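(* Let $n\ge1$ and let $\mathscr A$ be an arrangement of $d$ hyperplanes $H_1,\dots,H_d$ in the complex projective space $\mathbb P^n$, in general position with respect to hyperplanes and to quadrics, with respective orbifold multiplicities $m_i\in\mathbb Q_{\ge 1}\cup\{+\infty\}$, and let $\Delta=\sum_{i=1}^d(1-\tfrac1{m_i})H_i$ be the associated orbifold divisor. If $d\geq\binom{n+2}{2}$ and $m_i\geq 2n+2$ for all $i$, then the orbifold pair $(\mathbb P^n,\Delta)$ is Kobayashi-hyperbolic.
   Context: Everything is over $\mathbb C$. General position: each hyperplane of $\mathbb P^n$ is viewed as a point of the dual projective space. The arrangement is in general position with respect to hyperplanes if no $n+1$ of the corresponding $d$ points lie in a single hyperplane of the dual space; it is in general position with respect to quadrics if no $\binom{n+2}{2}$ of these points lie in a single quadric hypersurface of the dual space. Orbifold hyperbolicity: let $(X,\Delta)$ be an orbifold pair with $\Delta=\sum_i(1-\frac1{m_i})\Delta_i$ and $|\Delta|=\sum_i\Delta_i$. An orbifold map $h\colon\mathbb D\to(X,\Delta)$ from the unit disk is a holomorphic map $h\colon\mathbb D\to X$ such that $h(\mathbb D)\not\subset|\Delta|$ and $\mathrm{mult}_x(h^*\Delta_i)\ge m_i$ for all $i$ and all $x\in\mathbb D$ with $h(x)\in\Delta_i$ (so $h$ avoids $\Delta_i$ if $m_i=\infty$). The orbifold Kobayashi pseudo-distance $d_{(X,\Delta)}$ is the largest pseudo-distance on $X\setminus\lfloor\Delta\rfloor$ such that every orbifold map $\mathbb D\to(X,\Delta)$ is distance-decreasing with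 respect to the Poincaré distance on $\mathbb D$; here $\lfloor\Delta\rfloor$ is the union of the $\Delta_i$ with $m_i=\infty$. The pair $(X,\Delta)$ is Kobayashi-hyperbolic if $d_{(X,\Delta)}$ is a distance on $X\setminus\lfloor\Delta\rfloor$. *)

theory Defs
  imports "HOL-Complex_Analysis.Complex_Analysis"
begin

no_notation fps_nth (infixl "$" 75)

section \<open>Complex projective space\<close>

definition homog_rel :: "complex ^ 'k \<Rightarrow> complex ^ 'k \<Rightarrow> bool" where
  "homog_rel x y \<longleftrightarrow> x \<noteq> 0 \<and> y \<noteq> 0 \<and> (\<exists>c. x = c *s y)"

lemma homog_relE:
  assumes "homog_rel x y"
  obtains c where "c \<noteq> 0" "x \<noteq> 0" "y \<noteq> 0" "\<forall>i. x $ i = c * y $ i"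
proof -
  from assms obtain c where c: "x \<noteq> 0" "y \<noteq> 0" "x = c *s y"
    unfolding homog_rel_def by blast
  have "c \<noteq> 0"
    using c by (metis vector_smult_lzero)
  moreover have "x $ i = c * y $ i" for i
    using c(3) by simp
  ultimately show ?thesis
    using c(1,2) that by blast
qed

lemma part_equivp_homog_rel:
  "part_equivp (homog_rel :: complex ^ 'k \<Rightarrow> complex ^ 'k \<Rightarrow> bool)"
proof (rule part_equivpI)
  have "(vec 1 :: complex ^ 'k) \<noteq> 0"
    by (metis vec_component zero_index zero_neq_one)
  moreover have "(vec 1 :: complex ^ 'k) = 1 *s vec 1"
    by (rule vector_smult_lid[symmetric])
  ultimately show "\<exists>x::complex ^ 'k. homog_rel x x"
    unfolding homog_rel_def by blast
  show "symp (homog_rel :: complex ^ 'k \<Rightarrow> complex ^ 'k \<Rightarrow> bool)"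
  proof (rule sympI)
    fix x y :: "complex ^ 'k"
    assume "homog_rel x y"
    then obtain c where c: "c \<noteq> 0" "x \<noteq> 0" "y \<noteq> 0" "\<forall>i. x $ i = c * y $ i"
      by (metis homog_relE)
    have "y = inverse c *s x"
      unfolding vec_eq_iff using c(1,4) by simp
    with c(2,3) show "homog_rel y x"
      unfolding homog_rel_def by blast
  qed
  show "transp (homog_rel :: complex ^ 'k \<Rightarrow> complex ^ 'k \<Rightarrow> bool)"
  proof (rule transpI)
    fix x y z :: "complex ^ 'k"
    assume "homog_rel x y" "homog_rel y z"
    then show "homog_rel x z"
      unfolding homog_rel_def using vector_smult_assoc by blast
  qed
qed

text \<open>
  The projective space \<open>\<P>\<^sup>n\<close> with \<open>n + 1 = CARD('k)\<close>; the index type \<open>'k\<close> labels the homogeneous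
  coordinates.  The dual space is identified with the same type: the hyperplane
  \<open>\<Sum>i. a\<^sub>i x\<^sub>i = 0\<close> is the dual point \<open>[a]\<close>, and by symmetry a point \<open>[x]\<close> is also a hyperplane of
  the dual space.
\<close>

quotient_type 'k cproj = "(complex, 'k::finite) vec" / partial: homog_rel
  by (rule part_equivp_homog_rel)

lift_definition incident :: "'k::finite cproj \<Rightarrow> 'k cproj \<Rightarrow> bool"
  is "\<lambda>a x. (\<Sum>i\<in>UNIV. a $ i * x $ i) = 0"
proof -
  fix a b x y :: "complex ^ 'k"
  assume "homog_rel a b" "homog_rel x y"
  then obtain c d where c: "c \<noteq> 0" "\<forall>i. a $ i = c * b $ i"
    and d: "d \<noteq> 0" "\<forall>i. x $ i = d * y $ i"
    by (metis homog_relE)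
  have "(\<Sum>i\<in>UNIV. a $ i * x $ i) = (c * d) * (\<Sum>i\<in>UNIV. b $ i * y $ i)"
    unfolding sum_distrib_left by (rule sum.cong) (simp_all add: c d)
  with c(1) d(1) show "((\<Sum>i\<in>UNIV. a $ i * x $ i) = 0) = ((\<Sum>i\<in>UNIV. b $ i * y $ i) = 0)"
    by simp
qed

definition hyperplane :: "'k::finite cproj \<Rightarrow> 'k cproj set" where
  "hyperplane a = {x. incident a x}"

lift_definition on_quadric :: "complex ^ 'k ^ 'k \<Rightarrow> 'k::finite cproj \<Rightarrow> bool"
  is "\<lambda>Q x. (\<Sum>i\<in>UNIV. \<Sum>j\<in>UNIV. Q $ i $ j * x $ i * x $ j) = 0"
proof -
  fix Q :: "complex ^ 'k ^ 'k" and x y :: "complex ^ 'k"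
  assume "homog_rel x y"
  then obtain d where d: "d \<noteq> 0" "\<forall>i. x $ i = d * y $ i"
    by (metis homog_relE)
  have "(\<Sum>i\<in>UNIV. \<Sum>j\<in>UNIV. Q $ i $ j * x $ i * x $ j)
      = (d * d) * (\<Sum>i\<in>UNIV. \<Sum>j\<in>UNIV. Q $ i $ j * y $ i * y $ j)"
    unfolding sum_distrib_left by (intro sum.cong) (simp_all add: d)
  with d(1) show "((\<Sum>i\<in>UNIV. \<Sum>j\<in>UNIV. Q $ i $ j * x $ i * x $ j) = 0)
      = ((\<Sum>i\<in>UNIV. \<Sum>j\<in>UNIV. Q $ i $ j * y $ i * y $ j) = 0)"
    by simp
qed

text \<open>
  Quadric hypersurfaces are the zero sets of nonzero quadratic forms, equivalently of nonzero
  symmetric matrices; singular, reducible and non-reduced quadrics are included.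
\<close>

definition is_quadric :: "'k::finite cproj set \<Rightarrow> bool" where
  "is_quadric S \<longleftrightarrow> (\<exists>Q. Q \<noteq> 0 \<and> transpose Q = Q \<and> S = {x. on_quadric Q x})"

lift_definition chart_dom :: "'k \<Rightarrow> 'k::finite cproj \<Rightarrow> bool"
  is "\<lambda>j x. x $ j \<noteq> 0"
  by (metis homog_relE mult_eq_0_iff)

lift_definition affine_coord :: "'k \<Rightarrow> 'k \<Rightarrow> 'k::finite cproj \<Rightarrow> complex"
  is "\<lambda>j i x. x $ i / x $ j"
  by (metis homog_relE mult_divide_mult_cancel_left)

definition chart :: "'k::finite \<Rightarrow> 'k cproj set" where
  "chart j = {x. chart_dom j x}"

text \<open>Holomorphy of a map into \<open>\<P>\<^sup>n\<close> with respect to the standard atlas of affine charts.\<close>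

definition holomorphic_proj :: "(complex \<Rightarrow> 'k::finite cproj) \<Rightarrow> complex set \<Rightarrow> bool" where
  "holomorphic_proj h D \<longleftrightarrow>
     (\<forall>j. open {z \<in> D. h z \<in> chart j} \<and>
          (\<forall>i. (\<lambda>z. affine_coord j i (h z)) holomorphic_on {z \<in> D. h z \<in> chart j}))"


section \<open>Arrangements in general position\<close>

text \<open>
  An arrangement of \<open>d\<close> hyperplanes is a family \<open>H 1, \<dots>, H d\<close> of dual points.  With
  \<open>CARD('k) = n + 1\<close> the two bounds below are \<open>n + 1\<close> and \<open>(n + 2) choose 2\<close>.
\<close>

definition general_position_hyperplanes :: "nat \<Rightarrow> (nat \<Rightarrow> 'k::finite cproj) \<Rightarrow> bool" where
  "general_position_hyperplanes d H \<longleftrightarrow>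
     (\<forall>I \<subseteq> {1..d}. card I = CARD('k) \<longrightarrow> \<not> (\<exists>x. H ` I \<subseteq> hyperplane x))"

definition general_position_quadrics :: "nat \<Rightarrow> (nat \<Rightarrow> 'k::finite cproj) \<Rightarrow> bool" where
  "general_position_quadrics d H \<longleftrightarrow>
     (\<forall>I \<subseteq> {1..d}. card I = (CARD('k) + 1) choose 2 \<longrightarrow> \<not> (\<exists>S. is_quadric S \<and> H ` I \<subseteq> S))"


section \<open>Orbifold hyperbolicity\<close>

text \<open>
  An orbifold divisor \<open>\<Delta> = \<Sum>i=1..d. (1 - 1/m\<^sub>i) H\<^sub>i\<close> is given by the triple \<open>d, H, m\<close>.
\<close>

definition multiplicity_values :: "ereal set" where
  "multiplicity_values = insert \<infinity> {ereal q | q. q \<in> \<rat> \<and> 1 \<le> q}"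

definition orb_support :: "nat \<Rightarrow> (nat \<Rightarrow> 'k::finite cproj) \<Rightarrow> 'k cproj set" where
  "orb_support d H = (\<Union>i\<in>{1..d}. hyperplane (H i))"

definition orb_floor :: "nat \<Rightarrow> (nat \<Rightarrow> 'k::finite cproj) \<Rightarrow> (nat \<Rightarrow> ereal) \<Rightarrow> 'k cproj set" where
  "orb_floor d H m = (\<Union>i\<in>{i\<in>{1..d}. m i = \<infinity>}. hyperplane (H i))"

text \<open>
  On the chart \<open>x\<^sub>j \<noteq> 0\<close> the hyperplane \<open>[a]\<close> has the local equation \<open>\<Sum>i. a\<^sub>i x\<^sub>i / x\<^sub>j = 0\<close>.  The
  choices of a representative of \<open>[a]\<close> and of a chart around \<open>h z\<close> only change the pulled back
  equation by a nonvanishing holomorphic factor near \<open>z\<close>, hence do not affect its order at \<open>z\<close>.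
\<close>

definition local_equation :: "'k::finite cproj \<Rightarrow> 'k \<Rightarrow> 'k cproj \<Rightarrow> complex" where
  "local_equation a j x = (\<Sum>i\<in>UNIV. rep_cproj a $ i * affine_coord j i x)"

text \<open>
  The multiplicity at \<open>z\<close> of the pullback of the divisor \<open>hyperplane a\<close>.  It is only meaningful
  when the image of \<open>h\<close> does not lie in \<open>hyperplane a\<close>; it is then finite.
\<close>

definition pullback_mult :: "(complex \<Rightarrow> 'k::finite cproj) \<Rightarrow> 'k cproj \<Rightarrow> complex \<Rightarrow> int" where
  "pullback_mult h a z = zorder (\<lambda>w. local_equation a (SOME j. h z \<in> chart j) (h w)) z"

abbreviation unit_disk :: "complex set" where
  "unit_disk \<equiv> ball 0 1"

text \<open>
  Since multiplicities of pullbacks are finite, the last condition says that \<open>h\<close> avoids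
  \<open>hyperplane (H i)\<close> if \<open>m i = \<infinity>\<close>.
\<close>

definition orbifold_map ::
    "nat \<Rightarrow> (nat \<Rightarrow> 'k::finite cproj) \<Rightarrow> (nat \<Rightarrow> ereal) \<Rightarrow> (complex \<Rightarrow> 'k cproj) \<Rightarrow> bool" where
  "orbifold_map d H m h \<longleftrightarrow>
     holomorphic_proj h unit_disk \<and>
     \<not> h ` unit_disk \<subseteq> orb_support d H \<and>
     (\<forall>i\<in>{1..d}. \<forall>z\<in>unit_disk. h z \<in> hyperplane (H i) \<longrightarrow>
        m i \<le> ereal (of_int (pullback_mult h (H i) z)))"

text \<open>The Poincare distance, normalized to curvature \<open>-1\<close>.\<close>

definition poincare_dist :: "complex \<Rightarrow> complex \<Rightarrow> real" where
  "poincare_dist z w = 2 * artanh (cmod ((z - w) / (1 - cnj w * z)))"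

definition pseudo_distance_on :: "'a set \<Rightarrow> ('a \<Rightarrow> 'a \<Rightarrow> real) \<Rightarrow> bool" where
  "pseudo_distance_on S \<delta> \<longleftrightarrow>
     (\<forall>x\<in>S. \<delta> x x = 0) \<and>
     (\<forall>x\<in>S. \<forall>y\<in>S. 0 \<le> \<delta> x y \<and> \<delta> x y = \<delta> y x) \<and>
     (\<forall>x\<in>S. \<forall>y\<in>S. \<forall>z\<in>S. \<delta> x z \<le> \<delta> x y + \<delta> y z)"

definition orb_decreasing_pseudo_distance ::
    "nat \<Rightarrow> (nat \<Rightarrow> 'k::finite cproj) \<Rightarrow> (nat \<Rightarrow> ereal) \<Rightarrow> ('k cproj \<Rightarrow> 'k cproj \<Rightarrow> real) \<Rightarrow> bool" where
  "orb_decreasing_pseudo_distance d H m \<delta> \<longleftrightarrow>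
     pseudo_distance_on (- orb_floor d H m) \<delta> \<and>
     (\<forall>h. orbifold_map d H m h \<longrightarrow>
        (\<forall>z\<in>unit_disk. \<forall>w\<in>unit_disk. \<delta> (h z) (h w) \<le> poincare_dist z w))"

text \<open>
  The Kobayashi pseudo-distance is the largest such pseudo-distance.  This determines its values
  on the complement of \<open>orb_floor d H m\<close>, the only ones that matter.
\<close>

definition is_orb_kobayashi_distance ::
    "nat \<Rightarrow> (nat \<Rightarrow> 'k::finite cproj) \<Rightarrow> (nat \<Rightarrow> ereal) \<Rightarrow> ('k cproj \<Rightarrow> 'k cproj \<Rightarrow> real) \<Rightarrow> bool" where
  "is_orb_kobayashi_distance d H m \<delta> \<longleftrightarrow>
     orb_decreasing_pseudo_distance d H m \<delta> \<and>
     (\<forall>\<delta>'. orb_decreasing_pseudo_distance d H m \<delta>' \<longrightarrow>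
        (\<forall>x\<in>- orb_floor d H m. \<forall>y\<in>- orb_floor d H m. \<delta>' x y \<le> \<delta> x y))"

definition kobayashi_hyperbolic ::
    "nat \<Rightarrow> (nat \<Rightarrow> 'k::finite cproj) \<Rightarrow> (nat \<Rightarrow> ereal) \<Rightarrow> bool" where
  "kobayashi_hyperbolic d H m \<longleftrightarrow>
     (\<exists>\<delta>. is_orb_kobayashi_distance d H m \<delta> \<and> Metric_space (- orb_floor d H m) \<delta>)"

end

(*
An Ahlfors-Schwarz argument for an explicit negatively twisted 1-jet form. Put m = 2n + 2, let
l_1, ..., l_N be N = (n+2 choose 2) of the linear forms, f a local lift of an orbifold map.
Each l_i yields the covector (y, z) |-> l_i(f') l_i(y) - l_i(f) l_i(z) on C^(2n+2), which kills
(f, f'). General position with respect to quadrics says that the squares l_i^2 span the quadratic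
forms; so if (y, z) is killed by all covectors, then the symmetric tensor f' y - f z vanishes, and
(y, z) is a multiple of (f, f') when f and f' are independent. Hence 2n + 1 of the covectors, indexed
by some J, are independent, and the maximal minors of their matrix are the coordinates of (f, f')
times a form G_J(f, f') of bidegree (n, n). At a zero of l_i(f), of order at least m, the row of l_i
is O(|l_i(f)|^((m-1)/m)), so |G_J| prod_J |l_i(f)|^(-(m-1)/m) stays bounded. This quotient has degree
2n - (2n+1)^2/(2n+2) = -1/m < 0 in f: multiplied by |f|^(1/m) it is a metric of negative curvature.
After multiplication by exp(c sum_J (|l_i(f)|/|f|)^(2/m)) the curvature also controls the orbifold
derivatives, and the maximum principle bounds the metric by a constant times the Poincare metric.
Varying J bounds the length of the derivative, hence the Kobayashi pseudo-distance from below. It is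
finite because chains of orbifold discs w |-> x + w^M y join any two points.
*)
theory Submission
  imports Defs
begin

section \<open>Jet determinants\<close>

text \<open>The threshold 2n + 2 is dictated by degrees. Each of the 2n + 1 rows of G_J costs a
  denominator |l_i(f)|^((m-1)/m), so the quotient has degree 2n - (2n+1)(m-1)/m in f, negative
  exactly for m > 2n + 1. Negative degree leaves a positive power of |f|, whose logarithm has a
  positive Laplacian, while log |G_J| and log |l_i(f)| are harmonic off the zeros. This curvature
  alone does not dominate the metric. The exponential factor contributes the squared derivatives of
  the roots l_i(f)^(1/m), and these dominate G_J because each of its rows is controlled by such a
  root and its derivative. The obstacle is that the quotient is bounded but need not be continuous
  at the zeros of the l_i(f), where its supremum could be approached. The exponents are therefore
  perturbed by \<delta> > 0, which makes the weight vanish there; \<delta> tends to 0 only in the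
  final bound. Second order information is needed at a single point only, in a lift adapted to it,
  so pointwise expansions replace differential geometry.\<close>

definition bil :: "complex ^ 'b::finite \<Rightarrow> complex ^ 'b \<Rightarrow> complex" where
  "bil p x = (\<Sum>c\<in>UNIV. p $ c * x $ c)"

text \<open>The index type \<open>'k + 'k\<close> has 2n + 2 elements, so
  \<open>CARD('k + 'k)\<close> is both the dimension of the space of 1-jets and the threshold m for
  the multiplicities.\<close>

definition cpair :: "complex ^ 'k::finite \<Rightarrow> complex ^ 'k \<Rightarrow> complex ^ ('k + 'k)" where
  "cpair x y = (\<chi> b. case b of Inl c \<Rightarrow> x $ c | Inr c \<Rightarrow> y $ c)"

lemma cpair_nth [simp]: "cpair x y $ Inl c = x $ c" "cpair x y $ Inr c = y $ c"
  by (simp_all add: cpair_def)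

lemma sum_UNIV_Plus:
  fixes f :: "'a::finite + 'b::finite \<Rightarrow> 'c::comm_monoid_add"
  shows "(\<Sum>b\<in>UNIV. f b) = (\<Sum>c\<in>UNIV. f (Inl c)) + (\<Sum>c\<in>UNIV. f (Inr c))"
  by (simp add: UNIV_Plus_UNIV[symmetric] sum.Plus del: UNIV_Plus_UNIV)

lemma prod_UNIV_Plus:
  fixes f :: "'a::finite + 'b::finite \<Rightarrow> 'c::comm_monoid_mult"
  shows "(\<Prod>b\<in>UNIV. f b) = (\<Prod>c\<in>UNIV. f (Inl c)) * (\<Prod>c\<in>UNIV. f (Inr c))"
  by (simp add: UNIV_Plus_UNIV[symmetric] prod.Plus del: UNIV_Plus_UNIV)

lemma all_Plus: "(\<forall>b::'a + 'b. P b) \<longleftrightarrow> (\<forall>c. P (Inl c)) \<and> (\<forall>c. P (Inr c))"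
  by (metis sum.exhaust)

lemma bil_add [simp]: "bil p (x + y) = bil p x + bil p y"
  and bil_scale [simp]: "bil p (c *s x) = c * bil p x"
  and bil_diff [simp]: "bil p (x - y) = bil p x - bil p y"
  and bil_zero [simp]: "bil p 0 = 0"
  by (simp_all add: bil_def algebra_simps sum.distrib sum_distrib_left sum_subtractf)

lemma bil_uminus [simp]: "bil p (- x) = - bil p x"
  and bil_uminus_left [simp]: "bil (- p) x = - bil p x"
  by (simp_all add: bil_def sum_negf)

lemma bil_add_left [simp]: "bil (p + q) x = bil p x + bil q x"
  and bil_scale_left [simp]: "bil (c *s p) x = c * bil p x"
  and bil_zero_left [simp]: "bil 0 x = 0"
  and bil_diff_left [simp]: "bil (p - q) x = bil p x - bil q x"
  by (simp_all add: bil_def algebra_simps sum.distrib sum_distrib_left sum_subtractf)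

lemma bil_cpair [simp]: "bil (cpair p q) (cpair x y) = bil p x + bil q y"
  by (simp add: bil_def sum_UNIV_Plus)

lemma cpair_eq_0 [simp]: "cpair x y = 0 \<longleftrightarrow> x = 0 \<and> y = 0"
  by (simp add: vec_eq_iff all_Plus)

text \<open>\<open>bil\<close> is complex bilinear, so that pairings of holomorphic curves stay
  holomorphic; the Hermitian product of y with x is written \<open>bil (cnjv x) y\<close>.\<close>

definition cnjv :: "complex ^ 'k \<Rightarrow> complex ^ 'k::finite" where
  "cnjv x = (\<chi> c. cnj (x $ c))"

lemma cnjv_nth [simp]: "cnjv x $ c = cnj (x $ c)"
  by (simp add: cnjv_def)

lemma norm_vec_sq: "(norm (x :: complex ^ 'k::finite))^2 = (\<Sum>c\<in>UNIV. (cmod (x $ c))^2)"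
  by (simp add: norm_vec_def L2_set_def sum_nonneg)

lemma bil_cnjv_self: "bil (cnjv x) x = of_real ((norm x)^2)"
  unfolding bil_def norm_vec_sq of_real_sum
  by (rule sum.cong) (simp_all add: complex_norm_square[symmetric] mult.commute[of "cnj _"] del: of_real_power)

lemma norm_bil_le: "cmod (bil p x) \<le> norm p * norm x"
proof -
  have "cmod (bil p x) \<le> (\<Sum>c\<in>UNIV. cmod (p $ c) * cmod (x $ c))"
    unfolding bil_def by (rule order_trans[OF norm_sum]) (simp add: norm_mult)
  also have "\<dots> \<le> norm p * norm x"
    using L2_set_mult_ineq[of "\<lambda>c. cmod (p $ c)" "\<lambda>c. cmod (x $ c)" UNIV]
    by (simp add: norm_vec_def)
  finally show ?thesis .
qed

lemma norm_component_le: "norm (x $ i) \<le> norm x"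
  by (rule Finite_Cartesian_Product.norm_nth_le)

section \<open>The jet matrix and its determinant\<close>

text \<open>The index of the row added to the covectors.\<close>

abbreviation r0 :: "'k + 'k" where "r0 \<equiv> Inl undefined"

definition jet_row :: "complex ^ 'k::finite \<Rightarrow> complex ^ 'k \<Rightarrow> complex ^ 'k \<Rightarrow> complex ^ ('k + 'k)" where
  "jet_row p x v = cpair (bil p v *s p) (- bil p x *s p)"

text \<open>A free row \<open>\<theta>\<close> completes the 2n + 1 covectors to a square matrix: as
  a linear form in \<open>\<theta>\<close> the determinant has the maximal minors, up to sign, as
  coefficients.\<close>

definition jet_matrix :: "('k + 'k \<Rightarrow> complex ^ 'k::finite) \<Rightarrow> complex ^ 'k \<Rightarrow> complex ^ 'k
    \<Rightarrow> complex ^ ('k + 'k) \<Rightarrow> complex ^ ('k + 'k) ^ ('k + 'k)" where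
  "jet_matrix p x v \<theta> = (\<chi> a. if a = r0 then \<theta> else jet_row (p a) x v)"

text \<open>The form \<open>G\<^sub>J\<close>; the lemma \<open>det_jet_matrix\<close> below shows independence of the added row.\<close>

definition jet_det :: "('k + 'k \<Rightarrow> complex ^ 'k::finite) \<Rightarrow> complex ^ 'k \<Rightarrow> complex ^ 'k \<Rightarrow> complex" where
  "jet_det p x v = det (jet_matrix p x v (cpair (cnjv x) 0)) / of_real ((norm x)^2)"

lemma matrix_vector_bil: "(A *v x) $ i = bil (A $ i) x"
  by (simp add: matrix_vector_mult_def bil_def)

lemma bil_jet_row_self: "bil (jet_row p x v) (cpair x v) = 0"
  by (simp add: jet_row_def)

lemma det_eq_0_if_kernel:
  fixes A :: "complex ^ 'n ^ 'n"
  assumes "A *v x = 0" "x \<noteq> 0"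
  shows "det A = 0"
proof (rule ccontr)
  assume "det A \<noteq> 0"
  then obtain B where "B ** A = mat 1"
    using invertible_det_nz invertible_def by metis
  then have "x = B *v (A *v x)"
    by (metis matrix_vector_mul_assoc matrix_vector_mul_lid)
  with assms show False by simp
qed

lemma det_jet_matrix_row_add:
  "det (jet_matrix p x v (\<theta> + \<theta>')) = det (jet_matrix p x v \<theta>) + det (jet_matrix p x v \<theta>')"
  unfolding jet_matrix_def
  using det_row_add[of r0 "\<lambda>_. \<theta>" "\<lambda>_. \<theta>'" "\<lambda>a. jet_row (p a) x v"] by simp

lemma det_jet_matrix_row_scale:
  "det (jet_matrix p x v (c *s \<theta>)) = c * det (jet_matrix p x v \<theta>)"
  unfolding jet_matrix_def
  using det_row_mul[of r0 c "\<lambda>_. \<theta>" "\<lambda>a. jet_row (p a) x v"] by simp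

text \<open>All rows but the added one annihilate (x, v). Two added rows have a combination that
  annihilates it as well, so its determinant is zero; linearity in the added row then makes the
  determinant proportional to the value of that row on (x, v).\<close>

lemma det_jet_matrix:
  assumes "x \<noteq> 0"
  shows "det (jet_matrix p x v \<theta>) = bil \<theta> (cpair x v) * jet_det p x v"
proof -
  define \<theta>' where "\<theta>' = cpair (cnjv x) 0"
  define s where "s = bil \<theta> (cpair x v)"
  define s' where "s' = bil \<theta>' (cpair x v)"
  have s': "s' = of_real ((norm x)^2)"
    by (simp add: s'_def \<theta>'_def bil_cnjv_self)
  have "det (jet_matrix p x v (s' *s \<theta> + (- s) *s \<theta>')) = 0"
  proof (rule det_eq_0_if_kernel)
    show "jet_matrix p x v (s' *s \<theta> + (- s) *s \<theta>') *v cpair x v = 0"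
      by (simp add: vec_eq_iff matrix_vector_bil jet_matrix_def bil_jet_row_self s_def s'_def
          del: vector_sneg_minus1 vector_smult_lneg)
    show "cpair x v \<noteq> 0" using assms by simp
  qed
  then have "s' * det (jet_matrix p x v \<theta>) = s * det (jet_matrix p x v \<theta>')"
    by (simp only: det_jet_matrix_row_add det_jet_matrix_row_scale) simp
  moreover have "s' \<noteq> 0" using assms s' by simp
  ultimately show ?thesis
    unfolding jet_det_def s_def[symmetric] s'[symmetric] \<theta>'_def[symmetric]
    by (simp add: field_simps)
qed

section \<open>Homogeneity and shift invariance of the jet form\<close>

text \<open>Each of the m - 1 jet rows contributes a factor c, and one factor is lost because the
  added row takes a value c times as large on the scaled jet. The exponent m - 2 = 2n is the total
  degree.\<close>

lemma jet_det_scale: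
  assumes "x \<noteq> 0" "c \<noteq> 0"
  shows "jet_det p (c *s x) (c *s v) = c ^ (CARD('k + 'k) - 2) * jet_det p x (v :: complex ^ 'k::finite)"
proof -
  define \<theta> where "\<theta> = cpair (cnjv x) 0"
  have nz: "bil \<theta> (cpair x v) \<noteq> 0"
    using assms by (simp add: \<theta>_def bil_cnjv_self)
  have sc: "cpair (c *s x) (c *s v) = c *s cpair x v"
    by (simp add: vec_eq_iff all_Plus)
  have "jet_matrix p (c *s x) (c *s v) \<theta>
      = (\<chi> a. (if a = r0 then 1 else c) *s (jet_matrix p x v \<theta> $ a))"
    by (simp add: vec_eq_iff jet_matrix_def jet_row_def all_Plus)
  then have "det (jet_matrix p (c *s x) (c *s v) \<theta>)
      = (\<Prod>a\<in>UNIV. if a = (r0 :: 'k + 'k) then 1 else c) * det (jet_matrix p x v \<theta>)"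
    by (simp only: det_rows_mul vec_lambda_eta)
  also have "(\<Prod>a\<in>UNIV. if a = (r0 :: 'k + 'k) then 1 else c) = (\<Prod>a\<in>UNIV - {r0 :: 'k + 'k}. c)"
    by (subst prod.remove[of _ "r0"]) simp_all
  also have "\<dots> = c ^ (CARD('k + 'k) - 1)"
    by (simp add: card_Diff_singleton)
  finally have "bil \<theta> (cpair x v) * (c * jet_det p (c *s x) (c *s v))
      = bil \<theta> (cpair x v) * (c ^ (CARD('k + 'k) - 1) * jet_det p x v)"
    using assms by (simp add: det_jet_matrix sc mult_ac)
  then have "c * jet_det p (c *s x) (c *s v) = c ^ (CARD('k + 'k) - 1) * jet_det p x v"
    using nz by (metis mult_left_cancel)
  moreover have "CARD('k + 'k) - 1 = Suc (CARD('k + 'k) - 2)"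
    using zero_less_card_finite[where 'a = 'k] by (simp del: zero_less_card_finite)
  ultimately show ?thesis using assms by (simp add: mult.assoc)
qed

text \<open>Scaling v scales the \<open>Inl\<close> columns of the jet rows. Scaling also the added
  row, which is zero in the other columns, turns this into a scaling of n + 1 whole columns;
  removing the extra factor leaves the exponent n.\<close>

lemma jet_det_scale_tangent:
  assumes "x \<noteq> 0" "c \<noteq> 0"
  shows "jet_det p x (c *s v) = c ^ (CARD('k) - 1) * jet_det p x (v :: complex ^ 'k::finite)"
proof -
  define \<theta> :: "complex ^ ('k + 'k)" where "\<theta> = cpair (cnjv x) 0"
  define e :: "'k + 'k \<Rightarrow> complex" where "e b = (case b of Inl _ \<Rightarrow> c | Inr _ \<Rightarrow> 1)" for b
  have nz: "bil \<theta> (cpair x v) \<noteq> 0"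
    using assms by (simp add: \<theta>_def bil_cnjv_self)
  have eq: "bil \<theta> (cpair x (c *s v)) = bil \<theta> (cpair x v)"
    by (simp add: \<theta>_def)
  have tr: "transpose (jet_matrix p x (c *s v) (c *s \<theta>))
      = (\<chi> b. e b *s (transpose (jet_matrix p x v \<theta>) $ b))"
    by (simp add: vec_eq_iff jet_matrix_def jet_row_def all_Plus transpose_def e_def \<theta>_def)
  have "det (jet_matrix p x (c *s v) (c *s \<theta>)) = det (transpose (jet_matrix p x (c *s v) (c *s \<theta>)))"
    by (simp add: det_transpose)
  also have "\<dots> = prod e UNIV * det (transpose (jet_matrix p x v \<theta>))"
    unfolding tr by (simp only: det_rows_mul vec_lambda_eta)
  also have "prod e UNIV = c ^ CARD('k)"
    by (simp add: prod_UNIV_Plus e_def)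
  finally have "bil \<theta> (cpair x v) * (c * jet_det p x (c *s v))
      = bil \<theta> (cpair x v) * (c ^ CARD('k) * jet_det p x v)"
    using assms by (simp add: det_jet_matrix det_transpose eq mult_ac)
  then have "c * jet_det p x (c *s v) = c ^ CARD('k) * jet_det p x v"
    using nz by (metis mult_left_cancel)
  moreover have "CARD('k) = Suc (CARD('k) - 1)" by simp
  ultimately have "c * jet_det p x (c *s v) = c * (c ^ (CARD('k) - 1) * jet_det p x v)"
    by (metis power_Suc mult.assoc)
  then show ?thesis using assms by simp
qed

text \<open>Unipotent matrix for the passage from v to v + c x: it acts on jet rows from the right,
  because their second block is - l(x) l.\<close>

definition shear :: "complex \<Rightarrow> complex ^ ('k + 'k) ^ ('k::finite + 'k)" where
  "shear c = (\<chi> b. case b of Inl d \<Rightarrow> cpair (axis d 1) 0 | Inr d \<Rightarrow> cpair ((- c) *s axis d 1) (axis d 1))"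

lemma vec_mult_shear: "cpair y (z :: complex ^ 'k::finite) v* shear c = cpair (y - c *s z) z"
proof -
  have *: "(\<Sum>d\<in>UNIV. y $ d * axis d 1 $ e) = y $ e" for e and y :: "complex ^ 'k"
    by (simp add: axis_def if_distrib cong: if_cong)
  then have "(\<Sum>d\<in>UNIV. axis d 1 $ e * z $ d) = z $ e" for e and z :: "complex ^ 'k"
    by (simp add: mult.commute)
  then have "(\<Sum>d\<in>UNIV. c * (axis d 1 $ e * z $ d)) = c * z $ e" for e and c :: complex and z :: "complex ^ 'k"
    by (metis (no_types) sum_distrib_left)
  moreover note *
  ultimately show ?thesis
    by (simp add: vec_eq_iff all_Plus vector_matrix_mult_def sum_UNIV_Plus shear_def mult_ac sum_negf)
qed

lemma row_matrix_mult: "(A ** B) $ i = (A $ i) v* (B :: complex ^ 'n ^ 'm)"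
  by (simp add: vec_eq_iff matrix_matrix_mult_def vector_matrix_mult_def mult_ac)

text \<open>Only the modulus matters. Conjugation by the reflection \<open>S\<close> turns
  \<open>shear c\<close> into its inverse \<open>shear (- c)\<close>, so the determinant equals its
  own inverse.\<close>

lemma norm_det_shear: "cmod (det (shear c :: complex ^ ('k + 'k) ^ ('k::finite + 'k))) = 1"
proof -
  define S :: "complex ^ ('k + 'k) ^ ('k + 'k)" where
    "S = (\<chi> b. case b of Inl d \<Rightarrow> cpair (axis d 1) 0 | Inr d \<Rightarrow> cpair 0 (- axis d 1))"
  have vS: "cpair y z v* S = cpair y (- z)" for y z
  proof -
    have "(\<Sum>d\<in>UNIV. y $ d * axis d 1 $ e) = y $ e" for e and y :: "complex ^ 'k"
      by (simp add: axis_def if_distrib cong: if_cong)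
    then show ?thesis
      by (simp add: vec_eq_iff all_Plus vector_matrix_mult_def sum_UNIV_Plus S_def mult_ac sum_negf)
  qed
  have m1: "(mat 1 :: complex ^ ('k + 'k) ^ ('k + 'k)) $ b
      = (case b of Inl d \<Rightarrow> cpair (axis d 1) 0 | Inr d \<Rightarrow> cpair 0 (axis d 1))" for b
    by (simp add: vec_eq_iff all_Plus mat_def axis_def split: sum.split)
  have SS: "S ** S = mat 1"
    unfolding vec_eq_iff[of "S ** S"] row_matrix_mult m1 all_Plus
    by (simp add: S_def) (simp add: S_def[symmetric] vS)
  have SP: "S ** shear c ** S = shear (- c)"
    unfolding vec_eq_iff[of "S ** shear c ** S"] row_matrix_mult all_Plus
    apply (simp add: S_def)
    apply (simp add: S_def[symmetric] vS vec_mult_shear)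
    apply (simp add: shear_def vec_eq_iff all_Plus)
    done
  have PP: "shear c ** shear (- c) = (mat 1 :: complex ^ ('k + 'k) ^ ('k + 'k))"
    unfolding vec_eq_iff[of "shear c ** shear (- c)"] row_matrix_mult all_Plus m1
    by (simp add: shear_def[of c] vec_mult_shear)
  have dS: "det S * det S = 1"
    using SS by (metis det_mul det_I)
  have "det (shear (- c) :: complex ^ ('k + 'k) ^ ('k + 'k)) = det (shear c :: complex ^ ('k + 'k) ^ ('k + 'k))"
    using SP dS by (metis (no_types, lifting) det_mul mult.assoc mult.commute mult.right_neutral)
  moreover have "det (shear c :: complex ^ ('k + 'k) ^ ('k + 'k)) * det (shear (- c) :: complex ^ ('k + 'k) ^ ('k + 'k)) = 1"
    using PP by (metis det_mul det_I)
  ultimately have "(cmod (det (shear c :: complex ^ ('k + 'k) ^ ('k + 'k))))^2 = 1"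
    by (metis norm_mult norm_one power2_eq_square)
  then show ?thesis
    by (metis norm_ge_zero power2_eq_1_iff neg_0_le_iff_le not_one_le_zero)
qed

text \<open>Jet rows change by right multiplication with \<open>shear c\<close>, which fixes the
  added row (conj x, 0). Hence the form lives, up to modulus, on tangent vectors of projective space
  and ignores the derivative of the factor between two lifts.\<close>

lemma norm_jet_det_shift:
  assumes "x \<noteq> 0"
  shows "cmod (jet_det p x (v + c *s x)) = cmod (jet_det p x (v :: complex ^ 'k::finite))"
proof -
  define \<theta> :: "complex ^ ('k + 'k)" where "\<theta> = cpair (cnjv x) 0"
  have nz: "bil \<theta> (cpair x v) \<noteq> 0"
    using assms by (simp add: \<theta>_def bil_cnjv_self)
  have th: "\<theta> v* shear c = \<theta>"
    by (simp add: \<theta>_def vec_mult_shear)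
  have row: "jet_row q x v v* shear c = jet_row q x (v + c *s x)" for q
    by (simp add: jet_row_def vec_mult_shear vec_eq_iff all_Plus algebra_simps)
  have "jet_matrix p x v \<theta> ** shear c = jet_matrix p x (v + c *s x) \<theta>"
    by (subst vec_eq_iff) (simp add: row_matrix_mult jet_matrix_def th row)
  then have "det (jet_matrix p x (v + c *s x) \<theta>) = det (jet_matrix p x v \<theta>) * det (shear c :: complex ^ ('k + 'k) ^ ('k + 'k))"
    by (metis det_mul)
  then have "bil \<theta> (cpair x v) * jet_det p x (v + c *s x)
      = bil \<theta> (cpair x v) * (jet_det p x v * det (shear c :: complex ^ ('k + 'k) ^ ('k + 'k)))"
    using assms by (simp add: det_jet_matrix \<theta>_def mult_ac)
  then have "jet_det p x (v + c *s x) = jet_det p x v * det (shear c :: complex ^ ('k + 'k) ^ ('k + 'k))"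
    using nz by (metis mult_left_cancel)
  then show ?thesis by (simp add: norm_mult norm_det_shear)
qed

lemma norm_det_le:
  fixes A :: "complex ^ 'n ^ 'n"
  assumes "\<And>i j. cmod (A $ i $ j) \<le> K i"
  shows "cmod (det A) \<le> fact CARD('n) * (\<Prod>i\<in>UNIV. K i)"
proof -
  have "cmod (det A) \<le> (\<Sum>\<pi> | \<pi> permutes (UNIV :: 'n set). cmod (of_int (sign \<pi>) * (\<Prod>i\<in>UNIV. A $ i $ \<pi> i)))"
    unfolding det_def by (rule norm_sum)
  also have "\<dots> \<le> (\<Sum>\<pi> | \<pi> permutes (UNIV :: 'n set). \<Prod>i\<in>UNIV. K i)"
  proof (rule sum_mono)
    fix \<pi> :: "'n \<Rightarrow> 'n"
    have "cmod (of_int (sign \<pi>)) = 1"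
      by (simp add: sign_def)
    then show "cmod (of_int (sign \<pi>) * (\<Prod>i\<in>UNIV. A $ i $ \<pi> i)) \<le> (\<Prod>i\<in>UNIV. K i)"
      by (simp add: norm_mult prod_norm[symmetric]) (rule prod_mono, simp add: assms)
  qed
  also have "\<dots> = fact CARD('n) * (\<Prod>i\<in>UNIV. K i)"
    by (simp add: card_permutations[of UNIV "CARD('n)"])
  finally show ?thesis .
qed

text \<open>A common bound \<open>R a\<close> for both values of a covector bounds its whole row.
  The added row contributes \<open>norm x\<close>, and the division by its square in
  \<open>jet_det\<close> explains the factor on the left.\<close>

lemma norm_jet_det_le:
  fixes p :: "'k + 'k \<Rightarrow> complex ^ 'k::finite"
  assumes "x \<noteq> 0" "\<And>a. norm (p a) \<le> B"
    and "\<And>a. a \<noteq> r0 \<Longrightarrow> cmod (bil (p a) x) \<le> R a" "\<And>a. a \<noteq> r0 \<Longrightarrow> cmod (bil (p a) v) \<le> R a"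
  shows "cmod (jet_det p x v) * norm x \<le> fact CARD('k + 'k) * B ^ (CARD('k + 'k) - 1) * (\<Prod>a\<in>UNIV - {r0}. R a)"
proof -
  have "cmod (det (jet_matrix p x v (cpair (cnjv x) 0)))
      \<le> fact CARD('k + 'k) * (\<Prod>a\<in>UNIV. if a = r0 then norm x else B * R a)"
  proof (rule norm_det_le)
    fix a b :: "'k + 'k"
    have *: "cmod (bil (p a) y) * cmod (p a $ c) \<le> B * R a" if "cmod (bil (p a) y) \<le> R a" for y c
    proof -
      have "cmod (p a $ c) \<le> B"
        using norm_component_le assms(2) by (rule order_trans)
      moreover have "0 \<le> R a" using that norm_ge_zero by (rule order_trans[rotated])
      ultimately show ?thesis
        using mult_mono[OF that, of "cmod (p a $ c)" B] by (simp add: mult.commute)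
    qed
    show "cmod (jet_matrix p x v (cpair (cnjv x) 0) $ a $ b) \<le> (if a = r0 then norm x else B * R a)"
      using norm_component_le[of x] by (cases b) (auto simp: jet_matrix_def jet_row_def norm_mult intro!: * assms)
  qed
  also have "(\<Prod>a\<in>UNIV. if a = r0 then norm x else B * R a)
      = norm x * (\<Prod>a\<in>UNIV - {r0}. B * R a)"
    by (subst prod.remove[of _ r0]) simp_all
  also have "(\<Prod>a\<in>UNIV - {r0}. B * R a) = B ^ (CARD('k + 'k) - 1) * (\<Prod>a\<in>UNIV - {r0}. R a)"
    by (simp add: prod.distrib card_Diff_singleton)
  finally show ?thesis
    using assms(1) unfolding jet_det_def
    by (simp add: norm_divide norm_power norm_mult divide_simps power2_eq_square mult_ac)
qed

section \<open>Positivity of the jet forms\<close>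

text \<open>Dual form of the statement that the squares of the l_i span the quadratic forms: a
  symmetric tensor Q pairs with the square of l_i to Q(l_i, l_i), so no nonzero Q may be annihilated
  by all of them.\<close>

definition spans_quadrics :: "(nat \<Rightarrow> complex ^ 'k::finite) \<Rightarrow> nat \<Rightarrow> bool" where
  "spans_quadrics l N \<longleftrightarrow> (\<forall>Q. transpose Q = Q \<longrightarrow>
     (\<forall>i\<in>{1..N}. (\<Sum>a\<in>UNIV. \<Sum>b\<in>UNIV. Q $ a $ b * l i $ a * l i $ b) = 0) \<longrightarrow> Q = 0)"

text \<open>The condition on y removes the multiples of (x, v), which always lie in the kernel;
  independence of x and v enters as orthonormality.\<close>

lemma jet_rows_kernel:
  fixes x v y z :: "complex ^ 'k::finite"
  assumes sp: "spans_quadrics l N"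
    and x: "norm x = 1" and v: "norm v = 1" and xv: "bil (cnjv x) v = 0"
    and ker: "\<And>i. i \<in> {1..N} \<Longrightarrow> bil (jet_row (l i) x v) (cpair y z) = 0"
    and xy: "bil (cnjv x) y = 0"
  shows "y = 0 \<and> z = 0"
proof -
  \<comment> \<open>The polarized tensor v y - x z: on (p, p) it is twice the value of the jet row
    of p on (y, z).\<close>
  define Q :: "complex ^ 'k ^ 'k" where
    "Q = (\<chi> a b. v $ a * y $ b + v $ b * y $ a - x $ a * z $ b - x $ b * z $ a)"
  have Qbil: "(\<Sum>a\<in>UNIV. \<Sum>b\<in>UNIV. Q $ a $ b * p $ a * q $ b)
      = bil p v * bil q y + bil p y * bil q v - bil p x * bil q z - bil p z * bil q x" for p q
    unfolding bil_def sum_product sum.distrib[symmetric] sum_subtractf[symmetric]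
    by (intro sum.cong refl) (simp add: Q_def algebra_simps)
  have "(\<Sum>a\<in>UNIV. \<Sum>b\<in>UNIV. Q $ a $ b * l i $ a * l i $ b) = 0" if "i \<in> {1..N}" for i
    using ker[OF that] unfolding Qbil by (simp add: jet_row_def mult.commute)
  moreover have "transpose Q = Q"
    by (simp add: Q_def transpose_def vec_eq_iff)
  ultimately have "Q = 0"
    using sp unfolding spans_quadrics_def by blast
  then have pol: "bil p v * bil q y + bil q v * bil p y = bil p x * bil q z + bil q x * bil p z" for p q
    using Qbil[of p q] by (simp add: algebra_simps)
  have xx: "bil (cnjv x) x = 1" and vv: "bil (cnjv v) v = 1"
    using x v by (simp_all add: bil_cnjv_self)
  have vx: "bil (cnjv v) x = 0"
  proof -
    have "bil (cnjv v) x = cnj (bil (cnjv x) v)"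
      by (simp add: bil_def mult.commute)
    then show ?thesis using xv by simp
  qed
  have "bil (cnjv v) y = 0"
    using pol[of "cnjv v" "cnjv v"] vv vx by simp
  then have "bil q y = bil q x * bil (cnjv v) z" for q
    using pol[of "cnjv v" q] vv vx by simp
  then have qy: "bil q y = 0" for q
    using xx xy by (metis mult_zero_right mult_1)
  have axis: "bil (axis c 1) w = w $ c" for c and w :: "complex ^ 'k"
    by (simp add: bil_def axis_def if_distrib if_distribR cong: if_cong)
  have "y = 0"
    using qy axis by (simp add: vec_eq_iff) metis
  have "bil (cnjv x) z = 0"
    using pol[of "cnjv x" "cnjv x"] xx qy by simp
  then have "bil q z = 0" for q
    using pol[of "cnjv x" q] xx qy by simp
  then have "z = 0"
    using axis by (simp add: vec_eq_iff) metis
  with \<open>y = 0\<close> show ?thesis by simp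
qed

text \<open>A maximal independent subset of t and the rows, chosen to contain t, still has zero
  common kernel; so it has as many elements as the dimension and can be enumerated with t at the
  index \<open>a0\<close>.\<close>

lemma ex_square_of_spanning_rows:
  fixes t :: "complex ^ 'n" and R :: "(complex ^ 'n) set"
  assumes ker: "\<And>w. bil t w = 0 \<Longrightarrow> (\<And>r. r \<in> R \<Longrightarrow> bil r w = 0) \<Longrightarrow> w = 0" and "t \<noteq> 0"
  shows "\<exists>A. A $ a0 = t \<and> (\<forall>a. a \<noteq> a0 \<longrightarrow> A $ a \<in> R) \<and> det A \<noteq> 0"
proof -
  obtain B where B: "{t} \<subseteq> B" "B \<subseteq> insert t R" "vec.independent B" "insert t R \<subseteq> vec.span B"
    using vec.maximal_independent_subset_extend[of "{t}" "insert t R"] \<open>t \<noteq> 0\<close>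
    by (auto simp: vec.independent_insert)
  have kerB: "w = 0" if "\<And>b. b \<in> B \<Longrightarrow> bil b w = 0" for w
  proof (rule ker)
    have "vec.subspace {r. bil r w = 0}"
      by (simp add: vec.subspace_def)
    then have "vec.span B \<subseteq> {r. bil r w = 0}"
      using that by (intro vec.span_minimal) auto
    then have "bil r w = 0" if "r \<in> vec.span B" for r
      using that by blast
    then show "bil t w = 0" "\<And>r. r \<in> R \<Longrightarrow> bil r w = 0" using B(4) by auto
  qed
  have finB: "finite B"
    using B(3) vec.finiteI_independent by blast
  \<comment> \<open>With too few elements, padding by zero rows gives a singular square matrix,
    whose kernel vector contradicts \<open>kerB\<close>.\<close>
  have "vec.span B = UNIV"
  proof (rule ccontr)
    assume "vec.span B \<noteq> UNIV"
    then have lt: "card B < CARD('n)"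
      using B(3)
      by (metis (no_types, lifting) card_cart_basis order_le_imp_less_or_eq vec.dim_UNIV
          vec.dim_eq_card vec.dim_eq_full vec.dim_span vec.dim_subset_UNIV span_cart_basis)
    obtain f :: "complex ^ 'n \<Rightarrow> 'n" where f: "inj_on f B"
      using lt finB by (metis card_inj finite_class.finite_UNIV inj_on_iff_card_le order_less_imp_le)
    obtain c where c: "c \<notin> f ` B"
      using lt f by (metis UNIV_eq_I card_image less_irrefl)
    define A where "A = (\<chi> a. if a \<in> f ` B then inv_into B f a else (0 :: complex ^ 'n))"
    have "det A = 0"
      by (rule det_zero_row(1)[of c]) (simp add: row_def A_def c vec_eq_iff)
    then have "\<not> (\<exists>A'. A' ** A = mat 1)"
      by (simp add: invertible_left_inverse[symmetric] invertible_det_nz)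
    then obtain w where w: "A *v w = 0" "w \<noteq> 0"
      unfolding matrix_left_invertible_ker by blast
    have "bil b w = 0" if "b \<in> B" for b
    proof -
      have "bil (A $ f b) w = 0"
        using w(1) by (metis matrix_vector_bil zero_index)
      then show ?thesis using f that by (simp add: A_def)
    qed
    with kerB w show False by blast
  qed
  then have cardB: "card B = CARD('n)"
    using B(3) by (metis card_cart_basis vec.dim_UNIV vec.dim_eq_card vec.span_UNIV)
  have "t \<in> B" using B by simp
  have "card (B - {t}) = card (UNIV - {a0 :: 'n})"
    using cardB finB \<open>t \<in> B\<close> by simp
  then obtain f where f: "bij_betw f (UNIV - {a0}) (B - {t})"
    using finB finite_same_card_bij by (metis finite finite_Diff)
  define A where "A = (\<chi> a. if a = a0 then t else f a)"
  have "A $ a \<in> B" for a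
    using bij_betwE[OF f] \<open>t \<in> B\<close> by (auto simp: A_def)
  have "\<exists>a. A $ a = b" if "b \<in> B" for b
  proof (cases "b = t")
    case False
    then have "b \<in> f ` (UNIV - {a0})" using f that by (auto simp: bij_betw_def)
    then show ?thesis by (auto simp: A_def)
  qed (auto simp: A_def)
  then have "w = 0" if "A *v w = 0" for w
    using kerB[of w] that matrix_vector_bil[of A w] by (metis zero_index)
  then have "\<exists>A'. A' ** A = mat 1"
    unfolding matrix_left_invertible_ker by blast
  then have "det A \<noteq> 0"
    by (simp add: invertible_left_inverse[symmetric] invertible_det_nz)
  moreover have "A $ a \<in> R" if "a \<noteq> a0" for a
    using bij_betwE[OF f] B(2) that by (auto simp: A_def)
  ultimately show ?thesis
    by (intro exI[of _ A]) (auto simp: A_def)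
qed

text \<open>The row (conj x, 0) does not annihilate the remaining kernel direction (x, v) of the
  covectors, so together they contain the rows of a nonsingular matrix.\<close>

lemma ex_jet_det_nonzero:
  fixes x v :: "complex ^ 'k::finite"
  assumes "spans_quadrics l N" "norm x = 1" "norm v = 1" "bil (cnjv x) v = 0"
  shows "\<exists>\<iota>. range \<iota> \<subseteq> {1..N} \<and> jet_det (l \<circ> \<iota>) x v \<noteq> 0"
proof -
  define \<theta> :: "complex ^ ('k + 'k)" where "\<theta> = cpair (cnjv x) 0"
  have nz: "bil \<theta> (cpair x v) = 1"
    using assms by (simp add: \<theta>_def bil_cnjv_self)
  have "\<exists>A. A $ r0 = \<theta> \<and> (\<forall>a. a \<noteq> r0 \<longrightarrow> A $ a \<in> (\<lambda>i. jet_row (l i) x v) ` {1..N}) \<and> det A \<noteq> 0"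
  proof (rule ex_square_of_spanning_rows)
    fix w assume w: "bil \<theta> w = 0" "\<And>r. r \<in> (\<lambda>i. jet_row (l i) x v) ` {1..N} \<Longrightarrow> bil r w = 0"
    obtain y z where yz: "w = cpair y z"
      by (rule that[of "\<chi> c. w $ Inl c" "\<chi> c. w $ Inr c"]) (simp add: vec_eq_iff all_Plus)
    have "y = 0 \<and> z = 0"
      by (rule jet_rows_kernel[OF assms]) (use w in \<open>auto simp: yz \<theta>_def\<close>)
    then show "w = 0" by (simp add: yz)
  qed (use nz in auto)
  then obtain A where A: "A $ r0 = \<theta>" "\<forall>a. a \<noteq> r0 \<longrightarrow> A $ a \<in> (\<lambda>i. jet_row (l i) x v) ` {1..N}" "det A \<noteq> 0"
    by blast
  then have "\<forall>a. \<exists>i. a \<noteq> r0 \<longrightarrow> i \<in> {1..N} \<and> A $ a = jet_row (l i) x v"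
    by blast
  then obtain j where j: "\<And>a. a \<noteq> r0 \<Longrightarrow> j a \<in> {1..N} \<and> A $ a = jet_row (l (j a)) x v"
    by metis
  \<comment> \<open>An index besides \<open>r0\<close> yields a covector in the matrix, so {1..N} is
    nonempty and 1 can be the default value of \<open>\<iota>\<close> at \<open>r0\<close>.\<close>
  have "Inr undefined \<noteq> (r0 :: 'k + 'k)" by simp
  then have N: "1 \<in> {1..N}" using j by fastforce
  define \<iota> where "\<iota> a = (if a = r0 then 1 else j a)" for a
  have "A = jet_matrix (l \<circ> \<iota>) x v \<theta>"
    unfolding jet_matrix_def by (subst vec_eq_iff) (use A j in \<open>auto simp: \<iota>_def\<close>)
  then have "jet_det (l \<circ> \<iota>) x v \<noteq> 0"
    using A(3) det_jet_matrix[of x "l \<circ> \<iota>" v \<theta>] assms(2) nz by (cases "x = 0") auto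
  moreover have "range \<iota> \<subseteq> {1..N}"
    using j N by (auto simp: \<iota>_def)
  ultimately show ?thesis by blast
qed

lemma continuous_on_bil [continuous_intros]:
  "continuous_on S f \<Longrightarrow> continuous_on S (\<lambda>w. bil p (f w))"
  unfolding bil_def by (intro continuous_intros) 

lemma continuous_on_jet_det:
  fixes f g :: "'a::topological_space \<Rightarrow> complex ^ 'k::finite"
  assumes f: "continuous_on S f" and g: "continuous_on S g" and nz: "\<And>w. w \<in> S \<Longrightarrow> f w \<noteq> 0"
  shows "continuous_on S (\<lambda>w. jet_det p (f w) (g w))"
proof -
  have *: "continuous_on S (\<lambda>w. jet_matrix p (f w) (g w) (cpair (cnjv (f w)) 0) $ a $ b)" for a b
  proof (cases b)
    case (Inl c)
    show ?thesis
      by (cases "a = r0") (simp_all add: Inl jet_matrix_def jet_row_def, (intro continuous_intros f g)+)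
  next
    case (Inr c)
    show ?thesis
      by (cases "a = r0") (simp_all add: Inr jet_matrix_def jet_row_def, (intro continuous_intros f g)+)
  qed
  show ?thesis
    unfolding jet_det_def det_def by (intro * continuous_intros f) (simp_all add: nz)
qed

text \<open>Orthogonal projection of v off the line of x. Its norm divided by \<open>norm x\<close>
  is the Fubini-Study length of the tangent vector, which does not depend on the lift.\<close>

definition tangent_part :: "complex ^ 'k::finite \<Rightarrow> complex ^ 'k \<Rightarrow> complex ^ 'k" where
  "tangent_part x v = v - (bil (cnjv x) v / bil (cnjv x) x) *s x"

lemma norm_vector_scale: "norm (c *s (x :: complex ^ 'k::finite)) = cmod c * norm x"
proof -
  have "(norm (c *s x))^2 = (cmod c * norm x)^2"
    unfolding power_mult_distrib norm_vec_sq by (simp add: norm_mult power_mult_distrib sum_distrib_left)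
  then show ?thesis by (simp add: power2_eq_iff_nonneg)
qed

lemma bil_cnjv_self_eq_0 [simp]: "bil (cnjv x) x = 0 \<longleftrightarrow> x = 0"
  by (simp add: bil_cnjv_self)

lemma cnjv_zero [simp]: "cnjv 0 = 0"
  by (simp add: vec_eq_iff)

lemma bil_tangent_part: "bil (cnjv x) (tangent_part x v) = 0"
  by (cases "x = 0") (simp_all add: tangent_part_def cnjv_zero)

lemma tangent_part_decomp: "v = tangent_part x v + (bil (cnjv x) v / bil (cnjv x) x) *s x"
  by (simp add: tangent_part_def)

lemma cnjv_scale: "cnjv (c *s x) = cnj c *s cnjv x"
  by (simp add: vec_eq_iff)

text \<open>On orthonormal pairs the sum is continuous and positive, hence bounded below by
  compactness; shift invariance and bihomogeneity of degree (n, n) reduce every other jet to such a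
  pair.\<close>

lemma ex_jet_det_lower_bound:
  fixes l :: "nat \<Rightarrow> complex ^ 'k::finite"
  assumes sp: "spans_quadrics l N" and k: "CARD('k) \<ge> 2"
  shows "\<exists>c>0. \<forall>x v. x \<noteq> 0 \<longrightarrow> c * (norm x * norm (tangent_part x v)) ^ (CARD('k) - 1)
      \<le> (\<Sum>\<iota> | range \<iota> \<subseteq> {1..N}. cmod (jet_det (l \<circ> \<iota>) x v))"
proof -
  define F :: "('k + 'k \<Rightarrow> nat) set" where "F = {\<iota>. range \<iota> \<subseteq> {1..N}}"
  have "F = (UNIV \<rightarrow>\<^sub>E {1..N})" by (auto simp: F_def)
  then have finF: "finite F" by (simp add: finite_PiE)
  define s where "s w = (\<Sum>\<iota>\<in>F. cmod (jet_det (l \<circ> \<iota>) (fst w) (snd w)))" for w :: "(complex ^ 'k) \<times> (complex ^ 'k)"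
  define K :: "((complex ^ 'k) \<times> (complex ^ 'k)) set" where
    "K = (sphere 0 1 \<times> sphere 0 1) \<inter> {w. bil (cnjv (fst w)) (snd w) = 0}"
  have "compact K"
    unfolding K_def
  proof (intro compact_Int_closed compact_Times compact_sphere closed_Collect_eq continuous_intros)
    show "continuous_on UNIV (\<lambda>w :: (complex ^ 'k) \<times> (complex ^ 'k). bil (cnjv (fst w)) (snd w))"
      unfolding bil_def cnjv_nth by (intro continuous_intros)
  qed
  have spos: "s w > 0" if "w \<in> K" for w
  proof -
    have "norm (fst w) = 1" "norm (snd w) = 1" "bil (cnjv (fst w)) (snd w) = 0"
      using that by (auto simp: K_def)
    then obtain \<iota> where "\<iota> \<in> F" "jet_det (l \<circ> \<iota>) (fst w) (snd w) \<noteq> 0"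
      using ex_jet_det_nonzero[OF sp, of "fst w" "snd w"] unfolding F_def by blast
    then show ?thesis
      unfolding s_def by (intro sum_pos2[OF finF, of \<iota>]) auto
  qed
  have scont: "continuous_on K s"
    unfolding s_def by (intro continuous_intros continuous_on_jet_det) (auto simp: K_def)
  obtain c where c: "c > 0" "\<And>w. w \<in> K \<Longrightarrow> c \<le> s w"
  proof (cases "K = {}")
    case True
    then show ?thesis using that[of 1] by simp
  next
    case False
    then show ?thesis
      using continuous_attains_inf[OF \<open>compact K\<close> _ scont] spos that by metis
  qed
  have "c * (norm x * norm (tangent_part x v)) ^ (CARD('k) - 1) \<le> s (x, v)" if x: "x \<noteq> 0" for x v
  proof (cases "tangent_part x v = 0")
    case True
    \<comment> \<open>The exponent is positive because \<open>CARD('k)\<close> is at least 2, so the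
      left side vanishes.\<close>
    show ?thesis
      using k unfolding True norm_zero mult_zero_right s_def by (simp add: power_0_left sum_nonneg)
  next
    case False
    define \<rho> where "\<rho> = norm x"
    define t where "t = tangent_part x v"
    define T where "T = norm t"
    have pos: "\<rho> > 0" "T > 0" using x False by (simp_all add: \<rho>_def T_def t_def)
    define x1 where "x1 = complex_of_real (1 / \<rho>) *s x"
    define t1 where "t1 = complex_of_real (1 / T) *s t"
    have x1: "x = complex_of_real \<rho> *s x1" "x1 \<noteq> 0" and t1: "t = complex_of_real T *s t1"
      using pos by (simp_all add: x1_def t1_def \<rho>_def)
    have "(x1, t1) \<in> K"
      using pos by (auto simp: K_def x1_def t1_def norm_vector_scale \<rho>_def T_def norm_divide cnjv_scale
          bil_tangent_part t_def)
    have "cmod (jet_det p x v) = (\<rho> * T) ^ (CARD('k) - 1) * cmod (jet_det p x1 t1)" for p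
    proof -
      have "cmod (jet_det p x v) = cmod (jet_det p x t)"
        using tangent_part_decomp[of v x] norm_jet_det_shift[OF x] unfolding t_def by metis
      \<comment> \<open>Scaling the base point acts on the whole jet, so the tangent vector enters
        with length T / \<rho>.\<close>
      also have "t = complex_of_real \<rho> *s (complex_of_real (T / \<rho>) *s t1)"
        using pos by (simp add: t1)
      also have "cmod (jet_det p x \<dots>) = \<rho> ^ (CARD('k + 'k) - 2) * cmod (jet_det p x1 (complex_of_real (T / \<rho>) *s t1))"
        unfolding x1(1) by (subst jet_det_scale) (use pos x1 in \<open>auto simp: norm_mult norm_power\<close>)
      also have "cmod (jet_det p x1 (complex_of_real (T / \<rho>) *s t1)) = (T / \<rho>) ^ (CARD('k) - 1) * cmod (jet_det p x1 t1)"
        by (subst jet_det_scale_tangent) (use pos x1 in \<open>auto simp: norm_mult norm_power norm_divide\<close>)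
      also have "CARD('k + 'k) - 2 = (CARD('k) - 1) + (CARD('k) - 1)"
        using k by simp
      also have "\<rho> ^ (m + m) * ((T / \<rho>) ^ m * y) = (\<rho> * T) ^ m * y" for m y
        using pos by (simp add: power_add power_divide power_mult_distrib)
      finally show ?thesis .
    qed
    then have "s (x, v) = (\<rho> * T) ^ (CARD('k) - 1) * s (x1, t1)"
      by (simp add: s_def sum_distrib_left)
    then show ?thesis
      using c(2)[OF \<open>(x1, t1) \<in> K\<close>] pos by (simp add: \<rho>_def T_def t_def mult.commute mult_left_mono)
  qed
  with c(1) show ?thesis unfolding s_def F_def by auto
qed

section \<open>Second order expansions\<close>

text \<open>Every real quadratic polynomial in h is, up to its constant, Re (a h + b h^2) plus a
  multiple of |h|^2. Leaving a and b free isolates the Laplacian.\<close>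

abbreviation remainder2 :: "(complex \<Rightarrow> real) \<Rightarrow> complex \<Rightarrow> complex \<Rightarrow> complex \<Rightarrow> real \<Rightarrow> complex \<Rightarrow> real" where
  "remainder2 u z a b \<kappa> h \<equiv> (u (z + h) - u z - Re (a * h + b * h^2) - \<kappa> * (cmod h)^2) / (cmod h)^2"

text \<open>For a twice differentiable \<open>u\<close> the coefficient \<open>\<kappa>\<close> is a quarter of the Laplacian.\<close>

definition expands2 :: "(complex \<Rightarrow> real) \<Rightarrow> complex \<Rightarrow> real \<Rightarrow> bool" where
  "expands2 u z \<kappa> \<longleftrightarrow> (\<exists>a b. (remainder2 u z a b \<kappa> \<longlongrightarrow> 0) (at 0))"

text \<open>If \<kappa> were positive, Re (a h + b h^2) would be negative for all small nonzero h.
  But its values at t, -t, i t and -i t add up to 0.\<close>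

lemma expands2_local_max:
  assumes e: "expands2 u z \<kappa>" and max: "\<forall>\<^sub>F h in at 0. u (z + h) \<le> u z"
  shows "\<kappa> \<le> 0"
proof (rule ccontr)
  assume neg: "\<not> \<kappa> \<le> 0"
  obtain a b where lim: "(remainder2 u z a b \<kappa> \<longlongrightarrow> 0) (at 0)"
    using e unfolding expands2_def by blast
  have "\<forall>\<^sub>F h in at 0. - \<kappa> < (u (z + h) - u z - Re (a * h + b * h^2) - \<kappa> * (cmod h)^2) / (cmod h)^2"
    using order_tendstoD(1)[OF lim, of "- \<kappa>"] neg by simp
  moreover have "\<forall>\<^sub>F h in at (0::complex). h \<noteq> 0"
    by (simp add: eventually_at_filter)
  ultimately have "\<forall>\<^sub>F h in at 0. Re (a * h + b * h^2) < 0"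
    using max
  proof (eventually_elim)
    case (elim h)
    have "(cmod h)^2 > 0" using elim(2) by simp
    with elim(1) have "- \<kappa> * (cmod h)^2 < u (z + h) - u z - Re (a * h + b * h^2) - \<kappa> * (cmod h)^2"
      by (simp add: pos_less_divide_eq)
    with elim(3) show ?case by simp
  qed
  then obtain d where d: "d > 0" "\<And>h. h \<noteq> 0 \<Longrightarrow> cmod h < d \<Longrightarrow> Re (a * h + b * h^2) < 0"
    unfolding eventually_at by (auto simp: dist_norm)
  define t where "t = complex_of_real (d / 2)"
  have "Re (a * (t * w) + b * (t * w)^2) < 0" if "cmod w = 1" for w
    using d that by (intro d(2)) (auto simp: t_def norm_mult)
  from this[of 1] this[of "-1"] this[of \<i>] this[of "- \<i>"]
  show False by (simp add: power_mult_distrib power2_eq_square algebra_simps)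
qed

lemma expands2_cong:
  assumes "expands2 u z \<kappa>" "\<forall>\<^sub>F w in nhds z. u w = v w"
  shows "expands2 v z \<kappa>"
proof -
  obtain a b where lim: "(remainder2 u z a b \<kappa> \<longlongrightarrow> 0) (at 0)"
    using assms(1) unfolding expands2_def by blast
  have "((\<lambda>h. z + h) \<longlongrightarrow> z) (at 0)"
    by (auto intro!: tendsto_eq_intros)
  then have "filterlim (\<lambda>h. z + h) (nhds z) (at 0)" .
  then have ev: "\<forall>\<^sub>F h in at 0. u (z + h) = v (z + h)"
    using assms(2) by (rule eventually_compose_filterlim[rotated])
  have "u z = v z" using assms(2) by (rule eventually_nhds_x_imp_x)
  have "(remainder2 v z a b \<kappa> \<longlongrightarrow> 0) (at 0)"
    by (rule Lim_transform_eventually[OF lim]) (use ev \<open>u z = v z\<close> in \<open>auto elim!: eventually_mono\<close>)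
  then show ?thesis unfolding expands2_def by blast
qed

lemma expands2_add:
  assumes "expands2 u z \<kappa>" "expands2 v z \<mu>"
  shows "expands2 (\<lambda>w. u w + v w) z (\<kappa> + \<mu>)"
proof -
  obtain a b where 1: "(remainder2 u z a b \<kappa> \<longlongrightarrow> 0) (at 0)"
    using assms(1) unfolding expands2_def by blast
  obtain c d where 2: "(remainder2 v z c d \<mu> \<longlongrightarrow> 0) (at 0)"
    using assms(2) unfolding expands2_def by blast
  have "((\<lambda>h. (u (z + h) + v (z + h) - (u z + v z) - Re ((a + c) * h + (b + d) * h^2) - (\<kappa> + \<mu>) * (cmod h)^2) / (cmod h)^2) \<longlongrightarrow> 0) (at 0)"
    using tendsto_add[OF 1 2] by (simp add: add_divide_distrib[symmetric] algebra_simps)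
  then show ?thesis unfolding expands2_def by blast
qed

lemma expands2_const: "expands2 (\<lambda>_. c) z 0"
  unfolding expands2_def by (rule exI[of _ 0], rule exI[of _ 0]) simp

lemma expands2_cmult:
  assumes "expands2 u z \<kappa>"
  shows "expands2 (\<lambda>w. c * u w) z (c * \<kappa>)"
proof -
  obtain a b where 1: "(remainder2 u z a b \<kappa> \<longlongrightarrow> 0) (at 0)"
    using assms(1) unfolding expands2_def by blast
  have "((\<lambda>h. (c * u (z + h) - c * u z - Re ((of_real c * a) * h + (of_real c * b) * h^2) - c * \<kappa> * (cmod h)^2) / (cmod h)^2) \<longlongrightarrow> 0) (at 0)"
    using tendsto_mult_left[OF 1, of c] by (simp add: algebra_simps)
  then show ?thesis unfolding expands2_def by blast
qed

lemma expands2_sum: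
  assumes "\<And>i. i \<in> I \<Longrightarrow> expands2 (u i) z (\<kappa> i)"
  shows "expands2 (\<lambda>w. \<Sum>i\<in>I. u i w) z (\<Sum>i\<in>I. \<kappa> i)"
proof (cases "finite I")
  case True
  then show ?thesis using assms
    by (induction I rule: finite_induct) (simp_all add: expands2_const expands2_add)
qed (simp add: expands2_const)

text \<open>The power series beyond its quadratic term is h^3 times a function continuous at
  0.\<close>

lemma analytic_taylor2:
  assumes "q analytic_on {z}"
  obtains c where "((\<lambda>h. (q (z + h) - q z - deriv q z * h - c * h^2) / h^2) \<longlongrightarrow> 0) (at (0::complex))"
proof -
  obtain e where e: "e > 0" "q holomorphic_on ball z e"
    using assms by (meson analytic_at_ball)
  define c where "c = deriv (deriv q) z / 2"
  have ser: "\<forall>w\<in>ball z e. ((\<lambda>n. (deriv ^^ n) q z / fact n * (w - z) ^ n) sums q w)"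
    using holomorphic_power_series[OF e(2)] by blast
  define g where "g = (\<lambda>w. \<Sum>n. (deriv ^^ (n + 3)) q z / fact (n + 3) * w ^ n)"
  have sm: "(\<lambda>n. (deriv ^^ (n + 3)) q z / fact (n + 3) * h ^ n) sums
      ((q (z + h) - q z - deriv q z * h - c * h^2) / h ^ 3)" if "h \<noteq> 0" "cmod h < e" for h
  proof -
    have "(\<lambda>n. (deriv ^^ n) q z / fact n * h ^ n) sums q (z + h)"
      using ser[rule_format, of "z + h"] that by (simp add: dist_norm)
    then have "(\<lambda>n. (deriv ^^ (n + 3)) q z / fact (n + 3) * h ^ (n + 3)) sums
        (q (z + h) - (\<Sum>n<3. (deriv ^^ n) q z / fact n * h ^ n))"
      by (rule sums_split_initial_segment)
    then have "(\<lambda>n. (deriv ^^ (n + 3)) q z / fact (n + 3) * h ^ (n + 3) / h ^ 3) sums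
        ((q (z + h) - (\<Sum>n<3. (deriv ^^ n) q z / fact n * h ^ n)) / h ^ 3)"
      by (rule sums_divide)
    moreover have "(\<Sum>n<3. (deriv ^^ n) q z / fact n * h ^ n) = q z + deriv q z * h + c * h^2"
      by (simp add: numeral_3_eq_3 c_def power2_eq_square)
    moreover have "x * h ^ (n + 3) / h ^ 3 = x * h ^ n" for x n
      using that by (simp only: power_add) simp
    ultimately show ?thesis by (simp only: diff_diff_eq add.assoc)
  qed
  have sm': "summable (\<lambda>n. (deriv ^^ (n + 3)) q z / fact (n + 3) * complex_of_real (e / 2) ^ n)"
    using sm[of "of_real (e / 2)"] e(1) by (auto simp: sums_iff)
  have "isCont g 0"
    unfolding g_def using isCont_powser[OF sm', of 0] e(1) by simp
  then have "((\<lambda>h. h * g h) \<longlongrightarrow> 0 * g 0) (at 0)"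
    by (intro tendsto_mult tendsto_ident_at) (simp add: isCont_def)
  then have *: "((\<lambda>h. h * g h) \<longlongrightarrow> 0) (at 0)" by simp
  have "\<forall>\<^sub>F h in at 0. h * g h = (q (z + h) - q z - deriv q z * h - c * h^2) / h^2"
    unfolding eventually_at
  proof (intro exI[of _ e] conjI ballI impI e(1))
    fix h :: complex assume "h \<noteq> 0 \<and> dist h 0 < e"
    then have h: "h \<noteq> 0" "cmod h < e" by auto
    have "g h = (q (z + h) - q z - deriv q z * h - c * h^2) / h ^ 3"
      using sm[OF h] by (simp add: g_def sums_iff)
    then show "h * g h = (q (z + h) - q z - deriv q z * h - c * h^2) / h^2"
      using h by (simp add: power3_eq_cube power2_eq_square)
  qed
  from Lim_transform_eventually[OF * this] that show ?thesis by blast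
qed

lemma expands2_Re:
  assumes "q analytic_on {z}"
  shows "expands2 (\<lambda>w. Re (q w)) z 0"
proof -
  obtain c where c: "((\<lambda>h. (q (z + h) - q z - deriv q z * h - c * h^2) / h^2) \<longlongrightarrow> 0) (at (0::complex))"
    using analytic_taylor2[OF assms] by blast
  have "((\<lambda>h. (Re (q (z + h)) - Re (q z) - Re (deriv q z * h + c * h^2) - 0 * (cmod h)^2) / (cmod h)^2) \<longlongrightarrow> 0) (at 0)"
  proof (rule Lim_null_comparison[OF always_eventually tendsto_norm_zero[OF c]], rule allI)
    fix h
    have "\<bar>Re (q (z + h)) - Re (q z) - Re (deriv q z * h + c * h^2)\<bar> \<le> cmod (q (z + h) - q z - deriv q z * h - c * h^2)"
      using abs_Re_le_cmod[of "q (z + h) - q z - deriv q z * h - c * h^2"] by (simp add: algebra_simps)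
    then show "norm ((Re (q (z + h)) - Re (q z) - Re (deriv q z * h + c * h^2) - 0 * (cmod h)^2) / (cmod h)^2)
        \<le> norm ((q (z + h) - q z - deriv q z * h - c * h^2) / h^2)"
      by (simp add: norm_divide norm_power divide_right_mono)
  qed
  then show ?thesis unfolding expands2_def by blast
qed

text \<open>The logarithm of the modulus is the real part of a logarithm; division by
  \<open>q z\<close> moves the values close to 1, where \<open>Ln\<close> is analytic.\<close>

lemma expands2_ln_norm:
  assumes "q analytic_on {z}" "q z \<noteq> 0"
  shows "expands2 (\<lambda>w. ln (cmod (q w))) z 0"
proof -
  define g where "g w = Ln (q w / q z)" for w
  have "g analytic_on {z}"
    unfolding g_def using assms
    by (intro analytic_intros) auto
  then have "expands2 (\<lambda>w. ln (cmod (q z)) + Re (g w)) z (0 + 0)"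
    by (intro expands2_add expands2_const expands2_Re)
  moreover have "\<forall>\<^sub>F w in nhds z. q w \<noteq> 0"
    using assms analytic_at_imp_isCont continuous_within tendsto_imp_eventually_ne
    by (metis isCont_def tendsto_at_iff_tendsto_nhds)
  then have "\<forall>\<^sub>F w in nhds z. ln (cmod (q z)) + Re (g w) = ln (cmod (q w))"
    by eventually_elim (use assms in \<open>simp add: g_def norm_divide ln_div\<close>)
  ultimately show ?thesis using expands2_cong by force
qed

text \<open>In |q(z) + q'(z) h + c h^2 + r|^2 the only term of order two that is not the real part
  of a polynomial in h is |q'(z) h|^2.\<close>

lemma expands2_norm_sq:
  assumes "q analytic_on {z}"
  shows "expands2 (\<lambda>w. (cmod (q w))^2) z ((cmod (deriv q z))^2)"
proof -
  obtain c where c: "((\<lambda>h. (q (z + h) - q z - deriv q z * h - c * h^2) / h^2) \<longlongrightarrow> 0) (at (0::complex))"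
    using analytic_taylor2[OF assms] by blast
  define r where "r h = q (z + h) - q z - deriv q z * h - c * h^2" for h
  define A where "A h = q z + deriv q z * h + c * h^2" for h
  have q: "q (z + h) = A h + r h" for h by (simp add: r_def A_def)
  have id: "(cmod (q (z + h)))^2 - (cmod (q z))^2 - Re (2 * cnj (q z) * deriv q z * h + 2 * cnj (q z) * c * h^2) - (cmod (deriv q z))^2 * (cmod h)^2
      = Re (2 * deriv q z * h * cnj (c * h^2)) + (cmod (c * h^2))^2 + Re (2 * cnj (A h) * r h) + (cmod (r h))^2" for h
    unfolding q A_def cmod_power2 by (simp add: power2_eq_square algebra_simps)
  define R where "R = remainder2 (\<lambda>w. (cmod (q w))^2) z (2 * cnj (q z) * deriv q z) (2 * cnj (q z) * c) ((cmod (deriv q z))^2)"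
  define k where "k h = cmod (2 * deriv q z * c) * cmod h + (cmod c)^2 * (cmod h)^2 + 2 * cmod (A h) * cmod (r h / h^2) + cmod (r h / h^2) * cmod (r h)" for h
  have A0: "(A \<longlongrightarrow> q z) (at 0)"
    unfolding A_def by (auto intro!: tendsto_eq_intros)
  have r0: "((\<lambda>h. r h / h^2) \<longlongrightarrow> 0) (at 0)" using c unfolding r_def .
  have "\<forall>\<^sub>F h in at 0. r h / h^2 * h^2 = r h"
    by (auto simp: eventually_at_filter)
  moreover have "((\<lambda>h. r h / h^2 * h^2) \<longlongrightarrow> 0 * 0^2) (at 0)"
    by (intro tendsto_intros r0)
  ultimately have "(r \<longlongrightarrow> 0 * 0^2) (at 0)"
    by (rule Lim_transform_eventually[rotated])
  then have r00: "(r \<longlongrightarrow> 0) (at 0)" by simp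
  have "(k \<longlongrightarrow> cmod (2 * deriv q z * c) * 0 + (cmod c)^2 * 0^2 + 2 * cmod (q z) * 0 + 0 * 0) (at 0)"
    unfolding k_def
    by (intro tendsto_intros A0 tendsto_norm_zero r0 r00 tendsto_ident_at)
  then have k0: "(k \<longlongrightarrow> 0) (at 0)" by simp
  have "(R \<longlongrightarrow> 0) (at 0)"
  proof (rule Lim_null_comparison[OF _ k0])
    have "\<bar>R h\<bar> \<le> k h" if "h \<noteq> 0" for h
    proof -
      have "\<bar>Re (2 * deriv q z * h * cnj (c * h^2)) + (cmod (c * h^2))^2 + Re (2 * cnj (A h) * r h) + (cmod (r h))^2\<bar>
        \<le> cmod (2 * deriv q z * h * cnj (c * h^2)) + (cmod (c * h^2))^2 + cmod (2 * cnj (A h) * r h) + (cmod (r h))^2"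
        using abs_Re_le_cmod[of "2 * deriv q z * h * cnj (c * h^2)"] abs_Re_le_cmod[of "2 * cnj (A h) * r h"]
          zero_le_power2[of "cmod (c * h^2)"] zero_le_power2[of "cmod (r h)"] unfolding abs_le_iff by linarith
      also have "\<dots> = k h * (cmod h)^2"
        using that by (simp add: k_def norm_mult norm_power norm_divide field_simps power2_eq_square)
      finally show ?thesis
        using that unfolding R_def id by (simp add: pos_divide_le_eq)
    qed
    then show "\<forall>\<^sub>F h in at 0. norm (R h) \<le> k h"
      by (auto simp: eventually_at_filter)
  qed
  then show ?thesis unfolding expands2_def R_def by blast
qed

text \<open>The special case a = b = 0 of the expansion. Since there is no linear term, composition
  with a real function needs only its first derivative.\<close>

definition radial2 :: "(complex \<Rightarrow> real) \<Rightarrow> complex \<Rightarrow> real \<Rightarrow> bool" where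
  "radial2 s z \<mu> \<longleftrightarrow> ((\<lambda>h. (s (z + h) - s z) / (cmod h)^2) \<longlongrightarrow> \<mu>) (at 0)"

lemma radial2_imp_expands2:
  assumes "radial2 s z \<mu>"
  shows "expands2 s z \<mu>"
proof -
  have "((\<lambda>h. (s (z + h) - s z) / (cmod h)^2 - \<mu>) \<longlongrightarrow> \<mu> - \<mu>) (at 0)"
    using assms unfolding radial2_def by (intro tendsto_intros)
  moreover have "\<forall>\<^sub>F h in at 0. (s (z + h) - s z) / (cmod h)^2 - \<mu>
      = (s (z + h) - s z - Re (0 * h + 0 * h^2) - \<mu> * (cmod h)^2) / (cmod h)^2"
    by (auto simp: eventually_at_filter field_simps)
  ultimately have "(remainder2 s z 0 0 \<mu> \<longlongrightarrow> \<mu> - \<mu>) (at 0)"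
    by (rule Lim_transform_eventually)
  then show ?thesis unfolding expands2_def diff_self by blast
qed

lemma radial2_tendsto:
  assumes "radial2 s z \<mu>"
  shows "((\<lambda>h. s (z + h)) \<longlongrightarrow> s z) (at 0)"
proof -
  have "((\<lambda>h. (s (z + h) - s z) / (cmod h)^2 * (cmod h)^2 + s z) \<longlongrightarrow> \<mu> * (cmod 0)^2 + s z) (at 0)"
    using assms unfolding radial2_def by (intro tendsto_intros)
  moreover have "\<forall>\<^sub>F h in at 0. (s (z + h) - s z) / (cmod h)^2 * (cmod h)^2 + s z = s (z + h)"
    by (auto simp: eventually_at_filter)
  ultimately have "((\<lambda>h. s (z + h)) \<longlongrightarrow> \<mu> * (cmod 0)^2 + s z) (at 0)"
    by (rule Lim_transform_eventually)
  then show ?thesis by simp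
qed

lemma radial2_compose:
  assumes s: "radial2 s z \<mu>" and \<phi>: "(\<phi> has_real_derivative D) (at (s z))"
  shows "radial2 (\<lambda>w. \<phi> (s w)) z (D * \<mu>)"
proof -
  define q where "q t = (if t = s z then D else (\<phi> t - \<phi> (s z)) / (t - s z))" for t
  have "(q \<longlongrightarrow> D) (at (s z))"
    using \<phi> unfolding has_field_derivative_iff
    by (rule Lim_transform_eventually) (auto simp: eventually_at_filter q_def)
  then have "(q \<longlongrightarrow> q (s z)) (nhds (s z))"
    by (subst tendsto_at_iff_tendsto_nhds[symmetric]) (simp add: q_def)
  then have q: "((\<lambda>h. q (s (z + h))) \<longlongrightarrow> D) (at 0)"
    using filterlim_compose[OF _ radial2_tendsto[OF s]] by (force simp: q_def)
  have "((\<lambda>h. q (s (z + h)) * ((s (z + h) - s z) / (cmod h)^2)) \<longlongrightarrow> D * \<mu>) (at 0)"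
    using s unfolding radial2_def by (intro tendsto_intros q)
  moreover have "\<forall>\<^sub>F h in at 0. q (s (z + h)) * ((s (z + h) - s z) / (cmod h)^2)
      = (\<phi> (s (z + h)) - \<phi> (s z)) / (cmod h)^2"
    by (auto simp: eventually_at_filter q_def)
  ultimately show ?thesis
    unfolding radial2_def by (rule Lim_transform_eventually)
qed

lemma radial2_sum:
  assumes "\<And>i. i \<in> I \<Longrightarrow> radial2 (s i) z (\<mu> i)"
  shows "radial2 (\<lambda>w. \<Sum>i\<in>I. s i w) z (\<Sum>i\<in>I. \<mu> i)"
  using assms unfolding radial2_def sum_subtractf[symmetric] sum_divide_distrib
  by (intro tendsto_sum)

lemma radial2_norm_sq:
  assumes "q analytic_on {z}" "q z = 0"
  shows "radial2 (\<lambda>w. (cmod (q w))^2) z ((cmod (deriv q z))^2)"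
proof -
  have "(q has_field_derivative deriv q z) (at z)"
    using assms(1) analytic_on_imp_differentiable_at DERIV_deriv_iff_field_differentiable by blast
  then have "((\<lambda>h. (q (z + h) - q z) / h) \<longlongrightarrow> deriv q z) (at 0)"
    by (simp add: DERIV_def)
  then have "((\<lambda>h. (cmod ((q (z + h) - q z) / h))^2) \<longlongrightarrow> (cmod (deriv q z))^2) (at 0)"
    by (intro tendsto_intros)
  then show ?thesis
    by (simp add: radial2_def assms(2) norm_divide power_divide)
qed

text \<open>Write u s as s(z) u + u (s - s(z)): the last product is radial at z because u is
  continuous there.\<close>

lemma expands2_mult_radial2:
  assumes u: "expands2 u z \<kappa>" "isCont u z" and s: "radial2 s z \<mu>"
  shows "expands2 (\<lambda>w. u w * s w) z (\<kappa> * s z + u z * \<mu>)"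
proof -
  have "((\<lambda>h. u (z + h)) \<longlongrightarrow> u z) (at 0)"
    using u(2) by (simp add: isCont_iff)
  then have "((\<lambda>h. u (z + h) * ((s (z + h) - s z) / (cmod h)^2)) \<longlongrightarrow> u z * \<mu>) (at 0)"
    using s unfolding radial2_def by (intro tendsto_intros)
  then have "((\<lambda>h. ((u (z + h) * (s (z + h) - s z)) - u z * (s z - s z)) / (cmod h)^2) \<longlongrightarrow> u z * \<mu>) (at 0)"
    by simp
  then have "radial2 (\<lambda>w. u w * (s w - s z)) z (u z * \<mu>)"
    unfolding radial2_def .
  from expands2_add[OF expands2_cmult[OF u(1), of "s z"] radial2_imp_expands2[OF this]]
  show ?thesis by (simp add: algebra_simps)
qed

section \<open>Local lifts of curves\<close>

lemma homog_rel_refl: "homog_rel x x \<longleftrightarrow> x \<noteq> 0"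
  unfolding homog_rel_def by (metis vector_smult_lid)

lemma rep_cproj_nz [simp]: "rep_cproj a \<noteq> 0"
  using Quotient_rep_reflp[OF Quotient_cproj, of a] by (simp add: homog_rel_refl)

lemma abs_rep_cproj [simp]: "abs_cproj (rep_cproj a) = a"
  by (rule Quotient_abs_rep[OF Quotient_cproj])

lemma abs_cproj_eq_iff:
  assumes "x \<noteq> 0" "y \<noteq> 0"
  shows "abs_cproj x = abs_cproj y \<longleftrightarrow> (\<exists>c. x = c *s y)"
  using Quotient_rel[OF Quotient_cproj, of x y] assms homog_rel_refl unfolding homog_rel_def by metis

lemma cproj_cases:
  obtains x where "x \<noteq> 0" "a = abs_cproj x"
  by (metis abs_rep_cproj rep_cproj_nz)

lemma chart_abs [simp]: "x \<noteq> 0 \<Longrightarrow> abs_cproj x \<in> chart j \<longleftrightarrow> x $ j \<noteq> 0"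
  unfolding chart_def by (simp add: chart_dom.abs_eq homog_rel_refl)

lemma affine_coord_abs [simp]: "x \<noteq> 0 \<Longrightarrow> affine_coord j i (abs_cproj x) = x $ i / x $ j"
  by (simp add: affine_coord.abs_eq homog_rel_refl)

lemma hyperplane_abs [simp]: "x \<noteq> 0 \<Longrightarrow> abs_cproj x \<in> hyperplane a \<longleftrightarrow> bil (rep_cproj a) x = 0"
  unfolding hyperplane_def bil_def
  using incident.abs_eq[of "rep_cproj a" x] by (simp add: homog_rel_refl)

lemma on_quadric_rep: "on_quadric Q a \<longleftrightarrow> (\<Sum>i\<in>UNIV. \<Sum>j\<in>UNIV. Q $ i $ j * rep_cproj a $ i * rep_cproj a $ j) = 0"
  using on_quadric.abs_eq[of "rep_cproj a" Q] by (simp add: homog_rel_refl)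

lemma ex_chart: "\<exists>j. a \<in> chart j"
proof -
  obtain x where x: "x \<noteq> 0" "a = abs_cproj x" by (rule cproj_cases)
  then obtain j where "x $ j \<noteq> 0" by (metis vec_eq_iff zero_index)
  then show ?thesis using x by auto
qed

definition chart_lift :: "(complex \<Rightarrow> 'k::finite cproj) \<Rightarrow> 'k \<Rightarrow> complex \<Rightarrow> complex ^ 'k" where
  "chart_lift h j w = (\<chi> i. affine_coord j i (h w))"

text \<open>Germs of lifts suffice: the quantities to be maximized are unchanged under a change of
  lift, so no lift over the whole disc has to be constructed.\<close>

definition local_lift :: "(complex \<Rightarrow> 'k::finite cproj) \<Rightarrow> complex \<Rightarrow> (complex \<Rightarrow> complex ^ 'k) \<Rightarrow> bool" where
  "local_lift h z f \<longleftrightarrow> (\<forall>c. (\<lambda>w. f w $ c) analytic_on {z}) \<and> (\<forall>\<^sub>F w in nhds z. f w \<noteq> 0 \<and> h w = abs_cproj (f w))"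

definition vderiv :: "(complex \<Rightarrow> complex ^ 'k::finite) \<Rightarrow> complex \<Rightarrow> complex ^ 'k" where
  "vderiv f z = (\<chi> c. deriv (\<lambda>w. f w $ c) z)"

lemma analytic_at_imp_eventually_analytic:
  assumes "f analytic_on {z}"
  shows "\<forall>\<^sub>F w in nhds z. f analytic_on {w}"
proof -
  obtain s where s: "open s" "z \<in> s" "f holomorphic_on s"
    using assms analytic_at by blast
  then show ?thesis
    unfolding eventually_nhds using analytic_at by blast
qed

lemma eventually_local_lift:
  assumes "local_lift h z f"
  shows "\<forall>\<^sub>F w in nhds z. local_lift h w f"
proof -
  have "\<forall>\<^sub>F w in nhds z. \<forall>c. (\<lambda>w. f w $ c) analytic_on {w}"
    using assms by (intro eventually_all_finite analytic_at_imp_eventually_analytic) (simp add: local_lift_def)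
  moreover have "\<forall>\<^sub>F w in nhds z. \<forall>\<^sub>F w' in nhds w. f w' \<noteq> 0 \<and> h w' = abs_cproj (f w')"
    using assms unfolding local_lift_def eventually_eventually by blast
  ultimately show ?thesis
    unfolding local_lift_def by eventually_elim blast
qed

lemma local_lift_point:
  assumes "local_lift h z f"
  shows "f z \<noteq> 0" "h z = abs_cproj (f z)"
  using assms eventually_nhds_x_imp_x unfolding local_lift_def by blast+

lemma local_lift_chart:
  assumes h: "holomorphic_proj h D" and D: "open D" "z \<in> D" and j: "h z \<in> chart j"
  shows "local_lift h z (chart_lift h j)"
    and "\<forall>\<^sub>F w in nhds z. h w \<in> chart j"
proof -
  let ?U = "{z \<in> D. h z \<in> chart j}"
  have U: "open ?U" "z \<in> ?U" "\<And>i. (\<lambda>z. affine_coord j i (h z)) holomorphic_on ?U"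
    using assms unfolding holomorphic_proj_def by auto
  have "\<forall>\<^sub>F w in nhds z. w \<in> ?U"
    using U eventually_nhds by blast
  then show ev: "\<forall>\<^sub>F w in nhds z. h w \<in> chart j" by (rule eventually_mono) simp
  have "chart_lift h j w \<noteq> 0 \<and> h w = abs_cproj (chart_lift h j w)" if "h w \<in> chart j" for w
  proof -
    obtain x where x: "x \<noteq> 0" "h w = abs_cproj x" by (rule cproj_cases)
    then have xj: "x $ j \<noteq> 0" using that by simp
    have eq: "chart_lift h j w = inverse (x $ j) *s x"
      using affine_coord_abs[OF x(1)] unfolding vec_eq_iff chart_lift_def x(2)
      by (simp add: divide_inverse mult.commute)
    then have "chart_lift h j w \<noteq> 0" using x xj by simp
    moreover have "abs_cproj x = abs_cproj (chart_lift h j w)"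
      using abs_cproj_eq_iff[OF calculation x(1)] eq by metis
    ultimately show ?thesis using x by simp
  qed
  then show "local_lift h z (chart_lift h j)"
    unfolding local_lift_def using U ev analytic_at
    by (auto simp: chart_lift_def elim!: eventually_mono)
qed

lemma ex_local_lift:
  assumes "holomorphic_proj h D" "open D" "z \<in> D"
  shows "\<exists>f. local_lift h z f"
  using local_lift_chart[OF assms] ex_chart by blast

lemma isCont_eventually_nonzero:
  fixes f :: "'a::t2_space \<Rightarrow> 'b::{t1_space, zero}"
  shows "isCont f z \<Longrightarrow> f z \<noteq> 0 \<Longrightarrow> \<forall>\<^sub>F w in nhds z. f w \<noteq> 0"
  by (metis isCont_def tendsto_at_iff_tendsto_nhds tendsto_imp_eventually_ne)

text \<open>Two lifts differ by an analytic factor q, the quotient of components at an index where g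
  does not vanish; the product rule gives c = q(z) and d = q'(z).\<close>

lemma local_lift_unique:
  assumes f: "local_lift h z f" and g: "local_lift h z g"
  shows "\<exists>c d. c \<noteq> 0 \<and> f z = c *s g z \<and> vderiv f z = d *s g z + c *s vderiv g z"
proof -
  obtain a where a: "g z $ a \<noteq> 0"
    using local_lift_point(1)[OF g] by (metis vec_eq_iff zero_index)
  have fa: "(\<lambda>w. f w $ b) analytic_on {z}" and ga: "(\<lambda>w. g w $ b) analytic_on {z}" for b
    using f g unfolding local_lift_def by blast+
  define q where "q w = f w $ a / g w $ a" for w
  have q: "q analytic_on {z}"
    unfolding q_def using a by (intro analytic_intros fa ga) auto
  have "isCont (\<lambda>w. g w $ a) z"
    using ga analytic_at_imp_isCont by blast
  then have "\<forall>\<^sub>F w in nhds z. g w $ a \<noteq> 0"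
    using a by (rule isCont_eventually_nonzero)
  moreover have "\<forall>\<^sub>F w in nhds z. f w \<noteq> 0 \<and> h w = abs_cproj (f w)" "\<forall>\<^sub>F w in nhds z. g w \<noteq> 0 \<and> h w = abs_cproj (g w)"
    using f g unfolding local_lift_def by blast+
  ultimately have ev: "\<forall>\<^sub>F w in nhds z. f w = q w *s g w \<and> q w \<noteq> 0"
  proof eventually_elim
    case (elim w)
    then obtain c where c: "f w = c *s g w"
      using abs_cproj_eq_iff[of "f w" "g w"] by auto
    then have "c = q w" using elim by (simp add: q_def)
    with c elim show ?case by auto
  qed
  have d: "deriv (\<lambda>w. f w $ b) z = deriv q z * g z $ b + q z * deriv (\<lambda>w. g w $ b) z" for b
  proof -
    have "deriv (\<lambda>w. f w $ b) z = deriv (\<lambda>w. q w * g w $ b) z"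
      by (rule deriv_cong_ev) (use ev in \<open>auto elim!: eventually_mono\<close>)
    also have "\<dots> = q z * deriv (\<lambda>w. g w $ b) z + deriv q z * g z $ b"
      by (rule deriv_mult) (use q ga analytic_on_imp_differentiable_at in auto)
    finally show ?thesis by simp
  qed
  show ?thesis
    using eventually_nhds_x_imp_x[OF ev] d
    by (intro exI[of _ "q z"] exI[of _ "deriv q z"]) (auto simp: vderiv_def vec_eq_iff)
qed

text \<open>The substitution is the effect on a 1-jet of multiplying the lift by an analytic factor
  with value c and derivative d.\<close>

definition jet_invariant :: "(complex ^ 'k::finite \<Rightarrow> complex ^ 'k \<Rightarrow> 'b) \<Rightarrow> bool" where
  "jet_invariant \<Phi> \<longleftrightarrow> (\<forall>x v c d. x \<noteq> 0 \<longrightarrow> c \<noteq> 0 \<longrightarrow> \<Phi> (c *s x) (d *s x + c *s v) = \<Phi> x v)"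

text \<open>Intended for invariant \<Phi>, where the chosen lift is immaterial; this makes \<Phi> a
  function on the whole disc.\<close>

definition on_curve :: "(complex ^ 'k::finite \<Rightarrow> complex ^ 'k \<Rightarrow> 'b) \<Rightarrow> (complex \<Rightarrow> 'k cproj) \<Rightarrow> complex \<Rightarrow> 'b" where
  "on_curve \<Phi> h z = (let f = SOME f. local_lift h z f in \<Phi> (f z) (vderiv f z))"

lemma on_curve_eq:
  assumes "jet_invariant \<Phi>" and f: "local_lift h z f"
  shows "on_curve \<Phi> h z = \<Phi> (f z) (vderiv f z)"
proof -
  define g where "g = (SOME f. local_lift h z f)"
  have g: "local_lift h z g" unfolding g_def using f by (rule someI[of "local_lift h z"])
  have "f z \<noteq> 0" by (rule local_lift_point[OF f])
  then show ?thesis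
    using local_lift_unique[OF g f] assms(1)
    unfolding on_curve_def g_def[symmetric] Let_def jet_invariant_def by metis
qed

lemma eventually_on_curve_eq:
  assumes "jet_invariant \<Phi>" and f: "local_lift h z f"
  shows "\<forall>\<^sub>F w in nhds z. on_curve \<Phi> h w = \<Phi> (f w) (vderiv f w)"
  using eventually_local_lift[OF f] by eventually_elim (rule on_curve_eq[OF assms(1)])

lemma analytic_on_bil:
  "(\<And>c. (\<lambda>w. f w $ c) analytic_on S) \<Longrightarrow> (\<lambda>w. bil p (f w)) analytic_on S"
  unfolding bil_def by (intro analytic_intros)

lemma deriv_bil:
  assumes "\<And>c. (\<lambda>w. f w $ c) analytic_on {z}"
  shows "deriv (\<lambda>w. bil p (f w)) z = bil p (vderiv f z)"
proof -
  have "((\<lambda>w. f w $ c) has_field_derivative vderiv f z $ c) (at z)" for c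
    using analytic_on_imp_differentiable_at[OF assms] 
    by (simp add: vderiv_def DERIV_deriv_iff_field_differentiable)
  then have "((\<lambda>w. bil p (f w)) has_field_derivative bil p (vderiv f z)) (at z)"
    unfolding bil_def by (auto intro!: derivative_eq_intros simp: mult.commute)
  then show ?thesis by (rule DERIV_imp_deriv)
qed

text \<open>Dividing by the Hermitian product with the unit vector along f(z) makes g - g(z)
  orthogonal to g(z). Hence |g|^2 = 1 + |g - g(z)|^2 has no first order term at z.\<close>

lemma ex_normalized_lift:
  assumes f: "local_lift h z f"
  shows "\<exists>g. local_lift h z g \<and> norm (g z) = 1 \<and> (\<forall>\<^sub>F w in nhds z. bil (cnjv (g z)) (g w) = 1)"
proof -
  define x0 where "x0 = complex_of_real (1 / norm (f z)) *s f z"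
  define g where "g w = (1 / bil (cnjv x0) (f w)) *s f w" for w
  have fz: "f z \<noteq> 0" by (rule local_lift_point[OF f])
  have nz: "bil (cnjv x0) (f z) = of_real (norm (f z))"
    using fz unfolding x0_def cnjv_scale bil_scale_left bil_cnjv_self
    by (simp add: power2_eq_square)
  have gz: "g z = x0"
    unfolding g_def nz by (simp add: x0_def)
  have an: "(\<lambda>w. bil (cnjv x0) (f w)) analytic_on {z}"
    by (rule analytic_on_bil) (use f in \<open>simp add: local_lift_def\<close>)
  then have "isCont (\<lambda>w. bil (cnjv x0) (f w)) z"
    by (rule analytic_at_imp_isCont)
  then have ev: "\<forall>\<^sub>F w in nhds z. bil (cnjv x0) (f w) \<noteq> 0"
    by (rule isCont_eventually_nonzero) (use nz fz in simp)
  have "(\<lambda>w. g w $ c) analytic_on {z}" for c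
    unfolding g_def vector_smult_component
    by (intro analytic_intros an) (use f nz fz in \<open>auto simp: local_lift_def\<close>)
  moreover have "\<forall>\<^sub>F w in nhds z. f w \<noteq> 0 \<and> h w = abs_cproj (f w)"
    using f unfolding local_lift_def by blast
  with ev have "\<forall>\<^sub>F w in nhds z. g w \<noteq> 0 \<and> h w = abs_cproj (g w)"
  proof eventually_elim
    case (elim w)
    then have "g w \<noteq> 0" by (simp add: g_def)
    moreover have "abs_cproj (g w) = abs_cproj (f w)"
      using abs_cproj_eq_iff[OF calculation, of "f w"] elim by (auto simp: g_def)
    ultimately show ?case using elim by simp
  qed
  ultimately have "local_lift h z g" by (simp add: local_lift_def)
  moreover have "norm (g z) = 1"
    using fz by (simp add: gz x0_def norm_vector_scale norm_divide)
  moreover have "\<forall>\<^sub>F w in nhds z. bil (cnjv (g z)) (g w) = 1"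
    using ev unfolding gz by eventually_elim (simp add: g_def)
  ultimately show ?thesis by blast
qed

section \<open>The singular metric and its maximum points\<close>

text \<open>
  Since \<open>0 powr e = 0\<close>, this vanishes on the hyperplanes of \<open>p\<close>.  The correction \<open>\<delta> > 0\<close> makes it
  continuous there, so that its maximum points along a curve avoid these hyperplanes.
\<close>

definition jet_weight :: "('k + 'k \<Rightarrow> complex ^ 'k::finite) \<Rightarrow> real \<Rightarrow> complex ^ 'k \<Rightarrow> complex ^ 'k \<Rightarrow> real" where
  "jet_weight p \<delta> x v = cmod (jet_det p x v)
     * (\<Prod>a\<in>UNIV - {r0}. cmod (bil (p a) x) powr (\<delta> - (real CARD('k + 'k) - 1) / real CARD('k + 'k)))
     * norm x powr (1 / real CARD('k + 'k) - (real CARD('k + 'k) - 1) * \<delta>)"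

text \<open>For a local m-th root g of l_a(f) the summand is |g|^2 / |f|^(2/m), whose Laplacian
  contains |g'|^2, the squared derivative in the orbifold coordinate.\<close>

definition orb_potential :: "('k + 'k \<Rightarrow> complex ^ 'k::finite) \<Rightarrow> complex ^ 'k \<Rightarrow> real" where
  "orb_potential p x = (\<Sum>a\<in>UNIV - {r0}. (cmod (bil (p a) x) / norm x) powr (2 / real CARD('k + 'k)))"

declare card_UNIV_sum [simp del] card_sum [simp del]

lemma card_non_r0: "card (UNIV - {r0 :: 'k::finite + 'k}) = CARD('k + 'k) - 1"
  by (simp add: card_Diff_singleton)

lemma CARD_Plus_ge_2: "CARD('k::finite + 'k) \<ge> 2"
  using zero_less_card_finite[where 'a = 'k] by (simp add: card_UNIV_sum del: zero_less_card_finite)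

lemma norm_jet_det_change:
  assumes "x \<noteq> 0" "c \<noteq> 0"
  shows "cmod (jet_det p (c *s x) (d *s x + c *s v)) = cmod c ^ (CARD('k + 'k) - 2) * cmod (jet_det p x (v :: complex ^ 'k::finite))"
proof -
  have "d *s x + c *s v = c *s v + (d / c) *s (c *s x)"
    using assms by (simp add: vec_eq_iff)
  moreover have "c *s x \<noteq> 0" using assms by simp
  ultimately have "cmod (jet_det p (c *s x) (d *s x + c *s v)) = cmod (jet_det p (c *s x) (c *s v))"
    using norm_jet_det_shift[of "c *s x" p "c *s v" "d / c"] by metis
  also have "\<dots> = cmod c ^ (CARD('k + 'k) - 2) * cmod (jet_det p x v)"
    by (subst jet_det_scale[OF assms]) (simp only: norm_mult norm_power)
  finally show ?thesis .
qed

text \<open>The exponent of \<open>norm x\<close> is chosen to cancel degrees: m - 2 from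
  \<open>jet_det\<close>, (m - 1)(\<delta> - (m - 1)/m) from the linear forms and 1/m - (m - 1)
  \<delta> add up to 0.\<close>

lemma jet_invariant_jet_weight: "jet_invariant (jet_weight (p :: 'k + 'k \<Rightarrow> complex ^ 'k::finite) \<delta>)"
  unfolding jet_invariant_def
proof (intro allI impI)
  fix x v :: "complex ^ 'k" and c d :: complex
  assume x: "x \<noteq> 0" and c: "c \<noteq> 0"
  define m where "m = real CARD('k + 'k)"
  have m: "m \<ge> 2" using CARD_Plus_ge_2[where 'k = 'k] by (simp add: m_def)
  have nat: "real (CARD('k + 'k) - 2) = m - 2" "real (CARD('k + 'k) - 1) = m - 1"
    using CARD_Plus_ge_2[where 'k = 'k] by (simp_all add: m_def)
  define t where "t = cmod c"
  have t: "t > 0" using c by (simp add: t_def)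
  define e where "e = \<delta> - (m - 1) / m"
  define e' where "e' = 1 / m - (m - 1) * \<delta>"
  have "(\<Prod>a\<in>UNIV - {r0}. cmod (bil (p a) (c *s x)) powr e)
      = (\<Prod>a\<in>UNIV - {r0 :: 'k + 'k}. t powr e) * (\<Prod>a\<in>UNIV - {r0}. cmod (bil (p a) x) powr e)"
    by (simp add: norm_mult powr_mult t_def prod.distrib)
  also have "(\<Prod>a\<in>UNIV - {r0 :: 'k + 'k}. t powr e) = t powr (e * (m - 1))"
    unfolding prod_constant card_non_r0 nat(2)[symmetric]
    using t by (simp add: powr_realpow[symmetric] powr_powr)
  finally have p: "(\<Prod>a\<in>UNIV - {r0}. cmod (bil (p a) (c *s x)) powr e)
      = t powr (e * (m - 1)) * (\<Prod>a\<in>UNIV - {r0}. cmod (bil (p a) x) powr e)" .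
  have n: "norm (c *s x) powr e' = t powr e' * norm x powr e'"
    by (simp add: norm_vector_scale powr_mult t_def)
  have d: "cmod (jet_det p (c *s x) (d *s x + c *s v)) = t powr (m - 2) * cmod (jet_det p x v)"
    using norm_jet_det_change[OF x c] t unfolding nat(1)[symmetric] by (simp only: powr_realpow t_def)
  have "m - 2 + e * (m - 1) + e' = 0"
    using m by (simp add: e_def e'_def field_simps)
  then have "t powr (m - 2) * t powr (e * (m - 1)) * t powr e' = 1"
    using t by (simp add: powr_add[symmetric])
  then have "(t powr (m - 2) * j) * (t powr (e * (m - 1)) * q) * (t powr e' * y) = j * q * y" for j q y
    by algebra
  then show "jet_weight p \<delta> (c *s x) (d *s x + c *s v) = jet_weight p \<delta> x v"
    unfolding jet_weight_def m_def[symmetric] e_def[symmetric] e'_def[symmetric] p n d .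
qed

lemma jet_invariant_orb_potential: "jet_invariant (\<lambda>x v. orb_potential p x)"
  unfolding jet_invariant_def orb_potential_def by (simp add: norm_mult norm_vector_scale)

lemma jet_invariant_mult:
  "jet_invariant \<Phi> \<Longrightarrow> jet_invariant \<Psi> \<Longrightarrow> jet_invariant (\<lambda>x v. F (\<Phi> x v) (\<Psi> x v))"
  unfolding jet_invariant_def by metis

section \<open>Local computations at a maximum point\<close>

lemma inner_eq_Re_bil: "x \<bullet> (y :: complex ^ 'k::finite) = Re (bil (cnjv x) y)"
  by (simp add: inner_vec_def bil_def inner_complex_def)

lemma ex_local_root:
  assumes L: "L analytic_on {z}" "L z \<noteq> 0" and m: "m > 0"
  shows "\<exists>g. g analytic_on {z} \<and> (\<forall>\<^sub>F w in nhds z. g w ^ m = L w)"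
proof -
  define g where "g w = exp (Ln (L z) / of_nat m) * exp (Ln (L w / L z) / of_nat m)" for w
  have "g analytic_on {z}"
    unfolding g_def using assms by (intro analytic_intros) auto
  moreover have "\<forall>\<^sub>F w in nhds z. g w ^ m = L w"
    using isCont_eventually_nonzero[OF analytic_at_imp_isCont[OF L(1)] L(2)]
  proof eventually_elim
    case (elim w)
    show ?case
      using elim L(2) m by (simp add: g_def power_mult_distrib exp_of_nat_mult[symmetric])
  qed
  ultimately show ?thesis by blast
qed

lemma eventually_norm_less:
  assumes "cmod z < r"
  shows "\<forall>\<^sub>F w in nhds z. cmod w < r"
  using eventually_nhds_in_open[of "ball 0 r" z] assms by simp

text \<open>Let b be the Moebius map of the disc of radius r onto the unit disc with b(z) = 0, and D
  its denominator r^2 - conj(z) w. Then A (r^2 - |w|^2) = |D|^2 (1 - |b|^2), where log |D| is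
  harmonic and |b|^2 is radial at z.\<close>

lemma expands2_ln_disk:
  assumes r: "cmod z < r"
  shows "expands2 (\<lambda>w. ln (r^2 - (cmod w)^2)) z (- (r^2 / (r^2 - (cmod z)^2)^2))"
proof -
  define A where "A = r^2 - (cmod z)^2"
  have r0: "r > 0" using r norm_ge_zero[of z] by linarith
  have A: "A > 0" using r r0 by (simp add: A_def power_strict_mono)
  define D where "D w = of_real (r^2) - cnj z * w" for w
  have Dz: "D z = of_real A"
    by (simp add: D_def A_def mult.commute complex_norm_square[symmetric] del: of_real_power)
  define b where "b w = of_real r * (w - z) / D w" for w
  have D: "D analytic_on {z}" unfolding D_def by (intro analytic_intros)
  have Dnz: "D z \<noteq> 0" using A Dz by simp
  have b: "b analytic_on {z}" unfolding b_def by (intro analytic_intros D) (use Dnz in auto)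
  have dD: "(D has_field_derivative - cnj z) (at z)"
    unfolding D_def by (auto intro!: derivative_eq_intros)
  have "(b has_field_derivative of_real r / of_real A) (at z)"
  proof -
    have "((\<lambda>w. of_real r * (w - z) / D w) has_field_derivative of_real r / D z) (at z)"
      using Dnz by (auto intro!: derivative_eq_intros dD simp: power2_eq_square)
    then show ?thesis unfolding b_def Dz .
  qed
  then have db: "deriv b z = of_real r / of_real A" by (rule DERIV_imp_deriv)
  have rad: "radial2 (\<lambda>w. (cmod (b w))^2) z ((r / A)^2)"
    using radial2_norm_sq[OF b] r0 A by (simp add: b_def[of z] db norm_divide)
  have "((\<lambda>t. ln (1 - t)) has_real_derivative - 1) (at ((cmod (b z))^2))"
    by (auto intro!: derivative_eq_intros simp: b_def)
  from radial2_imp_expands2[OF radial2_compose[OF rad this]]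
  have e1: "expands2 (\<lambda>w. ln (1 - (cmod (b w))^2)) z (- 1 * (r / A)^2)" .
  have e2: "expands2 (\<lambda>w. 2 * ln (cmod (D w)) + ln (1 - (cmod (b w))^2) + - ln A) z (2 * 0 + - 1 * (r / A)^2 + 0)"
    by (intro expands2_add expands2_cmult expands2_const e1 expands2_ln_norm D Dnz)
  have id: "(cmod (D w))^2 - r^2 * (cmod (w - z))^2 = A * (r^2 - (cmod w)^2)" for w
    unfolding D_def A_def cmod_power2 by (simp add: power2_eq_square algebra_simps)
  from eventually_norm_less[OF r] isCont_eventually_nonzero[OF analytic_at_imp_isCont[OF D] Dnz]
  have "\<forall>\<^sub>F w in nhds z. 2 * ln (cmod (D w)) + ln (1 - (cmod (b w))^2) + - ln A = ln (r^2 - (cmod w)^2)"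
  proof eventually_elim
    case (elim w)
    have w: "r^2 - (cmod w)^2 > 0" using elim(1) r0 by (simp add: power_strict_mono)
    have "1 - (cmod (b w))^2 = A * (r^2 - (cmod w)^2) / (cmod (D w))^2"
      using elim(2) r0 unfolding id[symmetric]
      by (simp add: b_def norm_divide norm_mult power_divide power_mult_distrib diff_divide_distrib)
    then show ?case using elim(2) w A by (simp add: ln_div ln_mult ln_realpow)
  qed
  from expands2_cong[OF e2 this] show ?thesis by (simp add: A_def power_divide)
qed

lemma analytic_on_vderiv:
  assumes "\<And>c. (\<lambda>w. f w $ c) analytic_on S"
  shows "(\<lambda>w. vderiv f w $ c) analytic_on S"
  using analytic_deriv[OF assms, of c] by (simp add: vderiv_def)

lemma analytic_on_det_jet_matrix:
  assumes f: "\<And>c. (\<lambda>w. f w $ c) analytic_on S" and g: "\<And>c. (\<lambda>w. g w $ c) analytic_on S"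
  shows "(\<lambda>w. det (jet_matrix p (f w) (g w) \<theta>)) analytic_on S"
proof -
  have *: "(\<lambda>w. jet_matrix p (f w) (g w) \<theta> $ a $ b) analytic_on S" for a b
  proof (cases "a = r0")
    case False
    then show ?thesis
      by (cases b) (auto simp: jet_matrix_def jet_row_def intro!: analytic_intros analytic_on_bil f g)
  qed (simp add: jet_matrix_def)
  show ?thesis unfolding det_def by (intro analytic_intros *)
qed

text \<open>The function is |f|^2 for a lift normalized at z. For such a lift f'(z) is orthogonal to
  f(z), so the coefficient is the squared Fubini-Study speed.\<close>

lemma radial2_norm_normalized:
  fixes f :: "complex \<Rightarrow> complex ^ 'k::finite"
  assumes f: "\<And>c. (\<lambda>w. f w $ c) analytic_on {z}"
  shows "radial2 (\<lambda>w. 1 + (\<Sum>c\<in>UNIV. (cmod (f w $ c - f z $ c))^2)) z ((norm (vderiv f z))^2)"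
proof -
  have "radial2 (\<lambda>w. (cmod (f w $ c - f z $ c))^2) z ((cmod (vderiv f z $ c))^2)" for c
  proof -
    have an: "(\<lambda>w. f w $ c - f z $ c) analytic_on {z}" by (intro analytic_intros f)
    have "deriv (\<lambda>w. f w $ c - f z $ c) z = vderiv f z $ c"
      using f[of c, THEN analytic_on_imp_differentiable_at] by (simp add: vderiv_def)
    then show ?thesis using radial2_norm_sq[OF an] by simp
  qed
  from radial2_sum[of UNIV, OF this]
  show ?thesis unfolding norm_vec_sq by (simp add: radial2_def)
qed

lemma norm_sq_normalized:
  fixes x y :: "complex ^ 'k::finite"
  assumes "norm x = 1" "bil (cnjv x) y = 1"
  shows "(norm y)^2 = 1 + (\<Sum>c\<in>UNIV. (cmod (y $ c - x $ c))^2)"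
proof -
  have "x \<bullet> (y - x) = 0"
    using assms by (simp add: inner_eq_Re_bil bil_cnjv_self)
  then have "(norm (x + (y - x)))^2 = 1 + (norm (y - x))^2"
    using assms(1) by (simp only: norm_add_Pythagorean[of x "y - x"] orthogonal_def) simp
  then show ?thesis by (simp add: norm_vec_sq)
qed

lemma deriv_root:
  assumes g: "g analytic_on {z}" and ev: "\<forall>\<^sub>F w in nhds z. g w ^ m = L w"
  shows "deriv L z = of_nat m * g z ^ (m - 1) * deriv g z"
proof -
  have "(g has_field_derivative deriv g z) (at z)"
    using g analytic_on_imp_differentiable_at DERIV_deriv_iff_field_differentiable by blast
  then have "((\<lambda>w. g w ^ m) has_field_derivative of_nat m * g z ^ (m - 1) * deriv g z) (at z)"
    using DERIV_power[of g "deriv g z" z UNIV m] by (simp add: mult_ac)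
  then have "deriv (\<lambda>w. g w ^ m) z = of_nat m * g z ^ (m - 1) * deriv g z"
    by (rule DERIV_imp_deriv)
  moreover have "deriv (\<lambda>w. g w ^ m) z = deriv L z"
    by (rule deriv_cong_ev[OF ev]) simp
  ultimately show ?thesis by simp
qed

lemma power_powr_inverse:
  fixes t :: real
  assumes "t > 0" "m > 0"
  shows "(t ^ m) powr (s / real m) = t powr s"
  using assms by (simp add: powr_realpow[symmetric] powr_powr)

text \<open>The last factor vanishes on |w| = r and forces an interior maximum. The abbreviation is
  used with n = \<open>CARD('k) - 1\<close>, the degree of the weight in the derivative, as for the
  n-th power of a Poincare density.\<close>

abbreviation damped_weight :: "('k + 'k \<Rightarrow> complex ^ 'k::finite) \<Rightarrow> real \<Rightarrow> real \<Rightarrow> real \<Rightarrow> nat \<Rightarrow> (complex \<Rightarrow> complex ^ 'k) \<Rightarrow> complex \<Rightarrow> real" where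
  "damped_weight p \<delta> eps r n f w \<equiv> jet_weight p \<delta> (f w) (vderiv f w) * exp (eps * orb_potential p (f w)) * (r^2 - (cmod w)^2) ^ n"

text \<open>Near z the logarithm of the damped weight is the sum of the harmonic terms log |G| and
  log |l_a(f)|, a multiple of log |f|, the potential and the logarithm of the disc factor. The last
  three give the three lines of the inequality.\<close>

lemma expansion_at_max:
  fixes p :: "'k + 'k \<Rightarrow> complex ^ 'k::finite" and f :: "complex \<Rightarrow> complex ^ 'k"
  defines "m \<equiv> real CARD('k + 'k)" and "S \<equiv> UNIV - {r0 :: 'k + 'k}"
  assumes f: "\<And>c. (\<lambda>w. f w $ c) analytic_on {z}" and nf: "norm (f z) = 1"
    and nrm: "\<forall>\<^sub>F w in nhds z. bil (cnjv (f z)) (f w) = 1"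
    and g: "\<And>a. a \<in> S \<Longrightarrow> g a analytic_on {z}"
    and gL: "\<And>a. a \<in> S \<Longrightarrow> \<forall>\<^sub>F w in nhds z. g a w ^ CARD('k + 'k) = bil (p a) (f w)"
    and gnz: "\<And>a. a \<in> S \<Longrightarrow> g a z \<noteq> 0"
    and Gnz: "jet_det p (f z) (vderiv f z) \<noteq> 0"
    and r: "cmod z < r"
    and max: "\<forall>\<^sub>F w in nhds z. damped_weight p \<delta> eps r n f w
      \<le> damped_weight p \<delta> eps r n f z"
  shows "(1 / m - (m - 1) * \<delta>) / 2 * (norm (vderiv f z))^2
    + eps * (\<Sum>a\<in>S. (cmod (deriv (g a) z))^2 - (cmod (g a z))^2 * ((norm (vderiv f z))^2 / m))
    - real n * (r^2 / (r^2 - (cmod z)^2)^2) \<le> 0"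
proof -
  define x0 where "x0 = f z"
  define V where "V = (norm (vderiv f z))^2"
  define e where "e = \<delta> - (m - 1) / m"
  define e' where "e' = 1 / m - (m - 1) * \<delta>"
  define L where "L a w = bil (p a) (f w)" for a w
  \<comment> \<open>The added row is frozen at \<open>x0\<close> to keep the determinant
    holomorphic; by the normalization its value on the jet is 1, so |G| is still the modulus of
    \<open>jet_det\<close>.\<close>
  define G where "G w = det (jet_matrix p (f w) (vderiv f w) (cpair (cnjv x0) 0))" for w
  define N where "N w = 1 + (\<Sum>c\<in>UNIV. (cmod (f w $ c - x0 $ c))^2)" for w
  define F where "F w = damped_weight p \<delta> eps r n f w" for w
  define u where "u w = ln (cmod (G w)) + (\<Sum>a\<in>S. e * ln (cmod (L a w))) + e' / 2 * ln (N w)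
      + eps * (\<Sum>a\<in>S. (cmod (g a w))^2 * N w powr (- (1 / m))) + real n * ln (r^2 - (cmod w)^2)" for w
  have r0: "r > 0" using r norm_ge_zero[of z] by linarith
  have m: "m > 0" by (simp add: m_def)
  have CARDpos: "CARD('k + 'k) > 0" by simp
  have Nz: "N z = 1" by (simp add: N_def x0_def)
  have radN: "radial2 N z V"
    using radial2_norm_normalized[OF f] unfolding N_def x0_def V_def .
  have Lan: "L a analytic_on {z}" for a
    unfolding L_def by (rule analytic_on_bil) (rule f)
  have Lnz: "L a z \<noteq> 0" if "a \<in> S" for a
    using eventually_nhds_x_imp_x[OF gL[OF that]] gnz[OF that] by (metis L_def power_not_zero)
  have Gan: "G analytic_on {z}"
    unfolding G_def by (intro analytic_on_det_jet_matrix f analytic_on_vderiv)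
  have Gdet: "G w = bil (cnjv x0) (f w) * jet_det p (f w) (vderiv f w)" if "f w \<noteq> 0" for w
    unfolding G_def by (subst det_jet_matrix[OF that]) simp
  have Gz: "G z \<noteq> 0"
    using Gdet[of z] Gnz eventually_nhds_x_imp_x[OF nrm] nf by (cases "f z = 0") (auto simp: x0_def)
  have evL: "\<forall>\<^sub>F w in nhds z. \<forall>a\<in>S. L a w \<noteq> 0 \<and> g a w ^ CARD('k + 'k) = L a w"
    using isCont_eventually_nonzero[OF analytic_at_imp_isCont[OF Lan] Lnz] gL
    by (intro eventually_ball_finite ballI eventually_conj) (auto simp: S_def L_def)
  have evG: "\<forall>\<^sub>F w in nhds z. G w \<noteq> 0"
    by (rule isCont_eventually_nonzero[OF analytic_at_imp_isCont[OF Gan] Gz])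
  from eventually_norm_less[OF r] evL evG nrm have lnF: "\<forall>\<^sub>F w in nhds z. F w > 0 \<and> u w = ln (F w)"
  proof eventually_elim
    case (elim w)
    have fw: "f w \<noteq> 0" using elim(4) by auto
    have G: "cmod (G w) = cmod (jet_det p (f w) (vderiv f w))"
      using Gdet[OF fw] elim(4) by (simp add: x0_def)
    have nN: "(norm (f w))^2 = N w"
      unfolding N_def x0_def by (rule norm_sq_normalized[OF nf elim(4)])
    have gpos: "cmod (g a w) > 0" if "a \<in> S" for a
      using elim(2) that CARDpos by (metis power_eq_0_iff zero_less_norm_iff)
    have pot: "orb_potential p (f w) = (\<Sum>a\<in>S. (cmod (g a w))^2 * N w powr (- (1 / m)))"
      unfolding orb_potential_def S_def[symmetric]
    proof (rule sum.cong[OF refl])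
      fix a assume a: "a \<in> S"
      have gw: "cmod (bil (p a) (f w)) = cmod (g a w) ^ CARD('k + 'k)"
        using elim(2) a by (metis L_def norm_power)
      have 1: "cmod (bil (p a) (f w)) powr (2 / real CARD('k + 'k)) = (cmod (g a w))^2"
        unfolding gw power_powr_inverse[OF gpos[OF a] CARDpos] using gpos[OF a] by simp
      have "N w = norm (f w) powr 2"
        using fw nN by (simp add: powr_numeral)
      then have "N w powr (1 / m) = norm (f w) powr (2 / m)"
        by (simp only: powr_powr) simp
      then show "(cmod (bil (p a) (f w)) / norm (f w)) powr (2 / real CARD('k + 'k))
          = (cmod (g a w))^2 * N w powr (- (1 / m))"
        using 1 by (simp add: powr_divide powr_minus_divide m_def)
    qed
    have Lne: "\<not> (\<exists>a\<in>S. L a w = 0)" using elim(2) by blast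
    have Lpos: "cmod (L a w) powr e > 0" if "a \<in> S" for a using elim(2) that by simp
    have disk: "r^2 - (cmod w)^2 > 0" using elim(1) r0 by (simp add: power_strict_mono)
    have Ppos: "(\<Prod>a\<in>S. cmod (L a w) powr e) > 0" by (rule prod_pos) (use Lpos in auto)
    have F: "F w = cmod (G w) * (\<Prod>a\<in>S. cmod (L a w) powr e) * norm (f w) powr e'
        * exp (eps * (\<Sum>a\<in>S. (cmod (g a w))^2 * N w powr (- (1 / m)))) * (r^2 - (cmod w)^2) ^ n"
      unfolding F_def jet_weight_def pot G L_def e_def e'_def m_def S_def ..
    have lnN: "ln (N w) = 2 * ln (norm (f w))"
      using fw unfolding nN[symmetric] by (simp add: ln_realpow)
    have lnP: "ln (\<Prod>a\<in>S. cmod (L a w) powr e) = (\<Sum>a\<in>S. e * ln (cmod (L a w)))"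
      using Lpos elim(2) by (subst ln_prod) (auto simp: S_def ln_powr)
    have "F w > 0"
      unfolding F using elim(3) Ppos fw disk by (intro mult_pos_pos) auto
    moreover have "ln (F w) = u w"
      unfolding F u_def lnN lnP[symmetric] using elim(3) Ppos fw disk Lne
      by (simp add: ln_mult ln_realpow ln_powr)
    ultimately show ?case by simp
  qed
  have "\<forall>\<^sub>F w in nhds z. u w \<le> u z"
    using lnF max
  proof eventually_elim
    case (elim w)
    then show ?case
      using eventually_nhds_x_imp_x[OF lnF] by (simp add: F_def[symmetric])
  qed
  moreover have "filterlim (\<lambda>h. z + h) (nhds z) (at 0)"
    by (auto intro!: tendsto_eq_intros)
  ultimately have umax: "\<forall>\<^sub>F h in at 0. u (z + h) \<le> u z"
    by (rule eventually_compose_filterlim)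
  have eN: "expands2 (\<lambda>w. ln (N w)) z (1 * V)"
    by (intro radial2_imp_expands2 radial2_compose[OF radN]) (auto intro!: derivative_eq_intros simp: Nz)
  have rN: "radial2 (\<lambda>w. N w powr (- (1 / m))) z (- (1 / m) * V)"
    by (intro radial2_compose[OF radN]) (auto intro!: derivative_eq_intros simp: Nz)
  have eg: "expands2 (\<lambda>w. (cmod (g a w))^2 * N w powr (- (1 / m))) z
      ((cmod (deriv (g a) z))^2 * N z powr (- (1 / m)) + (cmod (g a z))^2 * (- (1 / m) * V))" if "a \<in> S" for a
    by (rule expands2_mult_radial2[OF expands2_norm_sq[OF g[OF that]] _ rN])
      (intro continuous_intros analytic_at_imp_isCont g that)
  have "expands2 u z (0 + (\<Sum>a\<in>S. e * 0) + e' / 2 * (1 * V)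
      + eps * (\<Sum>a\<in>S. (cmod (deriv (g a) z))^2 * N z powr (- (1 / m)) + (cmod (g a z))^2 * (- (1 / m) * V))
      + real n * (- (r^2 / (r^2 - (cmod z)^2)^2)))"
    unfolding u_def
    by (intro expands2_add expands2_cmult expands2_sum expands2_ln_norm expands2_ln_disk Gan Gz Lan Lnz eN eg r)
  from expands2_local_max[OF this umax] show ?thesis
    by (simp add: Nz e'_def V_def)
qed

text \<open>The outcome of the estimate at a maximum: n factors from the bound on the derivatives,
  m! from the Leibniz formula, and for each row a B from the entries of the covector, m B from its
  values and a B from the remaining power |l|^\<delta>.\<close>

definition weight_bound :: "nat \<Rightarrow> nat \<Rightarrow> real \<Rightarrow> real \<Rightarrow> real" where
  "weight_bound n m eps B = sqrt (real n / eps) ^ n * fact m * (real m * B ^ 3) ^ (m - 1)"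

lemma weight_bound_nonneg: "eps > 0 \<Longrightarrow> B \<ge> 1 \<Longrightarrow> 0 \<le> weight_bound n m eps B"
  by (simp add: weight_bound_def)

text \<open>The curvature of |f| absorbs the negative part of the potential, and what is left bounds
  the derivatives of the roots g_a. So every jet row is at most a multiple of |g_a|^(m-1), which the
  negative exponents of the weight compensate.\<close>

lemma jet_weight_at_max:
  fixes p :: "'k + 'k \<Rightarrow> complex ^ 'k::finite" and f :: "complex \<Rightarrow> complex ^ 'k"
  defines "m \<equiv> CARD('k + 'k)"
  assumes k: "CARD('k) \<ge> 2"
    and f: "\<And>c. (\<lambda>w. f w $ c) analytic_on {z}" and nf: "norm (f z) = 1"
    and nrm: "\<forall>\<^sub>F w in nhds z. bil (cnjv (f z)) (f w) = 1"
    and B: "B \<ge> 1" "\<And>a. norm (p a) \<le> B"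
    and pnz: "\<And>a. a \<noteq> r0 \<Longrightarrow> bil (p a) (f z) \<noteq> 0"
    and \<delta>: "0 \<le> \<delta>" "\<delta> \<le> 1 / (2 * real m * (real m - 1))"
    and eps: "eps > 0" "eps * (real m - 1) * B^2 \<le> 1 / 4"
    and r: "cmod z < r" "r \<le> 1"
    and max: "\<forall>\<^sub>F w in nhds z. damped_weight p \<delta> eps r (CARD('k) - 1) f w
      \<le> damped_weight p \<delta> eps r (CARD('k) - 1) f z"
  shows "jet_weight p \<delta> (f z) (vderiv f z) * (r^2 - (cmod z)^2) ^ (CARD('k) - 1)
    \<le> weight_bound (CARD('k) - 1) m eps B"
proof (cases "jet_det p (f z) (vderiv f z) = 0")
  case True
  then show ?thesis
    using B(1) eps by (simp add: jet_weight_def weight_bound_nonneg)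
next
  case Gnz: False
  define n where "n = CARD('k) - 1"
  define S where "S = UNIV - {r0 :: 'k + 'k}"
  have n: "n \<ge> 1" using k by (simp add: n_def)
  have m2: "m \<ge> 2" using CARD_Plus_ge_2[where 'k = 'k] by (simp add: m_def)
  have cardS: "card S = m - 1" by (simp add: S_def m_def card_non_r0)
  define v where "v = vderiv f z"
  define A where "A = r^2 - (cmod z)^2"
  have r0: "r > 0" using r norm_ge_zero[of z] by linarith
  have A: "A > 0" using r r0 by (simp add: A_def power_strict_mono)
  have "\<exists>g. g analytic_on {z} \<and> (\<forall>\<^sub>F w in nhds z. g w ^ m = bil (p a) (f w))" if "a \<in> S" for a
    by (rule ex_local_root) (use that pnz f m2 in \<open>auto simp: S_def intro: analytic_on_bil\<close>)
  then obtain g where g: "\<And>a. a \<in> S \<Longrightarrow> g a analytic_on {z}"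
      "\<And>a. a \<in> S \<Longrightarrow> \<forall>\<^sub>F w in nhds z. g a w ^ m = bil (p a) (f w)"
    by metis
  have gz: "g a z ^ m = bil (p a) (f z)" if "a \<in> S" for a
    using g(2)[OF that] by (rule eventually_nhds_x_imp_x)
  have gnz: "g a z \<noteq> 0" if "a \<in> S" for a
    using gz[OF that] pnz[of a] that m2 by (auto simp: S_def zero_power)
  have gB: "cmod (g a z) \<le> B" if "a \<in> S" for a
  proof (rule ccontr)
    assume "\<not> ?thesis"
    then have less: "B < cmod (g a z)" by simp
    have "cmod (g a z) \<le> cmod (g a z) ^ m"
      using less B(1) m2 by (intro self_le_power) auto
    also have "\<dots> = cmod (bil (p a) (f z))"
      using gz[OF that] by (metis norm_power)
    also have "\<dots> \<le> B" using norm_bil_le[of "p a" "f z"] B(2)[of a] nf by simp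
    finally show False using less by simp
  qed
  have dL: "bil (p a) v = of_nat m * g a z ^ (m - 1) * deriv (g a) z" if "a \<in> S" for a
    using deriv_root[OF g(1)[OF that] g(2)[OF that]] deriv_bil[OF f, of "p a"] by (simp add: v_def)
  define V where "V = (norm v)^2"
  have ineq: "(1 / real m - (real m - 1) * \<delta>) / 2 * V
    + eps * (\<Sum>a\<in>S. (cmod (deriv (g a) z))^2 - (cmod (g a z))^2 * (V / real m))
    - real n * (r^2 / A^2) \<le> 0"
    unfolding V_def v_def A_def m_def S_def n_def
    by (rule expansion_at_max[OF f nf nrm _ _ _ Gnz r(1) max])
      (use g gnz in \<open>auto simp: S_def m_def\<close>)
  \<comment> \<open>The hypothesis on \<open>eps\<close> bounds this negative part by V / (4 m); the
    hypothesis on \<delta> leaves at least V / (4 m) of curvature to absorb it.\<close>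
  have "(\<Sum>a\<in>S. (cmod (g a z))^2 * (V / real m)) \<le> (\<Sum>a\<in>S. B^2 * (V / real m))"
    using gB by (intro sum_mono mult_right_mono power_mono) (auto simp: V_def)
  also have "\<dots> = (real m - 1) * B^2 * (V / real m)"
    using m2 by (simp add: cardS)
  finally have "eps * (\<Sum>a\<in>S. (cmod (g a z))^2 * (V / real m)) \<le> eps * ((real m - 1) * B^2 * (V / real m))"
    by (rule mult_left_mono) (use eps in simp)
  also have "\<dots> = (eps * (real m - 1) * B^2) * (V / real m)" by simp
  also have "\<dots> \<le> 1 / 4 * (V / real m)"
    using eps(2) by (rule mult_right_mono) (simp add: V_def)
  finally have 1: "eps * (\<Sum>a\<in>S. (cmod (g a z))^2 * (V / real m)) \<le> V / (4 * real m)" by simp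
  have "(real m - 1) * \<delta> \<le> 1 / (2 * real m)"
  proof -
    have "(real m - 1) * \<delta> \<le> (real m - 1) * (1 / (2 * real m * (real m - 1)))"
      using \<delta>(2) by (rule mult_left_mono) (use m2 in simp)
    also have "\<dots> = 1 / (2 * real m)" using m2 by simp
    finally show ?thesis .
  qed
  moreover have "q / 2 \<le> (2 * q - y) / 2" if "y \<le> q" for y q :: real
    using that by simp
  moreover have "2 * (1 / (2 * real m)) = 1 / real m" "1 / (2 * real m) / 2 = 1 / (4 * real m)"
    by simp_all
  ultimately have "1 / (4 * real m) \<le> (1 / real m - (real m - 1) * \<delta>) / 2"
    by metis
  from mult_right_mono[OF this, of V]
  have 2: "V / (4 * real m) \<le> (1 / real m - (real m - 1) * \<delta>) / 2 * V" by (simp add: V_def)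
  have "eps * (\<Sum>a\<in>S. (cmod (deriv (g a) z))^2) \<le> real n * (r^2 / A^2)"
  proof -
    have "P \<le> R" if "T + (P - Q) - R \<le> 0" "Q \<le> W" "W \<le> T" for P Q R T W :: real
      using that by linarith
    from this[OF ineq[unfolded sum_subtractf right_diff_distrib[of eps]] 1 2] show ?thesis .
  qed
  also have "\<dots> \<le> real n * (1 / A^2)"
    using r0 r(2) by (intro mult_left_mono divide_right_mono) (auto simp: power_le_one)
  finally have sum_le: "(\<Sum>a\<in>S. (cmod (deriv (g a) z))^2) \<le> real n / (eps * A^2)"
    using eps(1) A by (simp add: field_simps)
  \<comment> \<open>A common bound for the derivatives of the roots. Its product with A is constant,
    which is why A^n cancels in the end.\<close>
  define s where "s = sqrt (real n / eps) / A"
  have s: "s > 0" using n eps(1) A by (simp add: s_def)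
  have s2: "s^2 = real n / (eps * A^2)"
    using eps(1) by (simp add: s_def power_divide)
  have dg: "cmod (deriv (g a) z) \<le> s" if "a \<in> S" for a
  proof -
    have "(cmod (deriv (g a) z))^2 \<le> (\<Sum>a\<in>S. (cmod (deriv (g a) z))^2)"
      using that by (intro member_le_sum) (auto simp: S_def)
    then have "(cmod (deriv (g a) z))^2 \<le> s^2" using sum_le s2 by simp
    then show ?thesis using s by (simp add: power2_le_iff_abs_le)
  qed
  \<comment> \<open>After division by s all root derivatives have size at most 1; homogeneity of
    degree n in the tangent vector restores s^n.\<close>
  define v1 where "v1 = complex_of_real (1 / s) *s v"
  have v: "v = complex_of_real s *s v1" using s by (simp add: v1_def)
  have fz: "f z \<noteq> 0" using nf by auto
  define R where "R a = real m * B * cmod (g a z) ^ (m - 1)" for a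
  have mB: "real m \<ge> 1" using m2 by simp
  have "cmod (jet_det p (f z) v1) * norm (f z) \<le> fact CARD('k + 'k) * B ^ (CARD('k + 'k) - 1) * (\<Prod>a\<in>UNIV - {r0}. R a)"
  proof (rule norm_jet_det_le[OF fz B(2)])
    fix a :: "'k + 'k" assume "a \<noteq> r0"
    then have a: "a \<in> S" by (simp add: S_def)
    have "cmod (bil (p a) (f z)) = cmod (g a z) * cmod (g a z) ^ (m - 1)"
      using power_minus_mult[of m "cmod (g a z)"] m2 unfolding gz[OF a, symmetric] norm_power by (simp add: mult.commute)
    also have "\<dots> \<le> (real m * B) * cmod (g a z) ^ (m - 1)"
      using gB[OF a] mB B(1) mult_mono[of 1 "real m" "cmod (g a z)" B] by (intro mult_right_mono) auto
    finally show "cmod (bil (p a) (f z)) \<le> R a" by (simp add: R_def)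
    have "cmod (bil (p a) v1) = (real m * cmod (g a z) ^ (m - 1)) * (cmod (deriv (g a) z) / s)"
      using s by (simp add: v1_def dL[OF a] norm_mult norm_divide norm_power)
    also have "\<dots> \<le> (real m * cmod (g a z) ^ (m - 1)) * B"
      using dg[OF a] s B(1) by (intro mult_left_mono) (auto simp: divide_le_eq intro: order_trans mult_right_mono)
    finally show "cmod (bil (p a) v1) \<le> R a" by (simp add: R_def mult_ac)
  qed
  then have "cmod (jet_det p (f z) v1) \<le> fact m * B ^ (m - 1) * (\<Prod>a\<in>S. R a)"
    using nf by (simp add: m_def S_def)
  then have J: "cmod (jet_det p (f z) v) \<le> s ^ n * (fact m * B ^ (m - 1) * (\<Prod>a\<in>S. R a))"
    unfolding v using fz s by (subst jet_det_scale_tangent) (auto simp: norm_mult norm_power n_def)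
  define e where "e = \<delta> - (real m - 1) / real m"
  have \<delta>1: "\<delta> \<le> 1"
  proof -
    have "1 * 1 \<le> 2 * real m * (real m - 1)" using m2 by (intro mult_mono) auto
    then have "1 / (2 * real m * (real m - 1)) \<le> 1" by (simp add: divide_le_eq)
    then show ?thesis using \<delta>(2) by simp
  qed
  have RP: "R a * cmod (bil (p a) (f z)) powr e \<le> real m * B * B" if a: "a \<in> S" for a
  proof -
    define t where "t = cmod (g a z)"
    have t: "t > 0" using gnz[OF a] by (simp add: t_def)
    have "cmod (bil (p a) (f z)) = t ^ m" unfolding gz[OF a, symmetric] t_def by (rule norm_power)
    moreover have "cmod (bil (p a) (f z)) \<le> B"
      using norm_bil_le[of "p a" "f z"] B(2)[of a] nf by simp
    ultimately have tB: "t ^ m \<le> B" by simp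
    \<comment> \<open>The cancellation behind the exponent (m - 1)/m: the power of the root coming
      from a row leaves only |l_a|^\<delta>.\<close>
    have "t ^ (m - 1) * (t ^ m) powr e = (t ^ m) powr \<delta>"
    proof -
      have "t ^ (m - 1) = t powr (real m - 1)"
        using t m2 by (simp add: powr_realpow[symmetric])
      then have "t ^ (m - 1) * (t ^ m) powr e = t powr (real m - 1 + real m * e)"
        using t by (simp add: powr_realpow[symmetric] powr_powr powr_add)
      also have "real m - 1 + real m * e = real m * \<delta>"
        using m2 by (simp add: e_def field_simps)
      finally show ?thesis using t by (simp add: powr_realpow[symmetric] powr_powr)
    qed
    also have "\<dots> \<le> B powr \<delta>" using tB t \<delta>(1) by (intro powr_mono2) auto
    also have "\<dots> \<le> B powr 1" using \<delta>1 B(1) by (intro powr_mono) auto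
    finally have "t ^ (m - 1) * (t ^ m) powr e \<le> B" using B(1) by simp
    then have "(real m * B) * (t ^ (m - 1) * (t ^ m) powr e) \<le> (real m * B) * B"
      using B(1) by (intro mult_left_mono) auto
    then show ?thesis
      unfolding R_def t_def[symmetric] \<open>cmod (bil (p a) (f z)) = t ^ m\<close> by (simp add: mult_ac)
  qed
  have "jet_weight p \<delta> (f z) v = cmod (jet_det p (f z) v) * (\<Prod>a\<in>S. cmod (bil (p a) (f z)) powr e)"
    using nf by (simp add: jet_weight_def S_def e_def m_def)
  also have "\<dots> \<le> (s ^ n * (fact m * B ^ (m - 1) * (\<Prod>a\<in>S. R a))) * (\<Prod>a\<in>S. cmod (bil (p a) (f z)) powr e)"
    using J by (rule mult_right_mono) (simp add: prod_nonneg)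
  also have "\<dots> = s ^ n * (fact m * B ^ (m - 1)) * (\<Prod>a\<in>S. R a * cmod (bil (p a) (f z)) powr e)"
    by (simp add: prod.distrib)
  also have "\<dots> \<le> s ^ n * (fact m * B ^ (m - 1)) * (\<Prod>a\<in>S. real m * B * B)"
    using s B(1) RP by (intro mult_left_mono prod_mono) (auto simp: R_def)
  also have "\<dots> = s ^ n * (fact m * (real m * B ^ 3) ^ (m - 1))"
    by (simp add: cardS power_mult_distrib power3_eq_cube)
  finally have "jet_weight p \<delta> (f z) v * A ^ n \<le> s ^ n * (fact m * (real m * B ^ 3) ^ (m - 1)) * A ^ n"
    using A by (intro mult_right_mono) auto
  also have "\<dots> = (s * A) ^ n * fact m * (real m * B ^ 3) ^ (m - 1)"
    by (simp add: power_mult_distrib)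
  also have "s * A = sqrt (real n / eps)" using A by (simp add: s_def)
  finally show ?thesis by (simp add: v_def A_def n_def weight_bound_def)
qed

section \<open>Boundedness along orbifold curves\<close>

lemma isCont_vector:
  fixes f :: "complex \<Rightarrow> complex ^ 'k::finite"
  assumes "\<And>c. (\<lambda>w. f w $ c) analytic_on {z}"
  shows "isCont f z"
  unfolding isCont_def
proof (rule vec_tendstoI)
  show "((\<lambda>w. f w $ c) \<longlongrightarrow> f z $ c) (at z)" for c
    using analytic_at_imp_isCont[OF assms] unfolding isCont_def .
qed

lemma local_lift_analytic: "local_lift h z f \<Longrightarrow> (\<lambda>w. f w $ c) analytic_on {z}"
  by (simp add: local_lift_def)

lemma isCont_local_lift: "local_lift h z f \<Longrightarrow> isCont f z"
  by (intro isCont_vector local_lift_analytic)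

lemma isCont_bil_lift: "local_lift h z f \<Longrightarrow> isCont (\<lambda>w. bil q (f w)) z"
  by (intro analytic_at_imp_isCont analytic_on_bil local_lift_analytic)

lemma isCont_jet_det_lift:
  assumes f: "local_lift h z f"
  shows "isCont (\<lambda>w. jet_det p (f w) (vderiv f w)) z"
proof -
  obtain U where U: "open U" "z \<in> U" "\<And>w. w \<in> U \<Longrightarrow> local_lift h w f"
    using eventually_local_lift[OF f] unfolding eventually_nhds by blast
  have an: "(\<lambda>w'. f w' $ c) analytic_on {w}" if "w \<in> U" for w c
    using U(3)[OF that] by (rule local_lift_analytic)
  have "continuous_on U f"
    by (intro continuous_at_imp_continuous_on ballI isCont_vector an)
  moreover have "continuous_on U (vderiv f)"
    by (intro continuous_at_imp_continuous_on ballI isCont_vector analytic_on_vderiv an)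
  ultimately have "continuous_on U (\<lambda>w. jet_det p (f w) (vderiv f w))"
    using U(3) local_lift_point(1) by (intro continuous_on_jet_det) blast+
  then show ?thesis using U continuous_on_eq_continuous_at by blast
qed

lemma orb_potential_le:
  fixes p :: "'k + 'k \<Rightarrow> complex ^ 'k::finite"
  assumes "B \<ge> 1" "\<And>a. norm (p a) \<le> B"
  shows "0 \<le> orb_potential p x" "orb_potential p x \<le> (real CARD('k + 'k) - 1) * B^2"
proof -
  define m where "m = real CARD('k + 'k)"
  have m: "m \<ge> 2" using CARD_Plus_ge_2[where 'k = 'k] by (simp add: m_def)
  show "0 \<le> orb_potential p x" by (simp add: orb_potential_def sum_nonneg)
  have "orb_potential p x \<le> (\<Sum>a\<in>UNIV - {r0 :: 'k + 'k}. B^2)"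
    unfolding orb_potential_def m_def[symmetric]
  proof (rule sum_mono)
    fix a
    have "cmod (bil (p a) x) / norm x \<le> B"
    proof (cases "x = 0")
      case False
      then have "cmod (bil (p a) x) \<le> B * norm x"
        using norm_bil_le[of "p a" x] assms(2)[of a] by (meson mult_right_mono norm_ge_zero order_trans)
      then show ?thesis using False by (simp add: divide_le_eq)
    qed (use assms(1) in simp)
    then have "(cmod (bil (p a) x) / norm x) powr (2 / m) \<le> B powr (2 / m)"
      using m by (intro powr_mono2) auto
    also have "\<dots> \<le> B powr 2" using m assms(1) by (intro powr_mono) (auto simp: divide_le_eq)
    also have "\<dots> = B^2" using assms(1) by (simp add: powr_numeral)
    finally show "(cmod (bil (p a) x) / norm x) powr (2 / m) \<le> B^2" .
  qed
  also have "\<dots> = (m - 1) * B^2" using m by (simp add: card_non_r0 m_def of_nat_diff)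
  finally show "orb_potential p x \<le> (real CARD('k + 'k) - 1) * B^2" by (simp add: m_def)
qed

text \<open>The form in which the orbifold condition is used: zeros of order at least \<open>CARD('k + 'k)\<close>.\<close>

definition orb_zero_at :: "complex ^ 'k::finite \<Rightarrow> (complex \<Rightarrow> complex ^ 'k) \<Rightarrow> complex \<Rightarrow> bool" where
  "orb_zero_at q f z \<longleftrightarrow> (\<exists>C. \<forall>\<^sub>F w in at z. bil q (f w) \<noteq> 0 \<and> cmod (bil q (vderiv f w))
     \<le> C * cmod (bil q (f w)) powr ((real CARD('k + 'k) - 1) / real CARD('k + 'k)))"

lemma jet_weight_nonneg: "jet_weight p \<delta> x v \<ge> 0"
  by (simp add: jet_weight_def prod_nonneg)

lemma jet_weight_eq_0:
  "a \<noteq> r0 \<Longrightarrow> bil (p a) x = 0 \<Longrightarrow> jet_weight p \<delta> x v = 0"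
proof -
  assume a: "a \<noteq> r0" "bil (p a) x = 0"
  have "(\<Prod>a\<in>UNIV - {r0}. cmod (bil (p a) x) powr e) = 0" for e
    by (rule prod_zero) (use a in auto)
  then show ?thesis by (simp add: jet_weight_def)
qed

text \<open>By the orbifold condition each row is O(|l_a(f)|^((m-1)/m)), so the weight is at most a
  locally bounded factor times the product of the |l_a(f)|^\<delta>, one of which tends to
  0.\<close>

lemma jet_weight_tendsto_0:
  fixes p :: "'k + 'k \<Rightarrow> complex ^ 'k::finite"
  assumes f: "local_lift h z f" and orb: "\<And>a. orb_zero_at (p a) f z" and \<delta>: "\<delta> > 0"
    and b: "b \<noteq> r0" "bil (p b) (f z) = 0"
  shows "((\<lambda>w. jet_weight p \<delta> (f w) (vderiv f w)) \<longlongrightarrow> 0) (at z)"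
proof -
  define m where "m = real CARD('k + 'k)"
  define \<alpha> where "\<alpha> = (m - 1) / m"
  define e' where "e' = 1 / m - (m - 1) * \<delta>"
  define S where "S = UNIV - {r0 :: 'k + 'k}"
  define L where "L a w = bil (p a) (f w)" for a w
  have m: "m \<ge> 2" using CARD_Plus_ge_2[where 'k = 'k] by (simp add: m_def)
  note contf = isCont_local_lift[OF f]
  have fz: "f z \<noteq> 0" by (rule local_lift_point[OF f])
  have contL: "isCont (L a) z" for a
    unfolding L_def by (intro analytic_at_imp_isCont analytic_on_bil local_lift_analytic[OF f])
  have "\<forall>a. \<exists>C. \<forall>\<^sub>F w in at z. bil (p a) (f w) \<noteq> 0 \<and> cmod (bil (p a) (vderiv f w)) \<le> C * cmod (bil (p a) (f w)) powr \<alpha>"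
    using orb unfolding orb_zero_at_def m_def[symmetric] \<alpha>_def[symmetric] by (rule allI)
  from choice[OF this] obtain C0 where
    C0: "\<And>a. \<forall>\<^sub>F w in at z. bil (p a) (f w) \<noteq> 0 \<and> cmod (bil (p a) (vderiv f w)) \<le> C0 a * cmod (bil (p a) (f w)) powr \<alpha>"
    by blast
  define K where "K a = cmod (L a z) + 1" for a
  have "((\<lambda>w. cmod (L a w)) \<longlongrightarrow> cmod (L a z)) (at z)" for a
    using contL by (intro tendsto_norm) (simp add: isCont_def)
  then have K: "\<forall>\<^sub>F w in at z. cmod (L a w) < K a" for a
    by (rule order_tendstoD(2)) (simp add: K_def)
  \<comment> \<open>One constant for both values in a row: \<open>C0\<close> handles the derivative,
    and \<open>K a powr (1 / m)\<close> the value itself, through |l| = |l|^(1/m)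
    |l|^((m-1)/m).\<close>
  define C where "C = (\<Sum>a\<in>UNIV. \<bar>C0 a\<bar> + K a powr (1 / m))"
  have C: "\<bar>C0 a\<bar> + K a powr (1 / m) \<le> C" for a
    unfolding C_def by (rule member_le_sum) auto
  have C1: "C0 a \<le> C" "K a powr (1 / m) \<le> C" for a
    using C[of a] powr_ge_zero[of "K a" "1 / m"] abs_ge_self[of "C0 a"] abs_ge_zero[of "C0 a"] by linarith+
  define B where "B = (\<Sum>a\<in>UNIV. norm (p a))"
  have B: "norm (p a) \<le> B" for a
    unfolding B_def by (rule member_le_sum) auto
  define M where "M = fact CARD('k + 'k) * B ^ (CARD('k + 'k) - 1) * C ^ (CARD('k + 'k) - 1)"
  have "\<forall>\<^sub>F w in at z. \<forall>a\<in>UNIV. L a w \<noteq> 0 \<and> cmod (bil (p a) (vderiv f w)) \<le> C0 a * cmod (L a w) powr \<alpha> \<and> cmod (L a w) < K a"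
    using C0 K unfolding L_def by (intro eventually_ball_finite ballI) (auto simp: eventually_conj_iff)
  moreover have "\<forall>\<^sub>F w in at z. f w \<noteq> 0"
    using isCont_eventually_nonzero[OF contf fz] eventually_nhds_conv_at by blast
  ultimately have bound: "\<forall>\<^sub>F w in at z. norm (jet_weight p \<delta> (f w) (vderiv f w))
      \<le> M * (\<Prod>a\<in>S. cmod (L a w) powr \<delta>) * norm (f w) powr (e' - 1)"
  proof eventually_elim
    case (elim w)
    have Lpos: "cmod (L a w) > 0" for a using elim by simp
    have 1: "cmod (L a w) \<le> C * cmod (L a w) powr \<alpha>" for a
    proof -
      have "cmod (L a w) = cmod (L a w) powr (1 / m + \<alpha>)"
        using Lpos[of a] m by (simp add: \<alpha>_def add_divide_distrib[symmetric])
      also have "\<dots> = cmod (L a w) powr (1 / m) * cmod (L a w) powr \<alpha>" by (rule powr_add)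
      also have "\<dots> \<le> C * cmod (L a w) powr \<alpha>"
      proof (rule mult_right_mono)
        have "cmod (L a w) powr (1 / m) \<le> K a powr (1 / m)"
          using elim(1) m by (intro powr_mono2) (auto intro: less_imp_le)
        then show "cmod (L a w) powr (1 / m) \<le> C" using C1(2)[of a] by simp
      qed simp
      finally show ?thesis .
    qed
    have 2: "cmod (bil (p a) (vderiv f w)) \<le> C * cmod (L a w) powr \<alpha>" for a
      using elim(1) mult_right_mono[OF C1(1)[of a], of "cmod (L a w) powr \<alpha>"] by (meson UNIV_I order_trans powr_ge_zero)
    have "cmod (jet_det p (f w) (vderiv f w)) * norm (f w)
        \<le> fact CARD('k + 'k) * B ^ (CARD('k + 'k) - 1) * (\<Prod>a\<in>UNIV - {r0}. C * cmod (L a w) powr \<alpha>)"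
      by (rule norm_jet_det_le[OF elim(2) B]) (use 1 2 in \<open>auto simp: L_def\<close>)
    also have "\<dots> = M * (\<Prod>a\<in>S. cmod (L a w) powr \<alpha>)"
      by (simp add: M_def prod.distrib card_non_r0 S_def)
    finally have J: "cmod (jet_det p (f w) (vderiv f w)) \<le> M * (\<Prod>a\<in>S. cmod (L a w) powr \<alpha>) / norm (f w)"
      using elim(2) by (simp add: le_divide_eq)
    have P: "(\<Prod>a\<in>S. cmod (L a w) powr \<alpha>) * (\<Prod>a\<in>S. cmod (L a w) powr (\<delta> - \<alpha>)) = (\<Prod>a\<in>S. cmod (L a w) powr \<delta>)"
      unfolding prod.distrib[symmetric] by (intro prod.cong refl) (simp add: powr_add[symmetric])
    have "norm (jet_weight p \<delta> (f w) (vderiv f w)) = cmod (jet_det p (f w) (vderiv f w))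
        * ((\<Prod>a\<in>S. cmod (L a w) powr (\<delta> - \<alpha>)) * norm (f w) powr e')"
      using jet_weight_nonneg[of p \<delta> "f w" "vderiv f w"]
      by (simp add: jet_weight_def S_def L_def \<alpha>_def m_def e'_def abs_mult mult.assoc prod_nonneg)
    also have "\<dots> \<le> (M * (\<Prod>a\<in>S. cmod (L a w) powr \<alpha>) / norm (f w)) * ((\<Prod>a\<in>S. cmod (L a w) powr (\<delta> - \<alpha>)) * norm (f w) powr e')"
      using J by (rule mult_right_mono) (simp add: prod_nonneg)
    also have "\<dots> = M * ((\<Prod>a\<in>S. cmod (L a w) powr \<alpha>) * (\<Prod>a\<in>S. cmod (L a w) powr (\<delta> - \<alpha>))) * (norm (f w) powr e' / norm (f w))"
      by simp
    also have "norm (f w) powr e' / norm (f w) = norm (f w) powr (e' - 1)"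
      using elim(2) by (simp add: powr_diff)
    finally show ?case unfolding P .
  qed
  have "((\<lambda>w. M * (\<Prod>a\<in>S. cmod (L a w) powr \<delta>) * norm (f w) powr (e' - 1)) \<longlongrightarrow>
      M * (\<Prod>a\<in>S. cmod (L a z) powr \<delta>) * norm (f z) powr (e' - 1)) (at z)"
    using contL contf fz \<delta> unfolding isCont_def
    by (intro tendsto_intros tendsto_powr') auto
  moreover have "(\<Prod>a\<in>S. cmod (L a z) powr \<delta>) = 0"
    using b by (intro prod_zero bexI[of _ b]) (auto simp: S_def L_def)
  ultimately have "((\<lambda>w. M * (\<Prod>a\<in>S. cmod (L a w) powr \<delta>) * norm (f w) powr (e' - 1)) \<longlongrightarrow> 0) (at z)"
    by simp
  from Lim_null_comparison[OF bound this] show ?thesis .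
qed

lemma isCont_jet_weight:
  fixes p :: "'k + 'k \<Rightarrow> complex ^ 'k::finite"
  assumes f: "local_lift h z f" and orb: "\<And>a. orb_zero_at (p a) f z" and \<delta>: "\<delta> > 0"
  shows "isCont (\<lambda>w. jet_weight p \<delta> (f w) (vderiv f w)) z"
proof (cases "\<exists>a. a \<noteq> r0 \<and> bil (p a) (f z) = 0")
  case True
  then obtain a where a: "a \<noteq> r0" "bil (p a) (f z) = 0" by blast
  show ?thesis
    unfolding isCont_def jet_weight_eq_0[of a p "f z", OF a] by (rule jet_weight_tendsto_0[where p = p and b = a, OF f orb \<delta> a])
next
  case False
  note contf = isCont_local_lift[OF f]
  have fz: "f z \<noteq> 0" by (rule local_lift_point[OF f])
  note contL = isCont_bil_lift[OF f]
  show ?thesis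
    using contf contL isCont_jet_det_lift[OF f, of p] fz False unfolding isCont_def jet_weight_def
    by (intro tendsto_intros tendsto_powr) auto
qed

lemma isCont_orb_potential:
  fixes p :: "'k + 'k \<Rightarrow> complex ^ 'k::finite"
  assumes f: "local_lift h z f"
  shows "isCont (\<lambda>w. orb_potential p (f w)) z"
proof -
  note contf = isCont_local_lift[OF f]
  have fz: "f z \<noteq> 0" by (rule local_lift_point[OF f])
  note contL = isCont_bil_lift[OF f]
  have "CARD('k + 'k) > 0" by simp
  then show ?thesis
    using contf contL fz unfolding isCont_def orb_potential_def
    by (intro tendsto_intros tendsto_powr') auto
qed

text \<open>\<open>T\<close> is continuous on the closed disc and zero on its boundary. At an
  interior maximum either some l_a vanishes, and with it the weight, or
  \<open>jet_weight_at_max\<close> applies; exp (1/4) bounds the exponential of the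
  potential.\<close>

lemma jet_weight_curve_bound_radius:
  fixes p :: "'k + 'k \<Rightarrow> complex ^ 'k::finite"
  defines "m \<equiv> CARD('k + 'k)"
  assumes k: "CARD('k) \<ge> 2" and B: "B \<ge> 1" "\<And>a. norm (p a) \<le> B"
    and h: "\<And>z. z \<in> unit_disk \<Longrightarrow> \<exists>f. local_lift h z f \<and> (\<forall>a. orb_zero_at (p a) f z)"
    and \<delta>: "0 < \<delta>" "\<delta> \<le> 1 / (2 * real m * (real m - 1))"
    and eps: "eps > 0" "eps * (real m - 1) * B^2 \<le> 1 / 4"
    and r: "cmod z < r" "r < 1" and f: "local_lift h z f"
  shows "jet_weight p \<delta> (f z) (vderiv f z) * (r^2 - (cmod z)^2) ^ (CARD('k) - 1)
    \<le> exp (1 / 4) * weight_bound (CARD('k) - 1) m eps B"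
proof -
  define n where "n = CARD('k) - 1"
  have n: "n > 0" using k by (simp add: n_def)
  define C where "C = weight_bound n m eps B"
  have C: "C \<ge> 0" using B(1) eps by (simp add: C_def weight_bound_nonneg)
  define \<Psi> where "\<Psi> x v = jet_weight p \<delta> x v * exp (eps * orb_potential p x)" for x v
  have inv: "jet_invariant \<Psi>"
    unfolding \<Psi>_def using jet_invariant_mult[OF jet_invariant_jet_weight jet_invariant_orb_potential, of "\<lambda>s t. s * exp (eps * t)"] .
  have r0: "r > 0" using r norm_ge_zero[of z] by linarith
  have pot: "orb_potential p x \<ge> 0" "exp (eps * orb_potential p x) \<le> exp (1 / 4)" for x
  proof -
    have "eps * orb_potential p x \<le> eps * ((real m - 1) * B^2)"
      unfolding m_def by (rule mult_left_mono[OF orb_potential_le(2)[OF B]]) (use eps in simp)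
    then show "exp (eps * orb_potential p x) \<le> exp (1 / 4)" using eps(2) by (simp add: mult.assoc)
  qed (rule orb_potential_le[OF B])
  \<comment> \<open>The maximum is sought on the whole disc, while each local argument below picks
    its own lift.\<close>
  define T where "T w = on_curve \<Psi> h w * (r^2 - (cmod w)^2) ^ n" for w
  have cont: "isCont T w" if w: "w \<in> unit_disk" for w
  proof -
    obtain g where g: "local_lift h w g" "\<And>a. orb_zero_at (p a) g w"
      using h[OF w] by blast
    have "isCont (\<lambda>w. \<Psi> (g w) (vderiv g w) * (r^2 - (cmod w)^2) ^ n) w"
      unfolding \<Psi>_def
      by (intro continuous_intros isCont_jet_weight[where p = p, OF g \<delta>(1)] isCont_orb_potential[OF g(1)])
    moreover have "\<forall>\<^sub>F w in nhds w. \<Psi> (g w) (vderiv g w) * (r^2 - (cmod w)^2) ^ n = T w"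
      using eventually_on_curve_eq[OF inv g(1)] by eventually_elim (simp add: T_def)
    ultimately show ?thesis using isCont_cong by fastforce
  qed
  have "cball 0 r \<subseteq> unit_disk" using r by auto
  then have "continuous_on (cball 0 r) T"
    using cont by (intro continuous_at_imp_continuous_on) blast
  moreover have "cball (0::complex) r \<noteq> {}" using r0 by simp
  ultimately obtain w where w: "w \<in> cball 0 r" "\<And>y. y \<in> cball 0 r \<Longrightarrow> T y \<le> T w"
    using continuous_attains_sup[of "cball 0 r" T] by auto
  have "T w \<le> exp (1 / 4) * C"
  proof (cases "cmod w = r")
    case True
    then show ?thesis using n C by (simp add: T_def power_0_left)
  next
    case False
    then have wr: "cmod w < r" using w(1) by simp
    then have wD: "w \<in> unit_disk" using r(2) by simp
    obtain g0 where "local_lift h w g0" using h[OF wD] by blast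
    then obtain g where g: "local_lift h w g" "norm (g w) = 1" "\<forall>\<^sub>F y in nhds w. bil (cnjv (g w)) (g y) = 1"
      using ex_normalized_lift by blast
    have Tw: "T w = damped_weight p \<delta> eps r n g w"
      using on_curve_eq[OF inv g(1)] by (simp add: T_def \<Psi>_def)
    show ?thesis
    proof (cases "\<exists>a. a \<noteq> r0 \<and> bil (p a) (g w) = 0")
      case True
      then obtain a where a: "a \<noteq> r0" "bil (p a) (g w) = 0" by blast
      show ?thesis using C unfolding Tw jet_weight_eq_0[of a p "g w", OF a] by simp
    next
      case nz: False
      have "\<forall>\<^sub>F y in nhds w. y \<in> ball 0 r"
        using wr eventually_nhds_in_open[of "ball 0 r" w] by simp
      with eventually_on_curve_eq[OF inv g(1)]
      have max: "\<forall>\<^sub>F y in nhds w. damped_weight p \<delta> eps r n g y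
          \<le> damped_weight p \<delta> eps r n g w"
      proof eventually_elim
        case (elim y)
        then show ?case using w(2)[of y] unfolding Tw by (simp add: T_def \<Psi>_def)
      qed
      have bnd: "jet_weight p \<delta> (g w) (vderiv g w) * (r^2 - (cmod w)^2) ^ n \<le> C"
        unfolding C_def n_def m_def
        by (rule jet_weight_at_max[OF k local_lift_analytic[OF g(1)] g(2,3) B _ _ _ eps(1) _ wr less_imp_le[OF r(2)] max[unfolded n_def]])
          (use nz \<delta> eps(2) in \<open>auto simp: m_def\<close>)
      have "T w = exp (eps * orb_potential p (g w)) * (jet_weight p \<delta> (g w) (vderiv g w) * (r^2 - (cmod w)^2) ^ n)"
        unfolding Tw by simp
      also have "\<dots> \<le> exp (eps * orb_potential p (g w)) * C"
        by (rule mult_left_mono[OF bnd]) simp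
      also have "\<dots> \<le> exp (1 / 4) * C" by (rule mult_right_mono[OF pot(2) C])
      finally show ?thesis .
    qed
  qed
  then have "T z \<le> exp (1 / 4) * C" using w(2)[of z] r(1) by simp
  moreover have "T z = exp (eps * orb_potential p (f z)) * (jet_weight p \<delta> (f z) (vderiv f z) * (r^2 - (cmod z)^2) ^ n)"
    using on_curve_eq[OF inv f] by (simp add: T_def \<Psi>_def)
  moreover have "1 * (jet_weight p \<delta> (f z) (vderiv f z) * (r^2 - (cmod z)^2) ^ n) \<le> \<dots>"
    using r r0 eps(1) pot(1) jet_weight_nonneg
    by (intro mult_right_mono mult_nonneg_nonneg zero_le_power) (auto simp: power_mono)
  ultimately show ?thesis by (simp add: C_def n_def)
qed

text \<open>The constant depends neither on r nor on \<delta>, so r may tend to 1 and \<delta> to 0.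
  Nonvanishing of the l_a at f(z) makes the weight continuous in \<delta>.\<close>

lemma jet_weight_curve_bound:
  fixes p :: "'k + 'k \<Rightarrow> complex ^ 'k::finite"
  defines "m \<equiv> CARD('k + 'k)"
  assumes k: "CARD('k) \<ge> 2" and B: "B \<ge> 1" "\<And>a. norm (p a) \<le> B"
    and h: "\<And>z. z \<in> unit_disk \<Longrightarrow> \<exists>f. local_lift h z f \<and> (\<forall>a. orb_zero_at (p a) f z)"
    and eps: "eps > 0" "eps * (real m - 1) * B^2 \<le> 1 / 4"
    and z: "z \<in> unit_disk" and f: "local_lift h z f" and nz: "\<And>a. bil (p a) (f z) \<noteq> 0"
  shows "jet_weight p 0 (f z) (vderiv f z) * (1 - (cmod z)^2) ^ (CARD('k) - 1)
    \<le> exp (1 / 4) * weight_bound (CARD('k) - 1) m eps B"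
    (is "_ \<le> ?C")
proof -
  have m2: "m \<ge> 2" using CARD_Plus_ge_2[where 'k = 'k] by (simp add: m_def)
  define \<delta>0 where "\<delta>0 = 1 / (2 * real m * (real m - 1))"
  have \<delta>0: "\<delta>0 > 0" using m2 by (simp add: \<delta>0_def)
  have 1: "jet_weight p \<delta> (f z) (vderiv f z) * (1^2 - (cmod z)^2) ^ (CARD('k) - 1) \<le> ?C" if "0 < \<delta>" "\<delta> \<le> \<delta>0" for \<delta>
  proof (rule tendsto_upperbound)
    show "((\<lambda>r. jet_weight p \<delta> (f z) (vderiv f z) * (r^2 - (cmod z)^2) ^ (CARD('k) - 1)) \<longlongrightarrow>
        jet_weight p \<delta> (f z) (vderiv f z) * (1^2 - (cmod z)^2) ^ (CARD('k) - 1)) (at_left 1)"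
      by (intro tendsto_intros)
    have "\<forall>\<^sub>F r in at_left 1. r \<in> {cmod z<..<1}"
      by (rule eventually_at_left_real) (use z in simp)
    then show "\<forall>\<^sub>F r in at_left 1. jet_weight p \<delta> (f z) (vderiv f z) * (r^2 - (cmod z)^2) ^ (CARD('k) - 1) \<le> ?C"
    proof eventually_elim
      case (elim r)
      then show ?case
        unfolding m_def using that eps B h f
        by (intro jet_weight_curve_bound_radius[OF k B h]) (auto simp: \<delta>0_def m_def)
    qed
  qed simp
  have "f z \<noteq> 0" by (rule local_lift_point[OF f])
  then have lim: "((\<lambda>\<delta>. jet_weight p \<delta> (f z) (vderiv f z) * (1^2 - (cmod z)^2) ^ (CARD('k) - 1)) \<longlongrightarrow>
      jet_weight p 0 (f z) (vderiv f z) * (1^2 - (cmod z)^2) ^ (CARD('k) - 1)) (at_right 0)"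
    unfolding jet_weight_def using nz by (intro tendsto_intros tendsto_powr) auto
  have "\<forall>\<^sub>F \<delta> in at_right 0. \<delta> \<in> {0<..<\<delta>0}"
    by (rule eventually_at_right_real) (rule \<delta>0)
  then have "\<forall>\<^sub>F \<delta> in at_right 0. jet_weight p \<delta> (f z) (vderiv f z) * (1^2 - (cmod z)^2) ^ (CARD('k) - 1) \<le> ?C"
    by eventually_elim (rule 1; simp)
  from tendsto_upperbound[OF lim this] show ?thesis by simp
qed

text \<open>Since |l_a(x)| is at most B |x|, its negative powers in the weight are bounded below;
  homogeneity produces the exponent m - 2 of |x|, and the exponent of B is rounded up to m -
  1.\<close>

lemma norm_jet_det_le_jet_weight:
  fixes p :: "'k + 'k \<Rightarrow> complex ^ 'k::finite"
  defines "m \<equiv> CARD('k + 'k)"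
  assumes B: "B \<ge> 1" "\<And>a. norm (p a) \<le> B" and x: "x \<noteq> 0" and nz: "\<And>a. bil (p a) x \<noteq> 0"
  shows "cmod (jet_det p x v) \<le> B ^ (m - 1) * norm x ^ (m - 2) * jet_weight p 0 x v"
proof -
  define M where "M = real m"
  have M: "M \<ge> 2" "real (m - 1) = M - 1" "real (m - 2) = M - 2"
    using CARD_Plus_ge_2[where 'k = 'k] by (auto simp: M_def m_def)
  define \<alpha> where "\<alpha> = (M - 1) / M"
  have \<alpha>: "0 \<le> \<alpha>" "\<alpha> \<le> 1" using M by (auto simp: \<alpha>_def)
  define S where "S = UNIV - {r0 :: 'k + 'k}"
  have nx: "norm x > 0" using x by simp
  have "(\<Prod>a\<in>S. (B * norm x) powr (- \<alpha>)) \<le> (\<Prod>a\<in>S. cmod (bil (p a) x) powr (- \<alpha>))"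
  proof (rule prod_mono, intro conjI)
    fix a
    have "cmod (bil (p a) x) \<le> B * norm x"
      using norm_bil_le[of "p a" x] B(2)[of a] by (meson mult_right_mono norm_ge_zero order_trans)
    then show "(B * norm x) powr (- \<alpha>) \<le> cmod (bil (p a) x) powr (- \<alpha>)"
      using nz[of a] \<alpha> by (intro powr_mono2') auto
  qed simp
  also have "(\<Prod>a\<in>S. (B * norm x) powr (- \<alpha>)) = (B * norm x) powr (- \<alpha> * (M - 1))"
    using nx B(1) unfolding S_def by (simp add: card_non_r0 powr_realpow[symmetric] powr_powr M(2)[unfolded m_def] M_def m_def)
  finally have P: "(B * norm x) powr (- \<alpha> * (M - 1)) \<le> (\<Prod>a\<in>S. cmod (bil (p a) x) powr (- \<alpha>))" .
  have e: "M - 2 + (- \<alpha> * (M - 1)) + 1 / M = 0"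
    using M(1) by (simp add: \<alpha>_def field_simps)
  have "1 \<le> B powr ((M - 1) + (- \<alpha> * (M - 1)))"
  proof (rule ge_one_powr_ge_zero[OF B(1)])
    have "\<alpha> * (M - 1) \<le> 1 * (M - 1)" by (rule mult_right_mono) (use \<alpha> M in auto)
    then show "0 \<le> (M - 1) + (- \<alpha> * (M - 1))" by simp
  qed
  then have "1 \<le> (B powr (M - 1) * B powr (- \<alpha> * (M - 1))) * norm x powr (M - 2 + (- \<alpha> * (M - 1)) + 1 / M)"
    unfolding e using x by (simp add: powr_add[symmetric])
  also have "\<dots> = (B powr (M - 1) * norm x powr (M - 2)) * ((B * norm x) powr (- \<alpha> * (M - 1)) * norm x powr (1 / M))"
    using B(1) nx by (simp only: powr_add powr_mult) (simp add: mult_ac)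
  also have "\<dots> \<le> (B powr (M - 1) * norm x powr (M - 2)) * ((\<Prod>a\<in>S. cmod (bil (p a) x) powr (- \<alpha>)) * norm x powr (1 / M))"
    by (intro mult_left_mono mult_right_mono P) auto
  finally have "cmod (jet_det p x v) * 1 \<le> cmod (jet_det p x v) * \<dots>"
    by (rule mult_left_mono) simp
  also have "\<dots> = (B powr (M - 1) * norm x powr (M - 2)) * jet_weight p 0 x v"
    by (simp add: jet_weight_def S_def M_def m_def \<alpha>_def mult_ac)
  also have "B powr (M - 1) * norm x powr (M - 2) = B ^ (m - 1) * norm x ^ (m - 2)"
    using B(1) nx unfolding M(2,3)[symmetric] by (simp add: powr_realpow del: of_nat_diff)
  finally show ?thesis by simp
qed

section \<open>Uniform bound on the derivatives of orbifold curves\<close>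

definition orb_curve :: "(nat \<Rightarrow> complex ^ 'k::finite) \<Rightarrow> nat \<Rightarrow> (complex \<Rightarrow> 'k cproj) \<Rightarrow> bool" where
  "orb_curve l N h \<longleftrightarrow> (\<forall>z\<in>unit_disk. \<exists>f. local_lift h z f \<and> (\<forall>i\<in>{1..N}. orb_zero_at (l i) f z))"

lemma orb_zero_at_eventually:
  assumes "orb_zero_at q f z"
  shows "\<forall>\<^sub>F w in at z. bil q (f w) \<noteq> 0"
  using assms unfolding orb_zero_at_def by (elim exE) (erule eventually_mono, blast)

text \<open>In a punctured neighbourhood of z no l_a(f) vanishes and the weight bounds the form. The
  resulting inequality has no negative powers, so it passes to z by continuity.\<close>

lemma jet_det_curve_bound:
  fixes p :: "'k + 'k \<Rightarrow> complex ^ 'k::finite"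
  defines "m \<equiv> CARD('k + 'k)"
  assumes k: "CARD('k) \<ge> 2" and B: "B \<ge> 1" "\<And>a. norm (p a) \<le> B"
    and h: "\<And>z. z \<in> unit_disk \<Longrightarrow> \<exists>f. local_lift h z f \<and> (\<forall>a. orb_zero_at (p a) f z)"
    and eps: "eps > 0" "eps * (real m - 1) * B^2 \<le> 1 / 4"
    and z: "z \<in> unit_disk" and f: "local_lift h z f"
  shows "cmod (jet_det p (f z) (vderiv f z)) * (1 - (cmod z)^2) ^ (CARD('k) - 1)
    \<le> B ^ (m - 1) * norm (f z) ^ (m - 2)
      * (exp (1 / 4) * weight_bound (CARD('k) - 1) m eps B)"
proof -
  define C where "C = exp (1 / 4) * weight_bound (CARD('k) - 1) m eps B"
  define n where "n = CARD('k) - 1"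
  obtain f0 where f0: "local_lift h z f0" "\<And>a. orb_zero_at (p a) f0 z"
    using h[OF z] by blast
  have ev0: "\<forall>\<^sub>F w in at z. \<forall>a\<in>UNIV. bil (p a) (f0 w) \<noteq> 0"
    using orb_zero_at_eventually[OF f0(2)] by (intro eventually_ball_finite ballI) auto
  have ev1: "\<forall>\<^sub>F w in at z. local_lift h w f0 \<and> local_lift h w f \<and> w \<in> unit_disk"
    using eventually_local_lift[OF f0(1)] eventually_local_lift[OF f] eventually_nhds_in_open[OF open_ball z]
    by (auto simp: eventually_nhds_conv_at eventually_conj_iff)
  have ev: "\<forall>\<^sub>F w in at z. cmod (jet_det p (f w) (vderiv f w)) * (1 - (cmod w)^2) ^ n \<le> B ^ (m - 1) * norm (f w) ^ (m - 2) * C"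
    using ev0 ev1
  proof eventually_elim
    case (elim w)
    have fw: "f w \<noteq> 0" using elim(2) local_lift_point by blast
    have nz: "bil (p a) (f w) \<noteq> 0" for a
      using local_lift_unique[of h w f f0] elim by auto
    have disk: "1 - (cmod w)^2 \<ge> 0" using elim(2) by (simp add: power_le_one)
    have "cmod (jet_det p (f w) (vderiv f w)) * (1 - (cmod w)^2) ^ n
        \<le> (B ^ (m - 1) * norm (f w) ^ (m - 2) * jet_weight p 0 (f w) (vderiv f w)) * (1 - (cmod w)^2) ^ n"
      unfolding m_def by (rule mult_right_mono[OF norm_jet_det_le_jet_weight[OF B fw nz]]) (use disk in simp)
    also have "\<dots> = B ^ (m - 1) * norm (f w) ^ (m - 2) * (jet_weight p 0 (f w) (vderiv f w) * (1 - (cmod w)^2) ^ n)"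
      by simp
    also have "\<dots> \<le> B ^ (m - 1) * norm (f w) ^ (m - 2) * C"
    proof (rule mult_left_mono)
      show "jet_weight p 0 (f w) (vderiv f w) * (1 - (cmod w)^2) ^ n \<le> C"
        unfolding C_def n_def m_def
        by (rule jet_weight_curve_bound[where p = p and f = f and z = w and h = h])
          (use elim(2) k B h eps nz in \<open>auto simp: m_def\<close>)
    qed (use B(1) in simp)
    finally show ?case .
  qed
  note contf = isCont_local_lift[OF f]
  have 1: "((\<lambda>w. cmod (jet_det p (f w) (vderiv f w)) * (1 - (cmod w)^2) ^ n)
      \<longlongrightarrow> cmod (jet_det p (f z) (vderiv f z)) * (1 - (cmod z)^2) ^ n) (at z)"
    using isCont_jet_det_lift[OF f, of p] unfolding isCont_def by (intro tendsto_intros)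
  have 2: "((\<lambda>w. B ^ (m - 1) * norm (f w) ^ (m - 2) * C) \<longlongrightarrow> B ^ (m - 1) * norm (f z) ^ (m - 2) * C) (at z)"
    using contf unfolding isCont_def by (intro tendsto_intros)
  from tendsto_le[OF _ 2 1 ev] show ?thesis by (simp add: C_def n_def)
qed

text \<open>Summation over all choices of rows and comparison with
  \<open>ex_jet_det_lower_bound\<close> bound the n-th power of the Fubini-Study speed against that
  of the Poincare density.\<close>

lemma orb_curve_tangent_bound:
  fixes l :: "nat \<Rightarrow> complex ^ 'k::finite"
  assumes sp: "spans_quadrics l N" and k: "CARD('k) \<ge> 2"
  shows "\<exists>K>0. \<forall>h z f. orb_curve l N h \<longrightarrow> z \<in> unit_disk \<longrightarrow> local_lift h z f \<longrightarrow>
    norm (tangent_part (f z) (vderiv f z)) * (1 - (cmod z)^2) \<le> K * norm (f z)"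
proof -
  define m where "m = CARD('k + 'k)"
  define n where "n = CARD('k) - 1"
  have n: "n \<ge> 1" using k by (simp add: n_def)
  have m2: "m \<ge> 2" "m - 2 = n + n" using k by (simp_all add: m_def n_def card_sum)
  define F :: "('k + 'k \<Rightarrow> nat) set" where "F = {\<iota>. range \<iota> \<subseteq> {1..N}}"
  obtain c where c: "c > 0" "\<And>x v. x \<noteq> 0 \<Longrightarrow> c * (norm x * norm (tangent_part x v)) ^ n
      \<le> (\<Sum>\<iota>\<in>F. cmod (jet_det (l \<circ> \<iota>) x v))"
    using ex_jet_det_lower_bound[OF sp k] unfolding n_def F_def by blast
  define B where "B = 1 + (\<Sum>i\<in>{1..N}. norm (l i))"
  have B1: "B \<ge> 1" by (simp add: B_def sum_nonneg)
  have B2: "norm (l i) \<le> B" if "i \<in> {1..N}" for i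
    using member_le_sum[of i "{1..N}" "\<lambda>i. norm (l i)"] that by (simp add: B_def)
  \<comment> \<open>The largest value allowed by the smallness condition.\<close>
  define eps where "eps = 1 / (4 * (real m - 1) * B^2)"
  have eps: "eps > 0" "eps * (real m - 1) * B^2 \<le> 1 / 4"
    using m2 B1 by (simp_all add: eps_def)
  define C where "C = exp (1 / 4) * (weight_bound n m eps B)"
  have C: "C \<ge> 0" using B1 eps by (simp add: C_def weight_bound_nonneg)
  \<comment> \<open>The summand 1 makes K at least 1, hence at most K^n, so the n-th root can be
    taken with the same constant.\<close>
  define K where "K = 1 + real (card F) * (B ^ (m - 1) * C) / c"
  have K: "K \<ge> 1" using C B1 c(1) by (simp add: K_def)
  have "norm (tangent_part (f z) (vderiv f z)) * (1 - (cmod z)^2) \<le> K * norm (f z)"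
    if h: "orb_curve l N h" and z: "z \<in> unit_disk" and f: "local_lift h z f" for h z f
  proof -
    define x v t \<rho> where "x = f z" and "v = vderiv f z" and "t = norm (tangent_part x v)" and "\<rho> = 1 - (cmod z)^2"
    have x: "norm x > 0" using local_lift_point(1)[OF f] by (simp add: x_def)
    have \<rho>: "\<rho> > 0" using z by (simp add: \<rho>_def power_less_one_iff abs_square_less_1)
    have J: "cmod (jet_det (l \<circ> \<iota>) x v) * \<rho> ^ n \<le> B ^ (m - 1) * norm x ^ (n + n) * C" if \<iota>: "\<iota> \<in> F" for \<iota>
    proof -
      have i: "\<iota> a \<in> {1..N}" for a using \<iota> rangeI[of \<iota> a] unfolding F_def by blast
      show ?thesis
        unfolding C_def n_def m_def x_def v_def \<rho>_def m2(2)[unfolded m_def n_def, symmetric]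
      proof (rule jet_det_curve_bound[OF k B1 _ _ eps(1) eps(2)[unfolded m_def] z f])
        show "norm ((l \<circ> \<iota>) a) \<le> B" for a using B2[OF i] by simp
        show "\<exists>f. local_lift h z f \<and> (\<forall>a. orb_zero_at ((l \<circ> \<iota>) a) f z)" if "z \<in> unit_disk" for z
          using h that i unfolding orb_curve_def o_def by blast
      qed
    qed
    have "c * (norm x * t) ^ n * \<rho> ^ n \<le> (\<Sum>\<iota>\<in>F. cmod (jet_det (l \<circ> \<iota>) x v)) * \<rho> ^ n"
      using c(2)[of x v] x \<rho> by (intro mult_right_mono) (auto simp: t_def)
    also have "\<dots> \<le> (\<Sum>\<iota>\<in>F. B ^ (m - 1) * norm x ^ (n + n) * C)"
      unfolding sum_distrib_right by (rule sum_mono) (rule J)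
    also have "\<dots> = norm x ^ n * norm x ^ n * (c * (K - 1))"
      using c(1) by (simp add: K_def power_add)
    also have "\<dots> \<le> norm x ^ n * norm x ^ n * (c * K)"
      using c(1) x by (intro mult_left_mono) auto
    finally have "(c * norm x ^ n) * (t * \<rho>) ^ n \<le> (c * norm x ^ n) * (norm x ^ n * K)"
      by (simp add: power_mult_distrib mult_ac)
    then have le: "(t * \<rho>) ^ n \<le> norm x ^ n * K"
      using c(1) x by (simp add: mult_le_cancel_left_pos)
    have "t * \<rho> \<le> K * norm x"
    proof (rule power_le_imp_le_base[of _ "n - 1"])
      have "norm x ^ n * K \<le> norm x ^ n * K ^ n"
        using K n x by (intro mult_left_mono self_le_power) auto
      then show "(t * \<rho>) ^ Suc (n - 1) \<le> (K * norm x) ^ Suc (n - 1)"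
        using le n by (simp add: power_mult_distrib mult.commute)
    qed (use K x in simp)
    then show ?thesis by (simp add: t_def \<rho>_def x_def v_def)
  qed
  then show ?thesis using K by (intro exI[of _ K]) auto
qed

section \<open>From multiplicities to derivative estimates\<close>

text \<open>At a zero write L = g (w - z)^n with g nonvanishing and n at least m. The derivative is
  O(|w - z|^(n-1)), while |L|^((m-1)/m) is comparable to |w - z|^(n - n/m), and n/m is at least
  1.\<close>

lemma deriv_bound_at_zero:
  assumes L: "L analytic_on {z}" and nz: "\<forall>\<^sub>F w in at z. L w \<noteq> 0"
    and m: "m > 0" and ord: "L z = 0 \<Longrightarrow> int m \<le> zorder L z"
  shows "\<exists>C. \<forall>\<^sub>F w in at z. cmod (deriv L w) \<le> C * cmod (L w) powr ((real m - 1) / real m)"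
proof (cases "L z = 0")
  case False
  define F where "F w = cmod (deriv L w) / cmod (L w) powr ((real m - 1) / real m)" for w
  have "isCont L z" "isCont (deriv L) z"
    using L by (auto intro: analytic_at_imp_isCont analytic_deriv)
  then have "(F \<longlongrightarrow> F z) (at z)"
    using False unfolding isCont_def F_def by (intro tendsto_intros tendsto_powr) auto
  then have "\<forall>\<^sub>F w in at z. F w < F z + 1" by (rule order_tendstoD(2)) simp
  with nz have "\<forall>\<^sub>F w in at z. cmod (deriv L w) \<le> (F z + 1) * cmod (L w) powr ((real m - 1) / real m)"
  proof eventually_elim
    case (elim w)
    then have "cmod (L w) powr ((real m - 1) / real m) > 0" by simp
    with elim(2) show ?case unfolding F_def[of w] by (simp add: pos_divide_less_eq)
  qed
  then show ?thesis ..
next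
  case True
  define \<alpha> where "\<alpha> = (real m - 1) / real m"
  obtain e where e: "e > 0" "L holomorphic_on ball z e"
    using L by (meson analytic_at_ball)
  obtain d where d: "d > 0" "\<And>w. w \<noteq> z \<Longrightarrow> dist w z < d \<Longrightarrow> L w \<noteq> 0"
    using nz unfolding eventually_at by blast
  \<comment> \<open>A point where L does not vanish, as the factorization at z requires.\<close>
  define w0 where "w0 = z + of_real (min e d / 2)"
  have "cmod (w0 - z) = min e d / 2"
    unfolding w0_def using e(1) d(1) by (simp add: norm_divide)
  then have w0: "w0 \<noteq> z" "dist w0 z < e" "dist w0 z < d"
    using e(1) d(1) by (auto simp: dist_norm)
  then have "w0 \<in> ball z e" "L w0 \<noteq> 0"
    using d(2)[of w0] by (auto simp: dist_commute)
  then have ex: "\<exists>w\<in>ball z e. L w \<noteq> 0" by blast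
  define g where "g = zor_poly L z"
  define n where "n = nat (zorder L z)"
  obtain r where r: "r > 0" "cball z r \<subseteq> ball z e" "g holomorphic_on cball z r"
      "\<And>w. w \<in> cball z r \<Longrightarrow> L w = g w * (w - z) ^ n \<and> g w \<noteq> 0"
    using zorder_exist_zero[OF e(2) open_ball connected_ball centre_in_ball[THEN iffD2, OF e(1)] ex]
    unfolding g_def n_def by blast
  have n: "n \<ge> m" using ord[OF True] by (simp add: n_def)
  have ghol: "g holomorphic_on ball z r" using r(3) by (rule holomorphic_on_subset) auto
  have gan: "g analytic_on {z}" using ghol r(1) by (meson analytic_at centre_in_ball open_ball)
  have gz: "g z \<noteq> 0" using r(1) r(4)[of z] by auto
  define F where "F w = (cmod (deriv g w) * cmod (w - z) + real n * cmod (g w)) / cmod (g w) powr \<alpha>" for w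
  have "isCont g z" "isCont (deriv g) z"
    using gan by (auto intro: analytic_at_imp_isCont analytic_deriv)
  then have "(F \<longlongrightarrow> F z) (at z)"
    using gz unfolding isCont_def F_def by (intro tendsto_intros tendsto_powr) auto
  then have evF: "\<forall>\<^sub>F w in at z. F w < F z + 1" by (rule order_tendstoD(2)) simp
  \<comment> \<open>Within distance 1 of z a larger exponent gives a smaller power, as used in
    comparing n - 1 with n (m - 1)/m.\<close>
  have evb: "\<forall>\<^sub>F w in at z. w \<in> ball z (min r 1) - {z}"
    by (rule eventually_at_in_open) (use r(1) in auto)
  have "\<forall>\<^sub>F w in at z. cmod (deriv L w) \<le> (F z + 1) * cmod (L w) powr \<alpha>"
    using evF evb
  proof eventually_elim
    case (elim w)
    define s where "s = cmod (w - z)"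
    have s: "0 < s" "s < 1" and wr: "w \<in> ball z r"
      using elim(2) by (auto simp: s_def dist_norm norm_minus_commute)
    have gw: "g w \<noteq> 0" using r(4)[of w] wr by auto
    have dg: "(g has_field_derivative deriv g w) (at w)"
      using ghol wr by (rule holomorphic_derivI[OF _ open_ball])
    have "((\<lambda>w. g w * (w - z) ^ n) has_field_derivative deriv g w * (w - z) ^ n + g w * (of_nat n * (w - z) ^ (n - 1))) (at w)"
      by (auto intro!: derivative_eq_intros dg)
    then have "(L has_field_derivative deriv g w * (w - z) ^ n + g w * (of_nat n * (w - z) ^ (n - 1))) (at w)"
      by (rule has_field_derivative_transform_within_open[OF _ open_ball wr]) (use r(4) in auto)
    then have dL: "deriv L w = deriv g w * (w - z) ^ n + g w * (of_nat n * (w - z) ^ (n - 1))"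
      by (rule DERIV_imp_deriv)
    have pw: "(w - z) ^ n = (w - z) * (w - z) ^ (n - 1)"
      using n m power_minus_mult[of n "w - z"] by (simp add: mult.commute)
    have "deriv L w = (deriv g w * (w - z) + of_nat n * g w) * (w - z) ^ (n - 1)"
    proof -
      have "a * (b * c) + d * (e * c) = (a * b + e * d) * c" for a b c d e :: complex
        by (simp add: algebra_simps)
      then show ?thesis unfolding dL pw .
    qed
    then have "cmod (deriv L w) = cmod (deriv g w * (w - z) + of_nat n * g w) * s ^ (n - 1)"
      by (simp only: norm_mult norm_power s_def)
    also have "\<dots> \<le> (cmod (deriv g w) * s + real n * cmod (g w)) * s ^ (n - 1)"
      using s norm_triangle_ineq[of "deriv g w * (w - z)" "of_nat n * g w"]
      by (intro mult_right_mono) (auto simp: norm_mult s_def)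
    also have "\<dots> = (F w * cmod (g w) powr \<alpha>) * s ^ (n - 1)"
      using gw by (simp add: F_def s_def)
    also have "\<dots> \<le> ((F z + 1) * cmod (g w) powr \<alpha>) * s ^ (n - 1)"
      using elim(1) s by (intro mult_right_mono) auto
    also have "\<dots> \<le> ((F z + 1) * cmod (g w) powr \<alpha>) * s powr (real n * \<alpha>)"
    proof (rule mult_left_mono)
      have "real n / real m \<ge> 1" using n m by simp
      then have "real n * \<alpha> \<le> real (n - 1)"
        using n m by (simp add: \<alpha>_def diff_divide_distrib right_diff_distrib of_nat_diff)
      then have "s powr real (n - 1) \<le> s powr (real n * \<alpha>)"
        using s by (intro powr_mono') auto
      then show "s ^ (n - 1) \<le> s powr (real n * \<alpha>)" using s by (simp add: powr_realpow)
      show "0 \<le> (F z + 1) * cmod (g w) powr \<alpha>"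
        by (intro mult_nonneg_nonneg) (auto simp: F_def)
    qed
    also have "\<dots> = (F z + 1) * cmod (L w) powr \<alpha>"
      using s r(4)[of w] wr by (simp add: norm_mult norm_power powr_mult s_def[symmetric] powr_realpow[symmetric] powr_powr)
    finally show ?case .
  qed
  then show ?thesis unfolding \<alpha>_def ..
qed

lemma analytic_zero_dichotomy:
  assumes "L analytic_on {z}"
  shows "(\<forall>\<^sub>F w in at z. L w \<noteq> 0) \<or> (\<forall>\<^sub>F w in nhds z. L w = (0::complex))"
proof -
  obtain e where e: "e > 0" "L holomorphic_on ball z e"
    using assms by (meson analytic_at_ball)
  show ?thesis
  proof (cases "\<exists>b\<in>ball z e. L b \<noteq> 0")
    case True
    then obtain b where "b \<in> ball z e" "L b \<noteq> 0" by blast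
    then have "\<forall>\<^sub>F w in at z. L w \<noteq> 0 \<and> w \<in> ball z e"
      using non_zero_neighbour_alt[OF e(2) open_ball connected_ball] e(1) by auto
    then show ?thesis by (auto elim: eventually_mono)
  next
    case False
    then have "\<forall>\<^sub>F w in nhds z. L w = 0"
      using e(1) unfolding eventually_nhds by (intro exI[of _ "ball z e"]) auto
    then show ?thesis ..
  qed
qed

lemma open_eventually_at:
  fixes D :: "'a::t1_space set"
  assumes "open D"
  shows "open {z \<in> D. \<forall>\<^sub>F w in at z. P w}"
proof (subst open_subopen, intro ballI)
  fix z assume z: "z \<in> {z \<in> D. \<forall>\<^sub>F w in at z. P w}"
  then obtain S where S: "open S" "z \<in> S" "\<And>w. w \<in> S \<Longrightarrow> w \<noteq> z \<Longrightarrow> P w"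
    unfolding eventually_at_topological by blast
  have "\<forall>\<^sub>F w in at y. P w" if "y \<in> S" for y
  proof (cases "y = z")
    case False
    then show ?thesis
      unfolding eventually_at_topological using S that
      by (intro exI[of _ "S - {z}"]) auto
  qed (use z in simp)
  then show "\<exists>T. open T \<and> z \<in> T \<and> T \<subseteq> {z \<in> D. \<forall>\<^sub>F w in at z. P w}"
    using S(1,2) assms z by (intro exI[of _ "S \<inter> D"]) auto
qed

text \<open>Identity theorem: around each point the curve either stays in the hyperplane or avoids
  it in a punctured neighbourhood. Both alternatives define open sets, disjoint and covering the
  disc, so connectedness leaves only one.\<close>

lemma curve_leaves_hyperplane:
  assumes h: "holomorphic_proj h unit_disk" and nsub: "\<not> h ` unit_disk \<subseteq> hyperplane a" and z: "z \<in> unit_disk"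
  shows "\<forall>\<^sub>F w in at z. h w \<notin> hyperplane a"
proof (rule ccontr)
  assume contr: "\<not> ?thesis"
  define A where "A = {z \<in> unit_disk. \<forall>\<^sub>F w in nhds z. h w \<in> hyperplane a}"
  define B where "B = {z \<in> unit_disk. \<forall>\<^sub>F w in at z. h w \<notin> hyperplane a}"
  have "unit_disk \<subseteq> A \<union> B"
  proof
    fix w assume w: "w \<in> unit_disk"
    obtain f where f: "local_lift h w f" using ex_local_lift[OF h open_ball w] by blast
    have L: "(\<lambda>y. bil (rep_cproj a) (f y)) analytic_on {w}"
      by (intro analytic_on_bil local_lift_analytic[OF f])
    have "\<forall>\<^sub>F y in nhds w. f y \<noteq> 0 \<and> h y = abs_cproj (f y)"
      using f by (simp add: local_lift_def)
    then have ev: "\<forall>\<^sub>F y in nhds w. h y \<in> hyperplane a \<longleftrightarrow> bil (rep_cproj a) (f y) = 0"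
      by eventually_elim simp
    from analytic_zero_dichotomy[OF L] show "w \<in> A \<union> B"
    proof
      assume "\<forall>\<^sub>F y in at w. bil (rep_cproj a) (f y) \<noteq> 0"
      moreover have "\<forall>\<^sub>F y in at w. h y \<in> hyperplane a \<longleftrightarrow> bil (rep_cproj a) (f y) = 0"
        using ev eventually_nhds_conv_at by blast
      ultimately have "\<forall>\<^sub>F y in at w. h y \<notin> hyperplane a" by eventually_elim blast
      then show ?thesis using w by (simp add: B_def)
    next
      assume "\<forall>\<^sub>F y in nhds w. bil (rep_cproj a) (f y) = 0"
      with ev have "\<forall>\<^sub>F y in nhds w. h y \<in> hyperplane a" by eventually_elim blast
      then show ?thesis using w by (simp add: A_def)
    qed
  qed
  moreover have "open A"
  proof (subst open_subopen, intro ballI)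
    fix w assume w: "w \<in> A"
    then obtain S where "open S" "w \<in> S" "\<And>y. y \<in> S \<Longrightarrow> \<forall>\<^sub>F y in nhds y. h y \<in> hyperplane a"
      unfolding A_def mem_Collect_eq
      by (subst (asm) eventually_eventually[symmetric]) (auto simp: eventually_nhds[where a = w])
    then show "\<exists>T. open T \<and> w \<in> T \<and> T \<subseteq> A"
      using w by (intro exI[of _ "S \<inter> unit_disk"]) (auto simp: A_def)
  qed
  moreover have "open B" unfolding B_def by (rule open_eventually_at) simp
  moreover have "A \<inter> B \<inter> unit_disk = {}"
  proof -
    have False if "w \<in> A" "w \<in> B" for w
    proof -
      have "\<forall>\<^sub>F y in at w. h y \<in> hyperplane a"
        using that(1) unfolding A_def eventually_nhds_conv_at by blast
      moreover have "\<forall>\<^sub>F y in at w. h y \<notin> hyperplane a" using that(2) by (simp add: B_def)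
      ultimately have "\<forall>\<^sub>F y in at w. False" by eventually_elim blast
      then show False by simp
    qed
    then show ?thesis by blast
  qed
  moreover have "B \<inter> unit_disk \<noteq> {}"
  proof -
    obtain w where w: "w \<in> unit_disk" "h w \<notin> hyperplane a" using nsub by blast
    then have "w \<notin> A" using eventually_nhds_x_imp_x unfolding A_def by blast
    then show ?thesis using calculation(1) w(1) by blast
  qed
  moreover have "A \<inter> unit_disk \<noteq> {}"
  proof -
    have "z \<notin> B" using contr by (simp add: B_def)
    then show ?thesis using calculation(1) z by blast
  qed
  ultimately show False
    using connectedD[OF connected_ball, of A B 0 1] by blast
qed

lemma orbifold_map_orb_curve:
  fixes H :: "nat \<Rightarrow> 'k::finite cproj"
  assumes h: "orbifold_map d H \<mu> h" and N: "N \<le> d"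
    and \<mu>: "\<And>i. i \<in> {1..d} \<Longrightarrow> ereal (real CARD('k + 'k)) \<le> \<mu> i"
  shows "orb_curve (\<lambda>i. rep_cproj (H i)) N h"
  unfolding orb_curve_def
proof
  fix z assume z: "z \<in> unit_disk"
  have hol: "holomorphic_proj h unit_disk" using h by (simp add: orbifold_map_def)
  define m where "m = CARD('k + 'k)"
  \<comment> \<open>The same choice of chart as in \<open>pullback_mult\<close>, so that L below is
    literally the function whose order is taken there.\<close>
  define j where "j = (SOME j. h z \<in> chart j)"
  have "h z \<in> chart j" unfolding j_def by (rule someI_ex) (rule ex_chart)
  define f where "f = chart_lift h j"
  have f: "local_lift h z f"
    unfolding f_def by (rule local_lift_chart[OF hol open_ball z \<open>h z \<in> chart j\<close>])
  have "orb_zero_at (rep_cproj (H i)) f z" if i: "i \<in> {1..N}" for i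
  proof -
    have id: "i \<in> {1..d}" using i N by auto
    define L where "L w = bil (rep_cproj (H i)) (f w)" for w
    have L: "L analytic_on {z}"
      unfolding L_def by (intro analytic_on_bil local_lift_analytic[OF f])
    have Leq: "L = (\<lambda>w. local_equation (H i) j (h w))"
      by (simp add: fun_eq_iff L_def f_def local_equation_def bil_def chart_lift_def)
    have "hyperplane (H i) \<subseteq> orb_support d H" using id by (auto simp: orb_support_def)
    then have "\<not> h ` unit_disk \<subseteq> hyperplane (H i)"
      using h unfolding orbifold_map_def by blast
    from curve_leaves_hyperplane[OF hol this z]
    have "\<forall>\<^sub>F w in at z. h w \<notin> hyperplane (H i)" .
    moreover have "\<forall>\<^sub>F w in nhds z. local_lift h w f" by (rule eventually_local_lift[OF f])
    then have "\<forall>\<^sub>F w in at z. local_lift h w f" using eventually_nhds_conv_at by blast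
    ultimately have nz: "\<forall>\<^sub>F w in at z. L w \<noteq> 0"
    proof eventually_elim
      case (elim w)
      then show ?case using local_lift_point[OF elim(2)] by (simp add: L_def)
    qed
    have ord: "int m \<le> zorder L z" if "L z = 0"
    proof -
      have "h z \<in> hyperplane (H i)"
        using that local_lift_point[OF f] by (simp add: L_def)
      then have "\<mu> i \<le> ereal (of_int (pullback_mult h (H i) z))"
        using h id z unfolding orbifold_map_def by blast
      also have "pullback_mult h (H i) z = zorder L z"
        unfolding pullback_mult_def Leq j_def ..
      finally have "ereal (real m) \<le> ereal (of_int (zorder L z))"
        using \<mu>[OF id] unfolding m_def by (rule order_trans[rotated])
      then show ?thesis by simp
    qed
    have "m > 0" by (simp add: m_def)
    from deriv_bound_at_zero[OF L nz this ord]
    obtain C where C: "\<forall>\<^sub>F w in at z. cmod (deriv L w) \<le> C * cmod (L w) powr ((real m - 1) / real m)"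
      by blast
    have "\<forall>\<^sub>F w in at z. L w \<noteq> 0 \<and> cmod (bil (rep_cproj (H i)) (vderiv f w)) \<le> C * cmod (L w) powr ((real m - 1) / real m)"
      using nz C \<open>\<forall>\<^sub>F w in at z. local_lift h w f\<close>
    proof eventually_elim
      case (elim w)
      have "deriv L w = bil (rep_cproj (H i)) (vderiv f w)"
        unfolding L_def by (rule deriv_bil[OF local_lift_analytic[OF elim(3)]])
      with elim show ?case by simp
    qed
    then show ?thesis
      unfolding orb_zero_at_def L_def m_def by blast
  qed
  with f show "\<exists>f. local_lift h z f \<and> (\<forall>i\<in>{1..N}. orb_zero_at (rep_cproj (H i)) f z)" by blast
qed

section \<open>A distance on projective space\<close>

text \<open>F is only real differentiable, so the Schwarz lemma is replaced by integration along the
  geodesic from w to z, the image of a radius under an automorphism of the disc. Its length is 2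
  artanh |b|, whence A / 2.\<close>

lemma hyperbolic_lipschitz:
  fixes F :: "complex \<Rightarrow> complex"
  assumes F: "\<And>z. z \<in> unit_disk \<Longrightarrow> \<exists>D. (F has_derivative D) (at z) \<and> (\<forall>b. cmod (D b) * (1 - (cmod z)^2) \<le> A * cmod b)"
    and z: "z \<in> unit_disk" and w: "w \<in> unit_disk"
  shows "cmod (F z - F w) \<le> A / 2 * poincare_dist z w"
proof -
  define b where "b = (z - w) / (1 - cnj w * z)"
  have sq: "(cmod x)^2 < 1" if "cmod x < 1" for x :: complex
    using that by (simp add: abs_square_less_1)
  have pos: "1 - cnj a * u \<noteq> 0" "1 + cnj a * u \<noteq> 0" if "cmod a < 1" "cmod u < 1" for a u
  proof -
    have "cmod (cnj a * u) < 1"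
      using mult_strict_mono'[of "cmod a" 1 "cmod u" 1] that by (simp add: norm_mult)
    then show "1 - cnj a * u \<noteq> 0" "1 + cnj a * u \<noteq> 0"
      by (metis norm_one order_less_irrefl right_minus_eq)
        (metis \<open>cmod (cnj a * u) < 1\<close> add_eq_0_iff norm_minus_cancel norm_one order_less_irrefl)
  qed
  have wz: "cmod w < 1" "cmod z < 1" using w z by auto
  have id: "(cmod (1 - cnj w * z))^2 - (cmod (z - w))^2 = (1 - (cmod w)^2) * (1 - (cmod z)^2)"
    unfolding cmod_power2 by (simp add: power2_eq_square algebra_simps)
  have "(1 - (cmod w)^2) * (1 - (cmod z)^2) > 0" using sq wz by (intro mult_pos_pos) auto
  then have "(cmod (z - w))^2 < (cmod (1 - cnj w * z))^2" using id by linarith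
  then have "cmod (z - w) < cmod (1 - cnj w * z)" by (rule power_less_imp_less_base) simp
  then have b1: "cmod b < 1" using pos(1)[OF wz] by (simp add: b_def norm_divide divide_less_eq)
  \<comment> \<open>The automorphism with M(0) = w and M(b) = z.\<close>
  define M where "M u = (u + w) / (1 + cnj w * u)" for u
  have M0: "M 0 = w" by (simp add: M_def)
  have w2: "1 - cnj w * w \<noteq> 0" using pos(1)[OF wz(1) wz(1)] .
  have Mb: "M b = z"
  proof -
    have d: "1 - cnj w * z \<noteq> 0" by (rule pos(1)[OF wz])
    have "b + w = z * (1 - cnj w * w) / (1 - cnj w * z)"
      unfolding b_def using d by (simp add: divide_simps) (simp add: algebra_simps)
    moreover have "1 + cnj w * b = (1 - cnj w * w) / (1 - cnj w * z)"
      unfolding b_def using d by (simp add: divide_simps) (simp add: algebra_simps)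
    ultimately show ?thesis using d w2 by (simp add: M_def)
  qed
  have id2: "(cmod (1 + cnj w * u))^2 - (cmod (u + w))^2 = (1 - (cmod w)^2) * (1 - (cmod u)^2)" for u
    unfolding cmod_power2 by (simp add: power2_eq_square algebra_simps)
  have M1: "1 - (cmod (M u))^2 = (1 - (cmod w)^2) * (1 - (cmod u)^2) / (cmod (1 + cnj w * u))^2" if "cmod u < 1" for u
    using pos(2)[OF wz(1) that] unfolding id2[symmetric]
    by (simp add: M_def norm_divide power_divide diff_divide_distrib)
  have Min: "M u \<in> unit_disk" if "cmod u < 1" for u
  proof -
    have "0 < 1 - (cmod (M u))^2"
      unfolding M1[OF that] using sq[OF that] sq[OF wz(1)] pos(2)[OF wz(1) that]
      by (intro divide_pos_pos mult_pos_pos) auto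
    then show ?thesis by (simp add: abs_square_less_1)
  qed
  have dM: "(M has_field_derivative (1 - (cmod w)^2) / (1 + cnj w * u)^2) (at u)" if "cmod u < 1" for u
  proof -
    have "(M has_field_derivative ((1 + cnj w * u) - (u + w) * cnj w) / ((1 + cnj w * u) * (1 + cnj w * u))) (at u)"
      unfolding M_def using pos(2)[OF wz(1) that] by (auto intro!: derivative_eq_intros)
    moreover have "(1 + cnj w * u) - (u + w) * cnj w = of_real (1 - (cmod w)^2)"
      by (simp add: complex_norm_square algebra_simps del: of_real_power)
    ultimately show ?thesis by (simp add: power2_eq_square)
  qed
  define G where "G t = F (M (of_real t * b))" for t :: real
  have tb: "cmod (of_real t * b) < 1" if "0 \<le> t" "t \<le> 1" for t
    using that b1 mult_right_le_one_le[of "cmod b" t] by (simp add: norm_mult mult.commute)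
  have "\<exists>g. (G has_vector_derivative g) (at t) \<and> norm g \<le> A * (cmod b / (1 - (t * cmod b)^2))"
    if t: "0 \<le> t" "t \<le> 1" for t
  proof -
    define u where "u = complex_of_real t * b"
    have u: "cmod u < 1" using tb[OF t] by (simp add: u_def)
    obtain D where D: "(F has_derivative D) (at (M u))" "\<And>h. cmod (D h) * (1 - (cmod (M u))^2) \<le> A * cmod h"
      using F[OF Min[OF u]] by blast
    define c where "c = (1 - complex_of_real ((cmod w)^2)) / (1 + cnj w * u)^2"
    have "((\<lambda>t. complex_of_real t * b) has_vector_derivative b) (at t)"
      by (auto intro!: derivative_eq_intros)
    moreover have "(M has_field_derivative c) (at (of_real t * b))"
      using dM[OF u] by (simp add: u_def c_def)
    ultimately have "(M \<circ> (\<lambda>t. complex_of_real t * b) has_vector_derivative b * c) (at t)"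
      by (rule field_vector_diff_chain_at)
    then have "((\<lambda>t. M (complex_of_real t * b)) has_derivative (\<lambda>s. s *\<^sub>R (b * c))) (at t)"
      by (simp add: has_vector_derivative_def o_def)
    from has_derivative_compose[OF this D(1)[unfolded u_def]]
    have "(G has_derivative (\<lambda>s. D (s *\<^sub>R (b * c)))) (at t)"
      by (simp add: G_def[abs_def])
    moreover have "D (s *\<^sub>R (b * c)) = s *\<^sub>R D (b * c)" for s
      by (rule linear_scale[OF has_derivative_linear[OF D(1)]])
    ultimately have 1: "(G has_vector_derivative D (b * c)) (at t)"
      by (simp add: has_vector_derivative_def)
    have q: "1 - (cmod u)^2 > 0" "1 - (cmod (M u))^2 > 0" using sq[OF u] sq Min[OF u] by auto
    have "cmod c = (1 - (cmod w)^2) / (cmod (1 + cnj w * u))^2"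
    proof -
      have "cmod (1 - complex_of_real ((cmod w)^2)) = \<bar>1 - (cmod w)^2\<bar>"
        by (metis norm_of_real of_real_1 of_real_diff)
      then show ?thesis using sq[OF wz(1)] by (simp add: c_def norm_divide norm_power del: of_real_power)
    qed
    \<comment> \<open>Automorphisms preserve the Poincare density.\<close>
    then have "cmod c * (1 - (cmod u)^2) = 1 - (cmod (M u))^2"
      unfolding M1[OF u] by simp
    then have c: "cmod c / (1 - (cmod (M u))^2) = 1 / (1 - (cmod u)^2)"
      using q by (simp add: frac_eq_eq)
    have "cmod (D (b * c)) \<le> A * cmod b * (cmod c / (1 - (cmod (M u))^2))"
      using D(2)[of "b * c"] q(2) by (simp add: norm_mult pos_le_divide_eq mult.assoc)
    then have "cmod (D (b * c)) \<le> A * cmod b / (1 - (cmod u)^2)"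
      unfolding c by simp
    moreover have "cmod u = t * cmod b" using t by (simp add: u_def norm_mult)
    ultimately show ?thesis using 1 by (intro exI[of _ "D (b * c)"]) simp
  qed
  then obtain g where g: "\<And>t. 0 \<le> t \<Longrightarrow> t \<le> 1 \<Longrightarrow> (G has_vector_derivative g t) (at t) \<and> norm (g t) \<le> A * (cmod b / (1 - (t * cmod b)^2))"
    by metis
  define Q where "Q t = A * artanh (t * cmod b)" for t
  have art: "(Q has_vector_derivative A * (cmod b / (1 - (t * cmod b)^2))) (at t)" if "0 \<le> t" "t \<le> 1" for t
  proof -
    have "\<bar>t * cmod b\<bar> < 1" using tb[OF that] that by (simp add: norm_mult)
    then have "(Q has_field_derivative A * (1 / (1 - (t * cmod b)^2) * cmod b)) (at t)"
      unfolding Q_def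
      by (intro DERIV_cmult DERIV_chain2[OF artanh_real_has_field_derivative]) (auto intro!: derivative_eq_intros)
    then show ?thesis by (simp add: has_real_derivative_iff_has_vector_derivative)
  qed
  have cont: "isCont G t" "isCont Q t" if "0 \<le> t" "t \<le> 1" for t
    using g[OF that] art[OF that] has_vector_derivative_continuous by blast+
  have "norm (G 1 - G 0) \<le> Q 1 - Q 0"
  proof (rule differentiable_bound_general[of 0 1 G Q g "\<lambda>t. A * (cmod b / (1 - (t * cmod b)^2))"])
    show "continuous_on {0..1} G" "continuous_on {0..1} Q"
      by (auto intro!: continuous_at_imp_continuous_on cont)
  qed (use g art in auto)
  then show ?thesis
    by (simp add: G_def M0 Mb Q_def poincare_dist_def b_def[symmetric])
qed

text \<open>An entry of the orthogonal projection onto the line of x. These matrices embed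
  projective space and yield an explicit distance whose growth along a curve is controlled by the
  Fubini-Study speed.\<close>

definition proj_entry :: "'k \<Rightarrow> 'k \<Rightarrow> complex ^ 'k::finite \<Rightarrow> complex" where
  "proj_entry i j x = x $ i * cnj (x $ j) / bil (cnjv x) x"

lemma proj_entry_scale:
  assumes "c \<noteq> 0"
  shows "proj_entry i j (c *s x) = proj_entry i j x"
  using assms by (simp add: proj_entry_def cnjv_scale)

lemma proj_entry_abs:
  assumes "x \<noteq> 0"
  shows "proj_entry i j (rep_cproj (abs_cproj x)) = proj_entry i j x"
proof -
  obtain c where c: "rep_cproj (abs_cproj x) = c *s x"
    using abs_cproj_eq_iff[OF rep_cproj_nz assms, of "abs_cproj x"] by auto
  then have "c \<noteq> 0" using rep_cproj_nz[of "abs_cproj x"] by auto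
  then show ?thesis unfolding c by (rule proj_entry_scale)
qed

definition proj_dist :: "'k::finite cproj \<Rightarrow> 'k cproj \<Rightarrow> real" where
  "proj_dist a b = (\<Sum>i\<in>UNIV. \<Sum>j\<in>UNIV. cmod (proj_entry i j (rep_cproj a) - proj_entry i j (rep_cproj b)))"

lemma proj_dist_nonneg: "proj_dist a b \<ge> 0"
  by (simp add: proj_dist_def sum_nonneg)

lemma proj_dist_commute: "proj_dist a b = proj_dist b a"
  by (simp add: proj_dist_def norm_minus_commute)

lemma proj_dist_self: "proj_dist a a = 0"
  by (simp add: proj_dist_def)

lemma proj_dist_triangle: "proj_dist a c \<le> proj_dist a b + proj_dist b c"
  unfolding proj_dist_def sum.distrib[symmetric]
  by (intro sum_mono) (metis diff_add_cancel diff_diff_eq2 norm_triangle_ineq)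

lemma proj_dist_eq_0:
  assumes "proj_dist a b = 0"
  shows "a = b"
proof -
  define x where "x = rep_cproj a"
  define y where "y = rep_cproj b"
  have nz: "x \<noteq> 0" "y \<noteq> 0" by (simp_all add: x_def y_def)
  have e: "proj_entry i j x = proj_entry i j y" for i j
    using assms unfolding proj_dist_def x_def y_def
    by (subst (asm) sum_nonneg_eq_0_iff; simp add: sum_nonneg sum_nonneg_eq_0_iff)
  have bx: "bil (cnjv x) x \<noteq> 0" "bil (cnjv y) y \<noteq> 0" using nz by simp_all
  obtain j where j: "x $ j \<noteq> 0" using nz(1) by (metis vec_eq_iff zero_index)
  define c where "c = (cnj (y $ j) / bil (cnjv y) y) * (bil (cnjv x) x / cnj (x $ j))"
  have "x $ i = c * y $ i" for i
    using e[of i j] bx j by (simp add: proj_entry_def c_def field_simps)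
  then have "x = c *s y" by (simp add: vec_eq_iff)
  then have "abs_cproj x = abs_cproj y" using abs_cproj_eq_iff[OF nz] by blast
  then show ?thesis by (simp add: x_def y_def)
qed

text \<open>For the normalized lift f'(z) is orthogonal to f(z), so the denominator |f|^2 is
  stationary at z and only the two terms of the numerator contribute.\<close>

lemma proj_entry_curve_derivative:
  fixes f :: "complex \<Rightarrow> complex ^ 'k::finite"
  assumes f: "local_lift h z f" and nf: "norm (f z) = 1"
    and nrm: "\<forall>\<^sub>F w in nhds z. bil (cnjv (f z)) (f w) = 1"
  shows "\<exists>D. ((\<lambda>w. proj_entry i j (rep_cproj (h w))) has_derivative D) (at z)
    \<and> (\<forall>b. cmod (D b) \<le> 2 * norm (tangent_part (f z) (vderiv f z)) * cmod b)"
proof -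
  define x where "x = f z"
  define v where "v = vderiv f z"
  have an: "(\<lambda>w. f w $ c) analytic_on {z}" for c by (rule local_lift_analytic[OF f])
  have xx: "bil (cnjv x) x = 1" using nf by (simp add: x_def bil_cnjv_self)
  have xv: "bil (cnjv x) v = 0"
  proof -
    have "deriv (\<lambda>w. bil (cnjv x) (f w)) z = deriv (\<lambda>w. 1) z"
      by (rule deriv_cong_ev) (use nrm in \<open>auto simp: x_def\<close>)
    then show ?thesis using deriv_bil[OF an, of "cnjv x"] by (simp add: v_def)
  qed
  have tv: "tangent_part x v = v" by (simp add: tangent_part_def xv)
  have d: "((\<lambda>w. f w $ c) has_derivative (\<lambda>b. v $ c * b)) (at z)" for c
    using analytic_on_imp_differentiable_at[OF an[of c]]
    by (simp add: v_def vderiv_def has_field_derivative_def[symmetric] DERIV_deriv_iff_field_differentiable)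
  have S: "((\<lambda>w. bil (cnjv (f w)) (f w)) has_derivative (\<lambda>b. 0)) (at z)"
  proof -
    have "((\<lambda>w. bil (cnjv (f w)) (f w)) has_derivative (\<lambda>b. \<Sum>c\<in>UNIV. cnj (f z $ c) * (v $ c * b) + cnj (v $ c * b) * f z $ c)) (at z)"
      unfolding bil_def cnjv_nth by (intro derivative_intros d)
    moreover have "(\<Sum>c\<in>UNIV. cnj (f z $ c) * (v $ c * b) + cnj (v $ c * b) * f z $ c) = bil (cnjv x) v * b + cnj (bil (cnjv x) v * b)" for b
      by (simp add: bil_def sum.distrib sum_distrib_right sum_distrib_left x_def mult_ac)
    ultimately show ?thesis by (simp add: xv)
  qed
  have d0: "((\<lambda>w. proj_entry i j (f w)) has_derivative (\<lambda>b. x $ i * cnj (v $ j * b) + v $ i * b * cnj (x $ j))) (at z)"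
    unfolding proj_entry_def
    by (rule has_derivative_eq_rhs[OF has_derivative_divide[OF has_derivative_mult[OF d has_derivative_cnj[OF d]] S]])
      (use xx in \<open>auto simp: x_def\<close>)
  have ev: "\<forall>\<^sub>F w in nhds z. proj_entry i j (f w) = proj_entry i j (rep_cproj (h w))"
    using eventually_local_lift[OF f]
  proof eventually_elim
    case (elim w)
    show ?case using local_lift_point[OF elim] proj_entry_abs by metis
  qed
  then have ev': "\<forall>\<^sub>F w in at z. proj_entry i j (f w) = proj_entry i j (rep_cproj (h w))"
    using eventually_nhds_conv_at by blast
  have der: "((\<lambda>w. proj_entry i j (rep_cproj (h w))) has_derivative (\<lambda>b. x $ i * cnj (v $ j * b) + v $ i * b * cnj (x $ j))) (at z)"
    by (rule has_derivative_transform_eventually[OF d0 ev' eventually_nhds_x_imp_x[OF ev] UNIV_I])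
  have "cmod (x $ i * cnj (v $ j * b) + v $ i * b * cnj (x $ j)) \<le> 2 * norm v * cmod b" for b
  proof -
    have c: "cmod (x $ c) \<le> 1" "cmod (v $ c) \<le> norm v" for c
      using norm_component_le[of x c] norm_component_le[of v c] nf by (auto simp: x_def)
    have "cmod (x $ i * cnj (v $ j * b)) \<le> 1 * (norm v * cmod b)"
      unfolding norm_mult complex_mod_cnj by (intro mult_mono c) auto
    moreover have "cmod (v $ i * b * cnj (x $ j)) \<le> (norm v * cmod b) * 1"
      unfolding norm_mult complex_mod_cnj by (intro mult_mono c) auto
    ultimately show ?thesis
      using norm_triangle_ineq[of "x $ i * cnj (v $ j * b)" "v $ i * b * cnj (x $ j)"] by linarith
  qed
  then show ?thesis unfolding x_def[symmetric] v_def[symmetric] tv using der by blast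
qed

text \<open>Each of the (n + 1)^2 matrix entries has Lipschitz constant K: 2 K from its derivative,
  halved by the normalization of \<open>poincare_dist\<close>.\<close>

lemma proj_dist_curve_le:
  fixes h :: "complex \<Rightarrow> 'k::finite cproj"
  assumes lift: "\<And>z. z \<in> unit_disk \<Longrightarrow> \<exists>f. local_lift h z f"
    and K: "\<And>z f. z \<in> unit_disk \<Longrightarrow> local_lift h z f \<Longrightarrow>
      norm (tangent_part (f z) (vderiv f z)) * (1 - (cmod z)^2) \<le> K * norm (f z)"
    and zw: "z \<in> unit_disk" "w \<in> unit_disk"
  shows "proj_dist (h z) (h w) \<le> real CARD('k) * real CARD('k) * K * poincare_dist z w"
proof -
  have "cmod (proj_entry i j (rep_cproj (h z)) - proj_entry i j (rep_cproj (h w))) \<le> (2 * K) / 2 * poincare_dist z w" for i j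
  proof (rule hyperbolic_lipschitz[OF _ zw])
    fix y assume y: "y \<in> unit_disk"
    then have pos: "1 - (cmod y)^2 > 0" by (simp add: abs_square_less_1)
    obtain f0 where "local_lift h y f0" using lift[OF y] by blast
    then obtain f where f: "local_lift h y f" "norm (f y) = 1" "\<forall>\<^sub>F w in nhds y. bil (cnjv (f y)) (f w) = 1"
      using ex_normalized_lift by blast
    obtain D where D: "((\<lambda>w. proj_entry i j (rep_cproj (h w))) has_derivative D) (at y)"
        "\<And>b. cmod (D b) \<le> 2 * norm (tangent_part (f y) (vderiv f y)) * cmod b"
      using proj_entry_curve_derivative[OF f] by blast
    have "cmod (D b) * (1 - (cmod y)^2) \<le> 2 * K * cmod b" for b
    proof -
      have "cmod (D b) * (1 - (cmod y)^2) \<le> 2 * norm (tangent_part (f y) (vderiv f y)) * cmod b * (1 - (cmod y)^2)"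
        using D(2) pos by (intro mult_right_mono) auto
      also have "\<dots> = (norm (tangent_part (f y) (vderiv f y)) * (1 - (cmod y)^2)) * (2 * cmod b)" by simp
      also have "\<dots> \<le> K * (2 * cmod b)"
        using K[OF y f(1)] f(2) by (intro mult_right_mono) auto
      finally show ?thesis by simp
    qed
    with D(1) show "\<exists>D. ((\<lambda>w. proj_entry i j (rep_cproj (h w))) has_derivative D) (at y) \<and>
        (\<forall>b. cmod (D b) * (1 - (cmod y)^2) \<le> 2 * K * cmod b)" by blast
  qed
  then have "proj_dist (h z) (h w) \<le> (\<Sum>i\<in>(UNIV :: 'k set). \<Sum>j\<in>(UNIV :: 'k set). (2 * K) / 2 * poincare_dist z w)"
    unfolding proj_dist_def by (intro sum_mono)
  then show ?thesis by simp
qed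

section \<open>Chains of orbifold discs\<close>

lemma orbifold_map_avoids_floor:
  assumes h: "orbifold_map d H m h" and z: "z \<in> unit_disk"
  shows "h z \<notin> orb_floor d H m"
proof
  assume "h z \<in> orb_floor d H m"
  then obtain i where i: "i \<in> {1..d}" "m i = \<infinity>" "h z \<in> hyperplane (H i)"
    by (auto simp: orb_floor_def)
  then have "m i \<le> ereal (of_int (pullback_mult h (H i) z))"
    using h z unfolding orbifold_map_def by blast
  with i(2) show False by simp
qed

lemma ex_scaling_small:
  fixes a b :: "'i \<Rightarrow> real"
  assumes "finite I" "\<And>i. i \<in> I \<Longrightarrow> a i > 0"
  shows "\<exists>eps>0. \<forall>i\<in>I. eps * b i < a i"
proof -
  have "\<forall>\<^sub>F eps in at_right 0. eps * b i < a i" if "i \<in> I" for i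
  proof -
    have "((\<lambda>eps. eps * b i) \<longlongrightarrow> 0 * b i) (at_right 0)" by (intro tendsto_intros)
    then show ?thesis by (rule order_tendstoD(2)) (use assms(2)[OF that] in simp)
  qed
  then have "\<forall>\<^sub>F eps in at_right 0. \<forall>i\<in>I. eps * b i < a i"
    using assms(1) by (simp add: eventually_ball_finite)
  moreover have "\<forall>\<^sub>F eps in at_right (0::real). eps > 0"
    by (rule eventually_at_right_less)
  ultimately have "\<forall>\<^sub>F eps in at_right 0. eps > 0 \<and> (\<forall>i\<in>I. eps * b i < a i)"
    by eventually_elim blast
  then show ?thesis
    using eventually_happens[of _ "at_right (0::real)"] by (simp add: trivial_limit_at_right_real)
qed

lemma finite_affine_roots:
  fixes a b :: complex
  assumes "a \<noteq> 0 \<or> b \<noteq> 0"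
  shows "finite {s. a + s * b = 0}"
proof (cases "b = 0")
  case True
  then show ?thesis using assms by simp
next
  case False
  have "s = - a / b" if "a + s * b = 0" for s
  proof -
    have "s * b = - a" using that by (simp add: eq_neg_iff_add_eq_0 add.commute)
    then show ?thesis using nonzero_eq_divide_eq[OF False, of s "- a"] by blast
  qed
  then have "{s. a + s * b = 0} \<subseteq> {- a / b}" by blast
  then show ?thesis by (rule finite_subset) simp
qed

text \<open>The disc meets the hyperplanes at w = 0 only: those not containing x are avoided by
  smallness of y, and for those containing x the pulled back equation is w^M l_i(y), of order
  exactly M.\<close>

lemma orbifold_disc:
  fixes H :: "nat \<Rightarrow> 'k::finite cproj"
  defines "l \<equiv> \<lambda>i. rep_cproj (H i)"
  assumes d: "d \<ge> 1"
    and l: "\<And>i. i \<in> {1..d} \<Longrightarrow> bil (l i) x \<noteq> 0 \<or> bil (l i) y \<noteq> 0 \<and> m i \<le> ereal (real M)"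
    and M: "M \<ge> 1"
    and small: "\<And>i. i \<in> {1..d} \<Longrightarrow> bil (l i) x \<noteq> 0 \<Longrightarrow> cmod (bil (l i) y) < cmod (bil (l i) x)"
    and nz: "\<And>w. w \<in> unit_disk \<Longrightarrow> x + w ^ M *s y \<noteq> 0"
  shows "orbifold_map d H m (\<lambda>w. abs_cproj (x + w ^ M *s y))"
proof -
  define g where "g w = x + w ^ M *s y" for w
  define h where "h w = abs_cproj (g w)" for w
  have gnz: "g w \<noteq> 0" if "w \<in> unit_disk" for w using nz[OF that] by (simp add: g_def)
  have ghol: "(\<lambda>w. g w $ c) holomorphic_on S" for c S
    unfolding g_def vector_add_component vector_smult_component by (intro holomorphic_intros)
  have hol: "holomorphic_proj h unit_disk"
    unfolding holomorphic_proj_def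
  proof (intro allI conjI)
    fix j
    have eq: "{z \<in> unit_disk. h z \<in> chart j} = {z \<in> unit_disk. g z $ j \<noteq> 0}"
      using gnz by (auto simp: h_def)
    have "continuous_on unit_disk (\<lambda>z. g z $ j)"
      by (rule holomorphic_on_imp_continuous_on[OF ghol])
    then have "open (unit_disk \<inter> (\<lambda>z. g z $ j) -` (- {0}))"
      by (rule continuous_open_preimage) auto
    moreover have "unit_disk \<inter> (\<lambda>z. g z $ j) -` (- {0}) = {z \<in> unit_disk. g z $ j \<noteq> 0}" by auto
    ultimately show "open {z \<in> unit_disk. h z \<in> chart j}" unfolding eq by simp
    show "(\<lambda>z. affine_coord j i (h z)) holomorphic_on {z \<in> unit_disk. h z \<in> chart j}" for i
    proof (rule holomorphic_transform)
      show "(\<lambda>z. g z $ i / g z $ j) holomorphic_on {z \<in> unit_disk. h z \<in> chart j}"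
        unfolding eq by (intro holomorphic_intros ghol) auto
    qed (use gnz in \<open>auto simp: h_def\<close>)
  qed
  have inH: "h z \<in> hyperplane (H i) \<longleftrightarrow> bil (l i) x + z ^ M * bil (l i) y = 0" if "z \<in> unit_disk" for z i
    using gnz[OF that] by (simp add: h_def g_def l_def)
  have zero: "bil (l i) x = 0 \<and> z = 0" if "i \<in> {1..d}" "z \<in> unit_disk" "h z \<in> hyperplane (H i)" for i z
  proof -
    have e: "bil (l i) x + z ^ M * bil (l i) y = 0" using inH that by blast
    have "bil (l i) x = 0"
    proof (rule ccontr)
      assume x0: "bil (l i) x \<noteq> 0"
      have "cmod (z ^ M) \<le> 1" using that(2) by (simp add: norm_power power_le_one)
      then have "cmod (z ^ M * bil (l i) y) \<le> cmod (bil (l i) y)"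
        unfolding norm_mult by (rule mult_left_le_one_le[rotated 2]) simp_all
      then have "cmod (z ^ M * bil (l i) y) < cmod (bil (l i) x)" using small[OF that(1) x0] by simp
      moreover have "bil (l i) x = - (z ^ M * bil (l i) y)" using e by (simp add: eq_neg_iff_add_eq_0)
      ultimately show False by simp
    qed
    moreover have "z = 0"
      using e calculation l[OF that(1)] by auto
    ultimately show ?thesis by simp
  qed
  have "\<not> h ` unit_disk \<subseteq> orb_support d H"
  proof
    assume "h ` unit_disk \<subseteq> orb_support d H"
    moreover have "(1 / 2 :: complex) \<in> unit_disk" by simp
    ultimately obtain i where "i \<in> {1..d}" "h (1 / 2) \<in> hyperplane (H i)"
      unfolding orb_support_def by blast
    then show False using zero[of i "1 / 2"] by simp
  qed
  moreover have "m i \<le> ereal (of_int (pullback_mult h (H i) z))"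
    if i: "i \<in> {1..d}" and z: "z \<in> unit_disk" and hz: "h z \<in> hyperplane (H i)" for i z
  proof -
    have 0: "bil (l i) x = 0" "z = 0" using zero[OF i z hz] by auto
    have y: "bil (l i) y \<noteq> 0" "m i \<le> ereal (real M)" using l[OF i] 0 by auto
    define j where "j = (SOME j. h z \<in> chart j)"
    have "h z \<in> chart j" unfolding j_def by (rule someI_ex) (rule ex_chart)
    define U where "U = {w \<in> unit_disk. h w \<in> chart j}"
    have "open U" using hol unfolding holomorphic_proj_def U_def by blast
    moreover have zU: "z \<in> U" using z \<open>h z \<in> chart j\<close> by (simp add: U_def)
    have gj: "g w $ j \<noteq> 0" if "w \<in> U" for w using that gnz[of w] by (auto simp: U_def h_def)
    \<comment> \<open>In the chart the equation is w^M times the nonvanishing analytic factor l_i(y)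
      / g_j.\<close>
    have "zorder (\<lambda>w. local_equation (H i) j (h w)) z = int M"
    proof (rule zorder_eqI[OF \<open>open U\<close> zU])
      show "(\<lambda>w. bil (l i) y / g w $ j) holomorphic_on U"
        using gj by (intro holomorphic_intros ghol)
      show "bil (l i) y / g z $ j \<noteq> 0" using gj[OF zU] y by simp
      fix w assume w: "w \<in> U" "w \<noteq> z"
      have gw: "g w \<noteq> 0" using w gnz by (auto simp: U_def)
      have "local_equation (H i) j (h w) = bil (l i) (g w) / g w $ j"
        unfolding local_equation_def h_def bil_def l_def sum_divide_distrib affine_coord_abs[OF gw] by simp
      then show "local_equation (H i) j (h w) = bil (l i) y / g w $ j * (w - z) powi int M"
        using 0 by (simp add: g_def)
    qed
    then show ?thesis using y(2) unfolding pullback_mult_def j_def by simp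
  qed
  ultimately show ?thesis
    using hol unfolding orbifold_map_def h_def g_def by blast
qed

section \<open>Finiteness of the Kobayashi pseudo-distance\<close>

text \<open>Finiteness, for one pair of points, of the supremum over all decreasing
  pseudo-distances.\<close>

definition kob_bounded :: "nat \<Rightarrow> (nat \<Rightarrow> 'k::finite cproj) \<Rightarrow> (nat \<Rightarrow> ereal) \<Rightarrow> 'k cproj \<Rightarrow> 'k cproj \<Rightarrow> bool" where
  "kob_bounded d H m a b \<longleftrightarrow> (\<exists>C. \<forall>D. orb_decreasing_pseudo_distance d H m D \<longrightarrow> D a b \<le> C)"

lemma kob_bounded_disc:
  assumes "orbifold_map d H m h" "z \<in> unit_disk" "w \<in> unit_disk"
  shows "kob_bounded d H m (h z) (h w)"
proof -
  have "D (h z) (h w) \<le> poincare_dist z w" if "orb_decreasing_pseudo_distance d H m D" for D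
    using that assms unfolding orb_decreasing_pseudo_distance_def by blast
  then show ?thesis unfolding kob_bounded_def by blast
qed

lemma kob_bounded_sym:
  assumes "kob_bounded d H m a b" "a \<notin> orb_floor d H m" "b \<notin> orb_floor d H m"
  shows "kob_bounded d H m b a"
proof -
  obtain C where C: "\<And>D. orb_decreasing_pseudo_distance d H m D \<Longrightarrow> D a b \<le> C"
    using assms(1) unfolding kob_bounded_def by blast
  have "D b a \<le> C" if D: "orb_decreasing_pseudo_distance d H m D" for D
  proof -
    have "D b a = D a b"
      using D assms(2,3) unfolding orb_decreasing_pseudo_distance_def pseudo_distance_on_def by blast
    then show ?thesis using C[OF D] by simp
  qed
  then show ?thesis unfolding kob_bounded_def by blast
qed

lemma kob_bounded_trans:
  assumes "kob_bounded d H m a b" "kob_bounded d H m b c"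
    and "a \<notin> orb_floor d H m" "b \<notin> orb_floor d H m" "c \<notin> orb_floor d H m"
  shows "kob_bounded d H m a c"
proof -
  obtain C1 C2 where C: "\<And>D. orb_decreasing_pseudo_distance d H m D \<Longrightarrow> D a b \<le> C1"
      "\<And>D. orb_decreasing_pseudo_distance d H m D \<Longrightarrow> D b c \<le> C2"
    using assms(1,2) unfolding kob_bounded_def by blast
  have "D a c \<le> C1 + C2" if D: "orb_decreasing_pseudo_distance d H m D" for D
  proof -
    have "D a c \<le> D a b + D b c"
      using D assms(3-5) unfolding orb_decreasing_pseudo_distance_def pseudo_distance_on_def by blast
    then show ?thesis using C[OF D] by linarith
  qed
  then show ?thesis unfolding kob_bounded_def by blast
qed

text \<open>From a vector off the earlier hyperplanes, moving in the direction conj(l_j) meets each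
  hyperplane for finitely many parameters only.\<close>

lemma ex_vector_off_hyperplanes:
  fixes l :: "'i \<Rightarrow> complex ^ 'k::finite"
  assumes "finite I" "\<And>i. i \<in> I \<Longrightarrow> l i \<noteq> 0"
  shows "\<exists>y. \<forall>i\<in>I. bil (l i) y \<noteq> 0"
  using assms
proof (induction I rule: finite_induct)
  case empty
  then show ?case by simp
next
  case (insert j I)
  then obtain y where y: "\<forall>i\<in>I. bil (l i) y \<noteq> 0" by auto
  define e where "e = cnjv (l j)"
  have ej: "bil (l j) e \<noteq> 0"
  proof -
    have "bil (l j) e = bil (cnjv (l j)) (l j)" by (simp add: e_def bil_def mult.commute)
    then show ?thesis using insert.prems[of j] by simp
  qed
  have "finite (\<Union>i\<in>I. {s. bil (l i) y + s * bil (l i) e = 0})"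
  proof (intro finite_UN_I insert.hyps)
    show "finite {s. bil (l i) y + s * bil (l i) e = 0}" if "i \<in> I" for i
      using y that by (intro finite_affine_roots) blast
  qed
  moreover have "finite {s. bil (l j) y + s * bil (l j) e = 0}"
    using ej by (intro finite_affine_roots) blast
  ultimately have "finite ((\<Union>i\<in>I. {s. bil (l i) y + s * bil (l i) e = 0}) \<union> {s. bil (l j) y + s * bil (l j) e = 0})"
    by simp
  then obtain s where "s \<notin> (\<Union>i\<in>I. {s. bil (l i) y + s * bil (l i) e = 0}) \<union> {s. bil (l j) y + s * bil (l j) e = 0}"
    using ex_new_if_finite[OF infinite_UNIV_char_0[where 'a = complex]] by blast
  then show ?case
    by (intro exI[of _ "y + s *s e"]) auto
qed

lemma abs_cproj_notin_floor_iff: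
  assumes "x \<noteq> 0"
  shows "abs_cproj x \<notin> orb_floor d H m \<longleftrightarrow> (\<forall>i\<in>{1..d}. m i = \<infinity> \<longrightarrow> bil (rep_cproj (H i)) x \<noteq> 0)"
  using assms by (auto simp: orb_floor_def)

text \<open>A single disc x + w^M eps y reaches all x + s y with |s| < eps, since w^M takes every
  value in the unit disc. The exponent M must dominate the multiplicities of the hyperplanes through
  x, which are finite because x is off the floor.\<close>

lemma kob_bounded_near:
  fixes H :: "nat \<Rightarrow> 'k::finite cproj"
  assumes d: "d \<ge> 1" and x: "x \<noteq> 0" and fl: "abs_cproj x \<notin> orb_floor d H m"
    and y: "\<And>i. i \<in> {1..d} \<Longrightarrow> bil (rep_cproj (H i)) x \<noteq> 0 \<or> bil (rep_cproj (H i)) y \<noteq> 0"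
  shows "\<exists>eps>0. \<forall>s. cmod s < eps \<longrightarrow> x + s *s y \<noteq> 0 \<and> kob_bounded d H m (abs_cproj x) (abs_cproj (x + s *s y))
    \<and> (s \<noteq> 0 \<longrightarrow> (\<forall>i\<in>{1..d}. bil (rep_cproj (H i)) (x + s *s y) \<noteq> 0))"
proof -
  define l where "l i = rep_cproj (H i)" for i
  define Z where "Z = {i \<in> {1..d}. bil (l i) x = 0}"
  have "\<exists>n. m i \<le> ereal (real n)" if "i \<in> Z" for i
  proof -
    have "m i \<noteq> \<infinity>"
      using that fl abs_cproj_notin_floor_iff[OF x] by (auto simp: Z_def l_def)
    then show ?thesis
    proof (cases "m i")
      case (real r)
      then show ?thesis using real_arch_simple[of r] by auto
    qed auto
  qed
  then obtain n where n: "\<And>i. i \<in> Z \<Longrightarrow> m i \<le> ereal (real (n i))" by metis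
  \<comment> \<open>Bounds all \<open>n i\<close> at once, and is positive even if no hyperplane
    passes through x.\<close>
  define M where "M = 1 + sum n Z"
  have M: "M \<ge> 1" by (simp add: M_def)
  have mM: "m i \<le> ereal (real M)" if "i \<in> Z" for i
  proof -
    have "finite Z" by (simp add: Z_def)
    then have "n i \<le> M" using member_le_sum[of i Z n] that by (simp add: M_def)
    then show ?thesis using n[OF that] by (meson ereal_less_eq(3) of_nat_le_iff order_trans)
  qed
  obtain eps1 where eps1: "eps1 > 0" "\<forall>i\<in>{1..d} - Z. eps1 * cmod (bil (l i) y) < cmod (bil (l i) x)"
    using ex_scaling_small[of "{1..d} - Z" "\<lambda>i. cmod (bil (l i) x)" "\<lambda>i. cmod (bil (l i) y)"] by (auto simp: Z_def)
  obtain eps2 where eps2: "eps2 > 0" "eps2 * norm y < norm x"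
    using ex_scaling_small[of "{()}" "\<lambda>_. norm x" "\<lambda>_. norm y"] x by auto
  define eps where "eps = min eps1 eps2"
  have eps: "eps > 0" using eps1 eps2 by (simp add: eps_def)
  have epsl: "eps * cmod (bil (l i) y) < cmod (bil (l i) x)" if "i \<in> {1..d}" "bil (l i) x \<noteq> 0" for i
  proof -
    have "eps * cmod (bil (l i) y) \<le> eps1 * cmod (bil (l i) y)"
      by (rule mult_right_mono) (simp_all add: eps_def)
    also have "eps1 * cmod (bil (l i) y) < cmod (bil (l i) x)"
      using eps1(2) that by (simp add: Z_def)
    finally show ?thesis .
  qed
  have epsx: "eps * norm y < norm x"
    using eps2(2) mult_right_mono[of eps eps2 "norm y"] by (simp add: eps_def)
  have small: "cmod s * t \<le> eps * t" if "cmod s < eps" "t \<ge> 0" for s t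
    using that by (intro mult_right_mono) auto
  have nz: "x + s *s y \<noteq> 0" if "cmod s < eps" for s
  proof
    assume "x + s *s y = 0"
    then have "norm x = norm (s *s y)" by (metis add_eq_0_iff norm_minus_cancel)
    then show False
      using small[OF that, of "norm y"] epsx by (simp add: norm_vector_scale)
  qed
  define h where "h w = abs_cproj (x + w ^ M *s (of_real eps *s y))" for w
  have disc: "orbifold_map d H m h"
    unfolding h_def
  proof (rule orbifold_disc[OF d _ M])
    fix i assume i: "i \<in> {1..d}"
    show "bil (rep_cproj (H i)) x \<noteq> 0 \<or> bil (rep_cproj (H i)) (of_real eps *s y) \<noteq> 0 \<and> m i \<le> ereal (real M)"
      using y[OF i] mM[of i] i eps by (auto simp: Z_def l_def)
    show "cmod (bil (rep_cproj (H i)) (of_real eps *s y)) < cmod (bil (rep_cproj (H i)) x)" if "bil (rep_cproj (H i)) x \<noteq> 0"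
      using epsl[OF i] that eps by (simp add: norm_mult l_def)
  next
    fix w :: complex assume "w \<in> unit_disk"
    then have "cmod w ^ M < 1" using M by (simp add: power_less_one_iff)
    then have "cmod (w ^ M * of_real eps) < eps" using eps by (simp add: norm_mult norm_power)
    from nz[OF this] show "x + w ^ M *s (of_real eps *s y) \<noteq> 0" by (simp add: vector_smult_assoc)
  qed
  have "kob_bounded d H m (abs_cproj x) (abs_cproj (x + s *s y))" if s: "cmod s < eps" for s
  proof -
    have "M \<noteq> 0" using M by simp
    then obtain w where w': "s / of_real eps = w ^ M"
      by (rule exists_complex_root)
    note w = w'[symmetric]
    have "cmod w ^ M = cmod (s / of_real eps)"
      unfolding w[symmetric] by (rule norm_power[symmetric])
    also have "\<dots> < 1"
      using s eps by (simp add: norm_divide)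
    finally have "cmod w ^ M < 1" .
    then have "cmod w < 1" using M by (simp add: power_less_one_iff)
    moreover have "h 0 = abs_cproj x" using M by (simp add: h_def power_0_left)
    moreover have "h w = abs_cproj (x + s *s y)" using eps by (simp add: h_def w vector_smult_assoc)
    ultimately show ?thesis using kob_bounded_disc[OF disc, of 0 w] by simp
  qed
  moreover have "bil (l i) (x + s *s y) \<noteq> 0" if "cmod s < eps" "s \<noteq> 0" "i \<in> {1..d}" for s i
  proof (cases "bil (l i) x = 0")
    case True
    then show ?thesis using y[OF that(3)] that(2) by (simp add: l_def)
  next
    case False
    show ?thesis
    proof
      assume "bil (l i) (x + s *s y) = 0"
      then have "bil (l i) x = - (s * bil (l i) y)" by (simp add: eq_neg_iff_add_eq_0)
      then have "cmod (bil (l i) x) = cmod s * cmod (bil (l i) y)" by (simp add: norm_mult)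
      then show False using small[OF that(1), of "cmod (bil (l i) y)"] epsl[OF that(3) False] by simp
    qed
  qed
  ultimately show ?thesis using nz eps unfolding l_def by blast
qed

text \<open>On the complex line through p and q the hyperplanes exclude finitely many parameters,
  whose complement is connected; the local relation given by discs therefore holds globally.\<close>

lemma kob_bounded_generic:
  fixes H :: "nat \<Rightarrow> 'k::finite cproj"
  assumes d: "d \<ge> 1"
    and p: "\<And>i. i \<in> {1..d} \<Longrightarrow> bil (rep_cproj (H i)) p \<noteq> 0"
    and q: "\<And>i. i \<in> {1..d} \<Longrightarrow> bil (rep_cproj (H i)) q \<noteq> 0"
  shows "kob_bounded d H m (abs_cproj p) (abs_cproj q)"
proof -
  let ?R = "kob_bounded d H m"
  define l where "l i = rep_cproj (H i)" for i
  define v where "v = q - p"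
  define T where "T = UNIV - (\<Union>i\<in>{1..d}. {t. bil (l i) p + t * bil (l i) v = 0})"
  define g where "g t = p + t *s v" for t
  have gT: "g t \<noteq> 0" "abs_cproj (g t) \<notin> orb_floor d H m" "\<And>i. i \<in> {1..d} \<Longrightarrow> bil (l i) (g t) \<noteq> 0" if "t \<in> T" for t
  proof -
    show 1: "\<And>i. i \<in> {1..d} \<Longrightarrow> bil (l i) (g t) \<noteq> 0" using that by (auto simp: T_def g_def)
    from 1[of 1] d show 2: "g t \<noteq> 0" by auto
    show "abs_cproj (g t) \<notin> orb_floor d H m"
      using abs_cproj_notin_floor_iff[OF 2] 1 by (auto simp: l_def)
  qed
  have "connected T"
    unfolding T_def
  proof (rule connected_open_diff_countable)
    show "countable (\<Union>i\<in>{1..d}. {t. bil (l i) p + t * bil (l i) v = 0})"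
      using p by (intro countable_finite finite_UN_I finite_affine_roots) (auto simp: l_def)
  qed auto
  then have "?R (abs_cproj (g 0)) (abs_cproj (g 1))"
  proof (rule connected_equivalence_relation)
    show "0 \<in> T" "1 \<in> T" using p q by (auto simp: T_def l_def v_def)
    show "?R (abs_cproj (g y)) (abs_cproj (g x))"
      if "?R (abs_cproj (g x)) (abs_cproj (g y))" "x \<in> T" "y \<in> T" for x y
      using kob_bounded_sym[OF that(1)] gT that by blast
    show "?R (abs_cproj (g x)) (abs_cproj (g z))"
      if "?R (abs_cproj (g x)) (abs_cproj (g y))" "?R (abs_cproj (g y)) (abs_cproj (g z))"
        "x \<in> T" "y \<in> T" "z \<in> T" for x y z
      using kob_bounded_trans[OF that(1,2)] gT that by blast
    fix t assume t: "t \<in> T"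
    obtain eps where eps: "eps > 0" "\<And>s. cmod s < eps \<Longrightarrow> ?R (abs_cproj (g t)) (abs_cproj (g t + s *s v))"
      using kob_bounded_near[OF d gT(1,2)[OF t], of v] gT(3)[OF t] unfolding l_def by blast
    show "\<exists>U. openin (top_of_set T) U \<and> t \<in> U \<and> (\<forall>x\<in>U. ?R (abs_cproj (g t)) (abs_cproj (g x)))"
    proof (intro exI[of _ "T \<inter> ball t eps"] conjI ballI)
      fix x assume "x \<in> T \<inter> ball t eps"
      then have "cmod (x - t) < eps" by (simp add: dist_norm norm_minus_commute)
      moreover have "g t + (x - t) *s v = g x"
        by (simp add: g_def vec_eq_iff algebra_simps)
      ultimately show "?R (abs_cproj (g t)) (abs_cproj (g x))"
        using eps(2)[of "x - t"] by simp
    qed (use t eps(1) in \<open>auto simp: openin_open_Int\<close>)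
  qed
  then show ?thesis by (simp add: g_def v_def)
qed

text \<open>One disc in a generic direction moves a point off all hyperplanes.\<close>

lemma kob_bounded_all:
  fixes H :: "nat \<Rightarrow> 'k::finite cproj"
  assumes d: "d \<ge> 1" and a: "a \<notin> orb_floor d H m" and b: "b \<notin> orb_floor d H m"
  shows "kob_bounded d H m a b"
proof -
  let ?R = "kob_bounded d H m"
  obtain y where y: "\<And>i. i \<in> {1..d} \<Longrightarrow> bil (rep_cproj (H i)) y \<noteq> 0"
    using ex_vector_off_hyperplanes[of "{1..d}" "\<lambda>i. rep_cproj (H i)", OF _ rep_cproj_nz] by blast
  have gen: "\<exists>p. p \<noteq> 0 \<and> (\<forall>i\<in>{1..d}. bil (rep_cproj (H i)) p \<noteq> 0) \<and> abs_cproj p \<notin> orb_floor d H m \<and> ?R c (abs_cproj p)"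
    if c: "c \<notin> orb_floor d H m" for c
  proof -
    obtain x where x: "x \<noteq> 0" "c = abs_cproj x" by (rule cproj_cases)
    obtain eps where eps: "eps > 0" "\<And>s. cmod s < eps \<Longrightarrow> x + s *s y \<noteq> 0 \<and> ?R (abs_cproj x) (abs_cproj (x + s *s y))
        \<and> (s \<noteq> 0 \<longrightarrow> (\<forall>i\<in>{1..d}. bil (rep_cproj (H i)) (x + s *s y) \<noteq> 0))"
      using kob_bounded_near[OF d x(1) c[unfolded x(2)], of y] y by blast
    define s where "s = complex_of_real (eps / 2)"
    have s: "cmod s < eps" "s \<noteq> 0" using eps(1) by (auto simp: s_def norm_divide)
    have p: "x + s *s y \<noteq> 0" "\<forall>i\<in>{1..d}. bil (rep_cproj (H i)) (x + s *s y) \<noteq> 0"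
      "?R c (abs_cproj (x + s *s y))"
      using eps(2)[OF s(1)] s(2) x(2) by auto
    moreover have "abs_cproj (x + s *s y) \<notin> orb_floor d H m"
      using abs_cproj_notin_floor_iff[OF p(1)] p(2) by blast
    ultimately show ?thesis by blast
  qed
  obtain p where p: "p \<noteq> 0" "\<forall>i\<in>{1..d}. bil (rep_cproj (H i)) p \<noteq> 0" "abs_cproj p \<notin> orb_floor d H m" "?R a (abs_cproj p)"
    using gen[OF a] by blast
  obtain q where q: "q \<noteq> 0" "\<forall>i\<in>{1..d}. bil (rep_cproj (H i)) q \<noteq> 0" "abs_cproj q \<notin> orb_floor d H m" "?R b (abs_cproj q)"
    using gen[OF b] by blast
  have "?R (abs_cproj p) (abs_cproj q)"
    using kob_bounded_generic[OF d] p(2) q(2) by blast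
  then have "?R a (abs_cproj q)"
    using kob_bounded_trans[OF p(4) _ a p(3) q(3)] by blast
  then show ?thesis
    using kob_bounded_trans[OF _ kob_bounded_sym[OF q(4) b q(3)] a q(3) b] by blast
qed

section \<open>The largest decreasing pseudo-distance and hyperbolicity\<close>

text \<open>The supremum of all decreasing pseudo-distances is finite by the chains of discs and is
  itself decreasing, so it is the largest one; as it dominates \<open>D0\<close>, it separates
  points.\<close>

lemma kobayashi_hyperbolic_if_lower_bound:
  fixes H :: "nat \<Rightarrow> 'k::finite cproj"
  assumes d: "d \<ge> 1" and D0: "orb_decreasing_pseudo_distance d H m D0"
    and sep: "\<And>a b. D0 a b = 0 \<Longrightarrow> a = b"
  shows "kobayashi_hyperbolic d H m"
proof -
  define X where "X = - orb_floor d H m"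
  define P where "P = {D. orb_decreasing_pseudo_distance d H m D}"
  \<comment> \<open>The value 0 elsewhere makes nonnegativity and symmetry hold for all arguments,
    as \<open>Metric_space\<close> demands.\<close>
  define D where "D a b = (if a \<in> X \<and> b \<in> X then SUP D'\<in>P. D' a b else 0)" for a b
  have P: "pseudo_distance_on X D'" if "D' \<in> P" for D'
    using that by (simp add: P_def orb_decreasing_pseudo_distance_def X_def)
  have ne: "P \<noteq> {}" and D0P: "D0 \<in> P" using D0 by (auto simp: P_def)
  have bdd: "bdd_above ((\<lambda>D'. D' a b) ` P)" if "a \<in> X" "b \<in> X" for a b
  proof -
    have "a \<notin> orb_floor d H m" "b \<notin> orb_floor d H m" using that by (auto simp: X_def)
    then obtain C where "\<forall>D. orb_decreasing_pseudo_distance d H m D \<longrightarrow> D a b \<le> C"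
      using kob_bounded_all[OF d] unfolding kob_bounded_def by blast
    then show ?thesis by (intro bdd_aboveI2[where M = C]) (simp add: P_def)
  qed
  have up: "D' a b \<le> D a b" if "D' \<in> P" "a \<in> X" "b \<in> X" for D' a b
    using cSUP_upper[OF that(1) bdd[OF that(2,3)]] that by (simp add: D_def)
  have least: "D a b \<le> C" if "a \<in> X" "b \<in> X" "\<And>D'. D' \<in> P \<Longrightarrow> D' a b \<le> C" for a b C
    using cSUP_least[OF ne that(3)] that(1,2) by (simp add: D_def)
  have nonneg: "0 \<le> D a b" for a b
  proof (cases "a \<in> X \<and> b \<in> X")
    case True
    then have "0 \<le> D0 a b" using P[OF D0P] unfolding pseudo_distance_on_def by blast
    then show ?thesis using up[OF D0P, of a b] True by linarith
  qed (auto simp: D_def)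
  have comm_le: "D a b \<le> D b a" if "a \<in> X" "b \<in> X" for a b
  proof (rule least[OF that])
    fix D' assume D': "D' \<in> P"
    have "D' a b = D' b a" using P[OF D'] that unfolding pseudo_distance_on_def by blast
    then show "D' a b \<le> D b a" using up[OF D' that(2,1)] by simp
  qed
  have comm: "D a b = D b a" for a b
  proof (cases "a \<in> X \<and> b \<in> X")
    case True
    then show ?thesis using comm_le by (intro antisym) auto
  qed (auto simp: D_def)
  have refl: "D a a = 0" if "a \<in> X" for a
  proof (rule antisym[OF least[OF that that] nonneg])
    fix D' assume "D' \<in> P"
    then show "D' a a \<le> 0" using P that unfolding pseudo_distance_on_def by fastforce
  qed
  have tri: "D a c \<le> D a b + D b c" if "a \<in> X" "b \<in> X" "c \<in> X" for a b c
  proof (rule least[OF that(1,3)])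
    fix D' assume D': "D' \<in> P"
    have "D' a c \<le> D' a b + D' b c" using P[OF D'] that unfolding pseudo_distance_on_def by blast
    then show "D' a c \<le> D a b + D b c" using up[OF D' that(1,2)] up[OF D' that(2,3)] by linarith
  qed
  have "D (h z) (h w) \<le> poincare_dist z w"
    if h: "orbifold_map d H m h" and zw: "z \<in> unit_disk" "w \<in> unit_disk" for h z w
  proof (rule least)
    show "h z \<in> X" "h w \<in> X" using orbifold_map_avoids_floor[OF h] zw by (auto simp: X_def)
    show "D' (h z) (h w) \<le> poincare_dist z w" if "D' \<in> P" for D'
      using that h zw unfolding P_def orb_decreasing_pseudo_distance_def by blast
  qed
  moreover have "pseudo_distance_on X D"
    unfolding pseudo_distance_on_def using refl nonneg comm tri by blast
  ultimately have "orb_decreasing_pseudo_distance d H m D"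
    unfolding orb_decreasing_pseudo_distance_def X_def by blast
  moreover have "D' a b \<le> D a b"
    if "orb_decreasing_pseudo_distance d H m D'" "a \<in> X" "b \<in> X" for D' a b
    using up that by (simp add: P_def)
  ultimately have kob: "is_orb_kobayashi_distance d H m D"
    unfolding is_orb_kobayashi_distance_def X_def by blast
  have "Metric_space X D"
  proof
    show "(D a b = 0) = (a = b)" if "a \<in> X" "b \<in> X" for a b
    proof
      assume "D a b = 0"
      moreover have "0 \<le> D0 a b" using P[OF D0P] that unfolding pseudo_distance_on_def by blast
      ultimately have "D0 a b = 0" using up[OF D0P that] by simp
      then show "a = b" by (rule sep)
    qed (use refl that in auto)
  qed (use nonneg comm tri in auto)
  with kob show ?thesis
    unfolding kobayashi_hyperbolic_def X_def by blast
qed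

lemma spans_quadrics_if_general_position:
  fixes H :: "nat \<Rightarrow> 'k::finite cproj"
  assumes gp: "general_position_quadrics d H" and N: "N = (CARD('k) + 1) choose 2" "N \<le> d"
  shows "spans_quadrics (\<lambda>i. rep_cproj (H i)) N"
  unfolding spans_quadrics_def
proof (intro allI impI)
  fix Q :: "complex ^ 'k ^ 'k"
  assume Q: "transpose Q = Q" "\<forall>i\<in>{1..N}. (\<Sum>a\<in>UNIV. \<Sum>b\<in>UNIV. Q $ a $ b * rep_cproj (H i) $ a * rep_cproj (H i) $ b) = 0"
  show "Q = 0"
  proof (rule ccontr)
    assume "Q \<noteq> 0"
    then have "is_quadric {x. on_quadric Q x}" using Q(1) unfolding is_quadric_def by blast
    moreover have "H ` {1..N} \<subseteq> {x. on_quadric Q x}" using Q(2) by (auto simp: on_quadric_rep)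
    moreover have "{1..N} \<subseteq> {1..d}" "card {1..N} = (CARD('k) + 1) choose 2" using N by auto
    ultimately show False using gp unfolding general_position_quadrics_def by blast
  qed
qed

theorem theoremE:
  fixes n d :: nat
    and H :: "nat \<Rightarrow> 'k::finite cproj"
    and m :: "nat \<Rightarrow> ereal"
  assumes "CARD('k) = n + 1"
    and "n \<ge> 1"
    and "general_position_hyperplanes d H"
    and "general_position_quadrics d H"
    and "\<And>i. i \<in> {1..d} \<Longrightarrow> m i \<in> multiplicity_values"
    and "d \<ge> (n + 2) choose 2"
    and "\<And>i. i \<in> {1..d} \<Longrightarrow> m i \<ge> ereal (2 * real n + 2)"
  shows "kobayashi_hyperbolic d H m"
proof -
  define N where "N = (n + 2) choose 2"
  define l where "l i = rep_cproj (H i)" for i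
  have k: "CARD('k) \<ge> 2" using assms(1,2) by simp
  have N: "N = (CARD('k) + 1) choose 2" "N \<le> d" using assms(1,6) by (simp_all add: N_def)
  have "N \<ge> 1" unfolding N_def using zero_less_binomial[of 2 "n + 2"] by linarith
  then have d: "d \<ge> 1" using N(2) by linarith
  have sp: "spans_quadrics l N"
    unfolding l_def by (rule spans_quadrics_if_general_position[OF assms(4) N])
  obtain K where K: "K > 0" "\<And>h z f. orb_curve l N h \<Longrightarrow> z \<in> unit_disk \<Longrightarrow> local_lift h z f \<Longrightarrow>
      norm (tangent_part (f z) (vderiv f z)) * (1 - (cmod z)^2) \<le> K * norm (f z)"
    using orb_curve_tangent_bound[OF sp k] by blast
  define A where "A = real CARD('k) * real CARD('k) * K"
  have A: "A > 0" using K(1) by (simp add: A_def)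
  \<comment> \<open>Division by the Lipschitz constant of orbifold discs makes the projection
    distance a competitor for the Kobayashi pseudo-distance.\<close>
  define D0 where "D0 a b = proj_dist a b / A" for a b :: "'k cproj"
  have "D0 (h z) (h w) \<le> poincare_dist z w"
    if h: "orbifold_map d H m h" and zw: "z \<in> unit_disk" "w \<in> unit_disk" for h z w
  proof -
    have "real CARD('k + 'k) = 2 * real n + 2" using assms(1) by (simp add: card_UNIV_sum)
    then have oc: "orb_curve l N h"
      unfolding l_def using assms(7) by (intro orbifold_map_orb_curve[OF h N(2)]) auto
    have "proj_dist (h z) (h w) \<le> A * poincare_dist z w"
      unfolding A_def
    proof (rule proj_dist_curve_le[OF _ _ zw])
      show "\<exists>f. local_lift h y f" if "y \<in> unit_disk" for y
        using oc that unfolding orb_curve_def by blast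
    qed (rule K(2)[OF oc])
    then show ?thesis using A by (simp add: D0_def divide_le_eq mult.commute)
  qed
  moreover have "pseudo_distance_on (- orb_floor d H m) D0"
    unfolding pseudo_distance_on_def D0_def add_divide_distrib[symmetric]
    using A proj_dist_commute
    by (auto intro!: divide_right_mono proj_dist_triangle divide_nonneg_nonneg proj_dist_nonneg simp: proj_dist_self)
  ultimately have "orb_decreasing_pseudo_distance d H m D0"
    unfolding orb_decreasing_pseudo_distance_def by blast
  moreover have "a = b" if "D0 a b = 0" for a b
    using that A by (intro proj_dist_eq_0) (simp add: D0_def)
  ultimately show ?thesis
    by (rule kobayashi_hyperbolic_if_lower_bound[OF d])
qed

end
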